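(* Let $H$ be a clique on $s$ vertices. Then computing the number $\#H(G)$ of exact copies of $H$ in a factored graph $G$ is fixed parameter tractable. In particular, there is an algorithm computing $\#H(G)$ on factored graphs $G=f(G_1,\dots,G_m)$ of complexity $(n,k)$ in $O(g(s,k)\,n^{s})$ time for some function $g(s,k)$.
   Context: In this result all graphs are undirected (equivalently, directed graphs with symmetric edge sets). For graphs $G,H$: the Cartesian product $G\,\square\,H$ has vertex set $V(G)\times V(H)$ and $(v_1,u_1)\sim(v_2,u_2)$ iff either $v_1=v_2$ and $u_1\sim u_2$ in $H$, or $u_1=u_2$ and $v_1\sim v_2$ in $G$; the tensor product $G\times H$ has vertex set $V(G)\times V(H)$ and $(v_1,u_1)\sim(v_2,u_2)$ iff $v_1\sim v_2$ in $G$ and $u_1\sim u_2$ in $H$; the union $G\cup H$ has vertex set $V(G)\cup V(H)$ and edge set $E(G)\cup E(H)$. Vertices of products are flattened tuples, so products are associative. A factored graph $G=f(G_1,\dots,G_m)$ is given by a formula $f$ built from explicitly given input graphs $G_1,\dots,G_m$ using these operations and parentheses; it has complexity $(n,k)$ if $f$ uses $k-1$ operations and each input graph has at most $n$ vertices. A problem on factored graphs is fixed parameter tractable if it can be solved on factored graphs of complexity $(n,k)$ in time $O(g(k)n^C)$ for some function $g$ and absolute constant $C$ independent of $k$ (here the clique size $s$ is regarded as fixed). If $H$ has vertices $b_1,\dots,b_s$, an ordered collection $a_1,\dots,a_s$ of $s$ distinct vertices of $G$ is an exact copy of $H$ if for all $i,j\in[s]$, $a_i,a_j$ are adjacent iff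 $b_i,b_j$ are adjacent; $\#H(G)$ is the number of such ordered collections. *)

theory Defs
  imports "Graph_Theory.Kuratowski"
begin

section \<open>Operations on graphs\<close>

text \<open>
  Graphs are pair digraphs of the AFP entry Graph_Theory; an undirected graph is one with a
  symmetric arc set. The finite undirected graphs are described by the locale predicate
  \<^term>\<open>pair_pseudo_graph\<close>; it does not exclude loops.
\<close>

definition cartesian_product ::
  "'a pair_pre_digraph \<Rightarrow> 'b pair_pre_digraph \<Rightarrow> ('a \<times> 'b) pair_pre_digraph" where
  "cartesian_product G H =
    \<lparr> pverts = pverts G \<times> pverts H,
      parcs = {((v1, u1), (v2, u2)) | v1 u1 v2 u2.
        v1 = v2 \<and> v1 \<in> pverts G \<and> (u1, u2) \<in> parcs H \<or>
        u1 = u2 \<and> u1 \<in> pverts H \<and> (v1, v2) \<in> parcs G} \<rparr>"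

definition tensor_product ::
  "'a pair_pre_digraph \<Rightarrow> 'b pair_pre_digraph \<Rightarrow> ('a \<times> 'b) pair_pre_digraph" where
  "tensor_product G H =
    \<lparr> pverts = pverts G \<times> pverts H,
      parcs = {((v1, u1), (v2, u2)) | v1 u1 v2 u2.
        (v1, v2) \<in> parcs G \<and> (u1, u2) \<in> parcs H} \<rparr>"

definition graph_union ::
  "'a pair_pre_digraph \<Rightarrow> 'a pair_pre_digraph \<Rightarrow> 'a pair_pre_digraph" where
  "graph_union G H = \<lparr> pverts = pverts G \<union> pverts H, parcs = parcs G \<union> parcs H \<rparr>"

definition map_graph :: "('a \<Rightarrow> 'b) \<Rightarrow> 'a pair_pre_digraph \<Rightarrow> 'b pair_pre_digraph" where
  "map_graph f G = \<lparr> pverts = f ` pverts G, parcs = map_prod f f ` parcs G \<rparr>"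

text \<open>
  The vertices of a factored graph are flattened tuples, represented as lists of input vertices.
  A union may contain tuples of different lengths, and then a flattened tuple may arise in several
  ways from a product; two vertices are adjacent iff they are adjacent for some way of splitting
  them.
\<close>

definition flatten :: "('a list \<times> 'a list) pair_pre_digraph \<Rightarrow> 'a list pair_pre_digraph" where
  "flatten G = map_graph (\<lambda>(v, u). v @ u) G"


section \<open>Factored graphs\<close>

text \<open>\<open>Input i\<close> refers to the input graph with index \<open>i\<close>, counted from 0.\<close>

datatype formula =
    Input nat
  | Cart formula formula
  | Tensor formula formula
  | Cup formula formula

fun inputs :: "formula \<Rightarrow> nat set" where
  "inputs (Input i) = {i}"
| "inputs (Cart f1 f2) = inputs f1 \<union> inputs f2"
| "inputs (Tensor f1 f2) = inputs f1 \<union> inputs f2"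
| "inputs (Cup f1 f2) = inputs f1 \<union> inputs f2"

fun operations :: "formula \<Rightarrow> nat" where
  "operations (Input i) = 0"
| "operations (Cart f1 f2) = operations f1 + operations f2 + 1"
| "operations (Tensor f1 f2) = operations f1 + operations f2 + 1"
| "operations (Cup f1 f2) = operations f1 + operations f2 + 1"

fun denoted_graph :: "formula \<Rightarrow> 'a pair_pre_digraph list \<Rightarrow> 'a list pair_pre_digraph" where
  "denoted_graph (Input i) Gs = map_graph (\<lambda>v. [v]) (Gs ! i)"
| "denoted_graph (Cart f1 f2) Gs =
    flatten (cartesian_product (denoted_graph f1 Gs) (denoted_graph f2 Gs))"
| "denoted_graph (Tensor f1 f2) Gs =
    flatten (tensor_product (denoted_graph f1 Gs) (denoted_graph f2 Gs))"
| "denoted_graph (Cup f1 f2) Gs = graph_union (denoted_graph f1 Gs) (denoted_graph f2 Gs)"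

definition factored_graph :: "formula \<Rightarrow> 'a pair_pre_digraph list \<Rightarrow> bool" where
  "factored_graph f Gs \<longleftrightarrow>
    inputs f = {..<length Gs} \<and> (\<forall>G \<in> set Gs. pair_pseudo_graph G)"

definition has_complexity :: "formula \<Rightarrow> 'a pair_pre_digraph list \<Rightarrow> nat \<Rightarrow> nat \<Rightarrow> bool" where
  "has_complexity f Gs n k \<longleftrightarrow>
    operations f + 1 = k \<and> (\<forall>G \<in> set Gs. card (pverts G) \<le> n)"


section \<open>Exact copies\<close>

text \<open>The list \<open>bs\<close> enumerates the vertices of \<open>H\<close>.\<close>

definition exact_copies ::
  "'b pair_pre_digraph \<Rightarrow> 'b list \<Rightarrow> 'a pair_pre_digraph \<Rightarrow> 'a list set" where
  "exact_copies H bs G =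
    {as. length as = length bs \<and> distinct as \<and> set as \<subseteq> pverts G \<and>
      (\<forall>i < length bs. \<forall>j < length bs.
        (as ! i, as ! j) \<in> parcs G \<longleftrightarrow> (bs ! i, bs ! j) \<in> parcs H)}"

definition num_exact_copies ::
  "'b pair_pre_digraph \<Rightarrow> 'b list \<Rightarrow> 'a pair_pre_digraph \<Rightarrow> nat" where
  "num_exact_copies H bs G = card (exact_copies H bs G)"


section \<open>The word RAM\<close>

text \<open>
  Structured programs over finitely many registers (those occurring in the program) and a
  random-access memory. Every operation takes one time step. All numbers
  appearing in a computation with word length \<open>w\<close>, including addresses and intermediate results,
  have to be less than \<open>2 ^ w\<close>: a computation that exceeds this bound gets stuck and does not
  terminate. Subtraction is truncated at 0.
\<close>

datatype binop = Plus | Minus | Times | Divide | Modulo | Less | Equal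

datatype exp = Num nat | Reg nat | Mem exp | Bin binop exp exp

datatype com =
    Assign nat exp       \<comment> \<open>register := value\<close>
  | Store exp exp        \<comment> \<open>memory cell at address := value\<close>
  | Seq com com
  | Cond exp com com
  | While exp com

record state =
  reg :: "nat \<Rightarrow> nat"
  mem :: "nat \<Rightarrow> nat"

fun apply_binop :: "binop \<Rightarrow> nat \<Rightarrow> nat \<Rightarrow> nat" where
  "apply_binop Plus x y = x + y"
| "apply_binop Minus x y = x - y"
| "apply_binop Times x y = x * y"
| "apply_binop Divide x y = x div y"
| "apply_binop Modulo x y = x mod y"
| "apply_binop Less x y = of_bool (x < y)"
| "apply_binop Equal x y = of_bool (x = y)"

fun eval :: "state \<Rightarrow> exp \<Rightarrow> nat" where
  "eval \<sigma> (Num c) = c"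
| "eval \<sigma> (Reg r) = reg \<sigma> r"
| "eval \<sigma> (Mem e) = mem \<sigma> (eval \<sigma> e)"
| "eval \<sigma> (Bin b e1 e2) = apply_binop b (eval \<sigma> e1) (eval \<sigma> e2)"

fun cost :: "exp \<Rightarrow> nat" where
  "cost (Num c) = 1"
| "cost (Reg r) = 1"
| "cost (Mem e) = 1 + cost e"
| "cost (Bin b e1 e2) = 1 + cost e1 + cost e2"

fun fits :: "nat \<Rightarrow> state \<Rightarrow> exp \<Rightarrow> bool" where
  "fits w \<sigma> (Num c) \<longleftrightarrow> c < 2 ^ w"
| "fits w \<sigma> (Reg r) \<longleftrightarrow> reg \<sigma> r < 2 ^ w"
| "fits w \<sigma> (Mem e) \<longleftrightarrow> fits w \<sigma> e \<and> mem \<sigma> (eval \<sigma> e) < 2 ^ w"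
| "fits w \<sigma> (Bin b e1 e2) \<longleftrightarrow>
    fits w \<sigma> e1 \<and> fits w \<sigma> e2 \<and> apply_binop b (eval \<sigma> e1) (eval \<sigma> e2) < 2 ^ w"

text \<open>
  \<open>exec w c \<sigma> t \<tau>\<close>: with word length \<open>w\<close>, program \<open>c\<close> started in state \<open>\<sigma>\<close> terminates after
  exactly \<open>t\<close> steps in state \<open>\<tau>\<close>.
\<close>

inductive exec :: "nat \<Rightarrow> com \<Rightarrow> state \<Rightarrow> nat \<Rightarrow> state \<Rightarrow> bool" for w :: nat where
  Assign: "fits w \<sigma> e \<Longrightarrow>
    exec w (Assign r e) \<sigma> (1 + cost e) (\<sigma>\<lparr>reg := (reg \<sigma>)(r := eval \<sigma> e)\<rparr>)"
| Store: "fits w \<sigma> e1 \<Longrightarrow> fits w \<sigma> e2 \<Longrightarrow>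
    exec w (Store e1 e2) \<sigma> (1 + cost e1 + cost e2)
      (\<sigma>\<lparr>mem := (mem \<sigma>)(eval \<sigma> e1 := eval \<sigma> e2)\<rparr>)"
| Seq: "exec w c1 \<sigma> t1 \<sigma>' \<Longrightarrow> exec w c2 \<sigma>' t2 \<sigma>'' \<Longrightarrow> exec w (Seq c1 c2) \<sigma> (t1 + t2) \<sigma>''"
| Cond_true: "fits w \<sigma> e \<Longrightarrow> eval \<sigma> e \<noteq> 0 \<Longrightarrow> exec w c1 \<sigma> t \<sigma>' \<Longrightarrow>
    exec w (Cond e c1 c2) \<sigma> (1 + cost e + t) \<sigma>'"
| Cond_false: "fits w \<sigma> e \<Longrightarrow> eval \<sigma> e = 0 \<Longrightarrow> exec w c2 \<sigma> t \<sigma>' \<Longrightarrow>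
    exec w (Cond e c1 c2) \<sigma> (1 + cost e + t) \<sigma>'"
| While_true: "fits w \<sigma> e \<Longrightarrow> eval \<sigma> e \<noteq> 0 \<Longrightarrow> exec w c \<sigma> t1 \<sigma>' \<Longrightarrow>
    exec w (While e c) \<sigma>' t2 \<sigma>'' \<Longrightarrow> exec w (While e c) \<sigma> (1 + cost e + t1 + t2) \<sigma>''"
| While_false: "fits w \<sigma> e \<Longrightarrow> eval \<sigma> e = 0 \<Longrightarrow> exec w (While e c) \<sigma> (1 + cost e) \<sigma>"

inductive_cases exec_AssignE: "exec w (Assign r e) \<sigma> t \<tau>"
inductive_cases exec_StoreE: "exec w (Store e1 e2) \<sigma> t \<tau>"
inductive_cases exec_SeqE: "exec w (Seq c1 c2) \<sigma> t \<tau>"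
inductive_cases exec_CondE: "exec w (Cond e c1 c2) \<sigma> t \<tau>"
inductive_cases exec_WhileE: "exec w (While e c) \<sigma> t \<tau>"

lemma exec_deterministic:
  "exec w c \<sigma> t \<tau> \<Longrightarrow> exec w c \<sigma> t' \<tau>' \<Longrightarrow> t' = t \<and> \<tau>' = \<tau>"
proof (induction arbitrary: t' \<tau>' rule: exec.induct)
  case (Assign \<sigma> e r)
  then show ?case by (auto elim: exec_AssignE)
next
  case (Store \<sigma> e1 e2)
  then show ?case by (auto elim: exec_StoreE)
next
  case (Seq c1 \<sigma> t1 \<sigma>' c2 t2 \<sigma>'')
  from Seq.prems obtain r1 \<rho> r2 where r: "t' = r1 + r2"
    "exec w c1 \<sigma> r1 \<rho>" "exec w c2 \<rho> r2 \<tau>'"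
    by (rule exec_SeqE)
  then show ?case using Seq.IH(1)[OF r(2)] Seq.IH(2)[of r2 \<tau>'] by simp
next
  case (Cond_true \<sigma> e c1 t \<sigma>' c2)
  from Cond_true.prems obtain r where r: "t' = 1 + cost e + r" "exec w c1 \<sigma> r \<tau>'"
    by (rule exec_CondE) (use Cond_true.hyps in simp_all)
  then show ?case using Cond_true.IH[OF r(2)] by simp
next
  case (Cond_false \<sigma> e c2 t \<sigma>' c1)
  from Cond_false.prems obtain r where r: "t' = 1 + cost e + r" "exec w c2 \<sigma> r \<tau>'"
    by (rule exec_CondE) (use Cond_false.hyps in simp_all)
  then show ?case using Cond_false.IH[OF r(2)] by simp
next
  case (While_true \<sigma> e c t1 \<sigma>' t2 \<sigma>'')
  from While_true.prems obtain r1 \<rho> r2 where r: "t' = 1 + cost e + r1 + r2"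
    "exec w c \<sigma> r1 \<rho>" "exec w (While e c) \<rho> r2 \<tau>'"
    by (rule exec_WhileE) (use While_true.hyps in simp_all)
  then show ?case using While_true.IH(1)[OF r(2)] While_true.IH(2)[of r2 \<tau>'] by simp
next
  case (While_false \<sigma> e c)
  from While_false.prems show ?case
    by (cases rule: exec_WhileE) (use While_false.hyps in auto)
qed

text \<open>The input occupies an initial segment of the memory; everything else is 0.\<close>

definition initial_state :: "nat list \<Rightarrow> state" where
  "initial_state ws =
    \<lparr> reg = (\<lambda>_. 0), mem = (\<lambda>a. if a < length ws then ws ! a else 0) \<rparr>"


section \<open>Problems on factored graphs\<close>

fun encode_formula :: "formula \<Rightarrow> nat list" where
  "encode_formula (Input i) = [0, i]"
| "encode_formula (Cart f1 f2) = 1 # encode_formula f1 @ encode_formula f2"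
| "encode_formula (Tensor f1 f2) = 2 # encode_formula f1 @ encode_formula f2"
| "encode_formula (Cup f1 f2) = 3 # encode_formula f1 @ encode_formula f2"

text \<open>
  An input graph is given by a list of its vertices, in an arbitrary order, followed by its
  adjacency matrix, row by row. The vertices are arbitrary numbers.
\<close>

definition encodes_graph :: "nat list \<Rightarrow> nat pair_pre_digraph \<Rightarrow> bool" where
  "encodes_graph ws G \<longleftrightarrow>
    (\<exists>vs. distinct vs \<and> set vs = pverts G \<and>
      ws = length vs # vs @ [of_bool ((v, u) \<in> parcs G). v \<leftarrow> vs, u \<leftarrow> vs])"

definition encodes_factored_graph ::
  "nat list \<Rightarrow> formula \<Rightarrow> nat pair_pre_digraph list \<Rightarrow> bool" where
  "encodes_factored_graph ws f Gs \<longleftrightarrow>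
    (\<exists>wss. list_all2 encodes_graph wss Gs \<and>
      ws = length Gs # encode_formula f @ concat wss)"

text \<open>
  A problem asks for a number \<open>F G\<close>, where \<open>G\<close> is the graph denoted by a factored graph. It is
  solvable in time \<open>O(T n k)\<close> if a single program solves it on all factored graphs of every
  complexity \<open>(n, k)\<close> with \<open>n \<ge> 1\<close>. Here \<open>N\<close> bounds \<open>n\<close> and the names of the input vertices, and
  the program has to work for every word length \<open>w\<close> with \<open>h k * N ^ h k \<le> 2 ^ w\<close>, so that words of
  \<open>O(log N)\<close> bits suffice, where the constant may depend on the parameter \<open>k\<close>. This is the word RAM
  with words of logarithmic length up to a factor depending on \<open>k\<close> in the running time; it allows
  the answer, which may have \<open>\<Theta>(k log n)\<close> bits, to be delivered in register 0.
\<close>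

definition solvable_in_time ::
  "(nat list pair_pre_digraph \<Rightarrow> nat) \<Rightarrow> (nat \<Rightarrow> nat \<Rightarrow> nat) \<Rightarrow> bool" where
  "solvable_in_time F T \<longleftrightarrow>
    (\<exists>(P :: com) (c :: nat) (h :: nat \<Rightarrow> nat).
      \<forall>n k N w f Gs ws.
        1 \<le> n \<and> factored_graph f Gs \<and> has_complexity f Gs n k \<and>
        encodes_factored_graph ws f Gs \<and>
        n \<le> N \<and> (\<forall>G \<in> set Gs. \<forall>v \<in> pverts G. v \<le> N) \<and> h k * N ^ h k \<le> 2 ^ w \<longrightarrow>
        (\<exists>t \<tau>. exec w P (initial_state ws) t \<tau> \<and> t \<le> c * T n k \<and>
          reg \<tau> 0 = F (denoted_graph f Gs)))"

definition fixed_parameter_tractable :: "(nat list pair_pre_digraph \<Rightarrow> nat) \<Rightarrow> bool" where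
  "fixed_parameter_tractable F \<longleftrightarrow>
    (\<exists>(g :: nat \<Rightarrow> nat) (C :: nat). solvable_in_time F (\<lambda>n k. g k * n ^ C))"

end

theory Submission
  imports Defs
begin

text \<open>
  The algorithm distributes the work over the columns of the vertices. A factored graph is a union
  of flattened products of input graphs, and whether two tuples of the same length are adjacent
  depends only on which adjacencies, equalities and memberships hold between their entries in each
  column. So an \<open>s\<close>-tuple of vertices of length \<open>L\<close> is read as \<open>L\<close> columns, each of which is an
  \<open>s\<close>-tuple of input vertices. There are about \<open>(k n) ^ s\<close> columns, but they have only \<open>4 ^ (s\<^sup>2 m)\<close>
  different types, where \<open>m \<le> k\<close> is the number of input graphs. The program first counts the columns
  of each type, which takes time \<open>n ^ s\<close> up to a factor depending on \<open>s\<close> and \<open>k\<close>. It then runs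
  through all sequences of at most \<open>3 k\<close> types, tests whether the corresponding \<open>s\<close>-tuples are
  cliques, and sums up the products of the counts; the time for this does not depend on \<open>n\<close>.

  Distinctness of the vertices comes for free: if adjacent vertices were equal, there would be a
  loop, which an exact copy of a clique cannot contain.

  In a run of \<open>t\<close> steps all numbers stay below \<open>M ^ 2 ^ t\<close> if they are initially at most \<open>M\<close>, since a
  step at most squares them. Hence the word length needs no attention in any part of the program
  whose running time is bounded in terms of \<open>s\<close> and \<open>k\<close>.
\<close>

section \<open>Loop programs\<close>

text \<open>Two loops have a number of rounds that grows with \<open>n\<close>: the one over the
  vertices of an input graph and the one over the \<open>s\<close>-tuples of input vertices. For
  these, repeated squaring would outgrow every word length logarithmic in \<open>N\<close>. So each
  round has to return to one fixed bound \<open>M\<close>, polynomial in \<open>N\<close>, and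
  squaring is charged to a single round only. Everything after the counting takes time depending on
  \<open>s\<close> and \<open>k\<close> alone and is treated as one run. A second obstacle is that a
  union mixes tuples of different lengths, so that a flattened tuple may be split in several ways.
  The adjacency test is therefore nondeterministic, and the program tries all strings of choice
  bits. The quantity \<open>E = 3 * k\<close>, which limits lengths, bits and rounds alike, is one
  more than the length of the encoded formula. It is crude, as vertices have length at most
  \<open>k\<close>, but it is at hand in a register once the formula has been read. Loops are
  restricted to \<open>For\<close> with a bound fixed at entry: then the final state, the running
  time and the word-length condition are separate functions of the initial state.\<close>

datatype prog =
    Asg nat exp
  | Sto exp exp
  | Sq prog prog (infixr \<open>;;\<close> 55)
  | Ite exp prog prog
  | For nat exp prog

definition set_reg :: "nat \<Rightarrow> nat \<Rightarrow> state \<Rightarrow> state" where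
  "set_reg r v \<sigma> = \<sigma>\<lparr>reg := (reg \<sigma>)(r := v)\<rparr>"

definition set_mem :: "nat \<Rightarrow> nat \<Rightarrow> state \<Rightarrow> state" where
  "set_mem a v \<sigma> = \<sigma>\<lparr>mem := (mem \<sigma>)(a := v)\<rparr>"

lemma reg_set_reg [simp]: "reg (set_reg r v \<sigma>) q = (if q = r then v else reg \<sigma> q)"
  and mem_set_reg [simp]: "mem (set_reg r v \<sigma>) = mem \<sigma>"
  and reg_set_mem [simp]: "reg (set_mem a v \<sigma>) = reg \<sigma>"
  and mem_set_mem [simp]: "mem (set_mem a v \<sigma>) = (mem \<sigma>)(a := v)"
  by (simp_all add: set_reg_def set_mem_def)

fun iterate :: "(state \<Rightarrow> state) \<Rightarrow> nat \<Rightarrow> nat \<Rightarrow> state \<Rightarrow> state" where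
  "iterate F r 0 \<sigma> = set_reg r 0 \<sigma>"
| "iterate F r (Suc j) \<sigma> = set_reg r (Suc j) (F (iterate F r j \<sigma>))"

primrec run :: "prog \<Rightarrow> state \<Rightarrow> state" where
  "run (Asg r e) = (\<lambda>\<sigma>. set_reg r (eval \<sigma> e) \<sigma>)"
| "run (Sto e1 e2) = (\<lambda>\<sigma>. set_mem (eval \<sigma> e1) (eval \<sigma> e2) \<sigma>)"
| "run (p ;; q) = (\<lambda>\<sigma>. run q (run p \<sigma>))"
| "run (Ite e p q) = (\<lambda>\<sigma>. if eval \<sigma> e \<noteq> 0 then run p \<sigma> else run q \<sigma>)"
| "run (For r e p) = (\<lambda>\<sigma>. iterate (run p) r (eval \<sigma> e) \<sigma>)"

text \<open>The constants of \<open>For\<close> are those of the compiled loop: 2 for clearing the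
  counter and \<open>3 + cost e\<close> for the last, failing test; in each round
  \<open>3 + cost e\<close> for the test and 4 for the increment.\<close>

primrec time :: "prog \<Rightarrow> state \<Rightarrow> nat" where
  "time (Asg r e) = (\<lambda>\<sigma>. 1 + cost e)"
| "time (Sto e1 e2) = (\<lambda>\<sigma>. 1 + cost e1 + cost e2)"
| "time (p ;; q) = (\<lambda>\<sigma>. time p \<sigma> + time q (run p \<sigma>))"
| "time (Ite e p q) = (\<lambda>\<sigma>. 1 + cost e + (if eval \<sigma> e \<noteq> 0 then time p \<sigma> else time q \<sigma>))"
| "time (For r e p) =
    (\<lambda>\<sigma>. 5 + cost e + (\<Sum>j<eval \<sigma> e. 7 + cost e + time p (iterate (run p) r j \<sigma>)))"

text \<open>In the case of \<open>For\<close>, \<open>1 < 2 ^ w\<close> lets the increment and the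
  result of the comparison fit, while the counter never exceeds the bound of the loop.\<close>

primrec safe :: "nat \<Rightarrow> prog \<Rightarrow> state \<Rightarrow> bool" where
  "safe w (Asg r e) = (\<lambda>\<sigma>. fits w \<sigma> e)"
| "safe w (Sto e1 e2) = (\<lambda>\<sigma>. fits w \<sigma> e1 \<and> fits w \<sigma> e2)"
| "safe w (p ;; q) = (\<lambda>\<sigma>. safe w p \<sigma> \<and> safe w q (run p \<sigma>))"
| "safe w (Ite e p q) = (\<lambda>\<sigma>. fits w \<sigma> e \<and> (if eval \<sigma> e \<noteq> 0 then safe w p \<sigma> else safe w q \<sigma>))"
| "safe w (For r e p) = (\<lambda>\<sigma>. eval \<sigma> e < 2 ^ w \<and> 1 < (2::nat) ^ w \<and>
    (\<forall>j<eval \<sigma> e. safe w p (iterate (run p) r j \<sigma>)))"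

primrec writes :: "prog \<Rightarrow> nat set" where
  "writes (Asg r e) = {r}"
| "writes (Sto e1 e2) = {}"
| "writes (p ;; q) = writes p \<union> writes q"
| "writes (Ite e p q) = writes p \<union> writes q"
| "writes (For r e p) = insert r (writes p)"

primrec storeless :: "prog \<Rightarrow> bool" where
  "storeless (Asg r e) = True"
| "storeless (Sto e1 e2) = False"
| "storeless (p ;; q) \<longleftrightarrow> storeless p \<and> storeless q"
| "storeless (Ite e p q) \<longleftrightarrow> storeless p \<and> storeless q"
| "storeless (For r e p) = storeless p"

text \<open>The compiled \<open>While\<close> evaluates the loop bound anew at each test. A numeral,
  or a register that the body does not write, keeps its value from the entry of the loop and costs
  one step.\<close>

fun constant_outside :: "nat set \<Rightarrow> exp \<Rightarrow> bool" where
  "constant_outside W (Num c) = True"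
| "constant_outside W (Reg q) \<longleftrightarrow> q \<notin> W"
| "constant_outside W _ = False"

primrec well_formed :: "prog \<Rightarrow> bool" where
  "well_formed (Asg r e) = True"
| "well_formed (Sto e1 e2) = True"
| "well_formed (p ;; q) \<longleftrightarrow> well_formed p \<and> well_formed q"
| "well_formed (Ite e p q) \<longleftrightarrow> well_formed p \<and> well_formed q"
| "well_formed (For r e p) \<longleftrightarrow> r \<notin> writes p \<and> constant_outside (insert r (writes p)) e \<and> well_formed p"

primrec com_of :: "prog \<Rightarrow> com" where
  "com_of (Asg r e) = Assign r e"
| "com_of (Sto e1 e2) = Store e1 e2"
| "com_of (p ;; q) = com.Seq (com_of p) (com_of q)"
| "com_of (Ite e p q) = Cond e (com_of p) (com_of q)"
| "com_of (For r e p) = com.Seq (Assign r (Num 0))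
    (While (Bin Less (Reg r) e) (com.Seq (com_of p) (Assign r (Bin Plus (Reg r) (Num 1)))))"

lemma iterate_frame:
  assumes "\<And>\<sigma>. reg (F \<sigma>) q = reg \<sigma> q" "q \<noteq> r"
  shows "reg (iterate F r j \<sigma>) q = reg \<sigma> q"
  using assms by (induction j) auto

lemma reg_iterate [simp]: "reg (iterate F r j \<sigma>) r = j"
  by (cases j) auto

lemma run_frame: "q \<notin> writes p \<Longrightarrow> reg (run p \<sigma>) q = reg \<sigma> q"
  by (induction p arbitrary: \<sigma>) (auto simp: iterate_frame)

lemma mem_run: "storeless p \<Longrightarrow> mem (run p \<sigma>) = mem \<sigma>"
proof (induction p arbitrary: \<sigma>)
  case (For r e p)
  have "mem (iterate (run p) r j \<sigma>) = mem \<sigma>" for j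
    using For by (induction j) auto
  then show ?case by simp
qed auto

lemma eval_constant_outside:
  "constant_outside W e \<Longrightarrow> (\<And>q. q \<notin> W \<Longrightarrow> reg \<tau> q = reg \<sigma> q) \<Longrightarrow> eval \<tau> e = eval \<sigma> e"
  by (cases "(W, e)" rule: constant_outside.cases) auto

lemma eval_iterate:
  assumes "constant_outside (insert r (writes p)) e"
  shows "eval (iterate (run p) r j \<sigma>) e = eval \<sigma> e"
  using assms by (rule eval_constant_outside) (auto intro: iterate_frame run_frame)

lemma fits_constant_outside:
  "constant_outside W e \<Longrightarrow> eval \<sigma> e < 2 ^ w \<Longrightarrow> fits w \<sigma> e"
  by (cases "(W, e)" rule: constant_outside.cases) auto

lemma exec_com_of:
  "well_formed p \<Longrightarrow> safe w p \<sigma> \<Longrightarrow> exec w (com_of p) \<sigma> (time p \<sigma>) (run p \<sigma>)"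
proof (induction p arbitrary: \<sigma>)
  case (Asg r e)
  then show ?case using exec.Assign[of w \<sigma> e r] by (simp add: set_reg_def)
next
  case (Sto e1 e2)
  then show ?case using exec.Store[of w \<sigma> e1 e2] by (simp add: set_mem_def)
next
  case (Sq p q)
  then show ?case by (auto intro: exec.Seq)
next
  case (Ite e p q)
  then show ?case
    using exec.Cond_true[of w \<sigma> e "com_of p" "time p \<sigma>" "run p \<sigma>" "com_of q"]
      exec.Cond_false[of w \<sigma> e "com_of q" "time q \<sigma>" "run q \<sigma>" "com_of p"]
    by auto
next
  case (For r e p)
  let ?n = "eval \<sigma> e" and ?S = "\<lambda>j. iterate (run p) r j \<sigma>"
  let ?b = "Bin Less (Reg r) e"
  let ?body = "com.Seq (com_of p) (Assign r (Bin Plus (Reg r) (Num 1)))"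
  have r: "r \<notin> writes p" and c: "constant_outside (insert r (writes p)) e" and "well_formed p"
    using For.prems by auto
  have n: "?n < 2 ^ w" "1 < (2::nat) ^ w" and s: "\<And>j. j < ?n \<Longrightarrow> safe w p (?S j)"
    using For.prems by auto
  have fb: "fits w (?S j) ?b" and eb: "eval (?S j) ?b = of_bool (j < ?n)" if "j \<le> ?n" for j
    using that n fits_constant_outside[OF c, of "?S j" w] by (auto simp: eval_iterate[OF c])
  \<comment> \<open>Induction downwards from the last round: a big-step derivation of a while loop
    is built from its end, so the claim is about the loop started after \<open>j\<close>
    rounds.\<close>
  have "exec w (While ?b ?body) (?S j)
     ((3 + cost e) + (\<Sum>i\<in>{j..<?n}. 7 + cost e + time p (?S i))) (?S ?n)" if "j \<le> ?n" for j
    using that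
  proof (induction rule: inc_induct)
    case base
    then show ?case
      using exec.While_false[of w "?S ?n" ?b ?body] fb[of ?n] eb[of ?n] by (simp add: eval_nat_numeral)
  next
    case (step j)
    have "exec w (com_of p) (?S j) (time p (?S j)) (run p (?S j))"
      using For.IH \<open>well_formed p\<close> s step by blast
    moreover have "exec w (Assign r (Bin Plus (Reg r) (Num 1))) (run p (?S j)) 4 (?S (Suc j))"
      using exec.Assign[of w "run p (?S j)" "Bin Plus (Reg r) (Num 1)" r] step n
        run_frame[OF r, of "?S j"]
      by (simp add: set_reg_def eval_nat_numeral)
    ultimately have "exec w ?body (?S j) (time p (?S j) + 4) (?S (Suc j))"
      by (rule exec.Seq)
    then have "exec w (While ?b ?body) (?S j) (1 + cost ?b + (time p (?S j) + 4) +
        ((3 + cost e) + (\<Sum>i\<in>{Suc j..<?n}. 7 + cost e + time p (?S i)))) (?S ?n)"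
      using step eb[of j] fb[of j] by (intro exec.While_true) auto
    also have "1 + cost ?b + (time p (?S j) + 4) +
        ((3 + cost e) + (\<Sum>i\<in>{Suc j..<?n}. 7 + cost e + time p (?S i))) =
        (3 + cost e) + (\<Sum>i\<in>{j..<?n}. 7 + cost e + time p (?S i))"
      using step by (simp add: sum.atLeast_Suc_lessThan)
    finally show ?case .
  qed
  from this[of 0] have "exec w (While ?b ?body) (?S 0)
     ((3 + cost e) + (\<Sum>i<?n. 7 + cost e + time p (?S i))) (?S ?n)"
    by (simp add: atLeast0LessThan)
  moreover have "exec w (Assign r (Num 0)) \<sigma> 2 (?S 0)"
    using exec.Assign[of w \<sigma> "Num 0" r] by (simp add: set_reg_def eval_nat_numeral)
  ultimately have "exec w (com_of (For r e p)) \<sigma>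
     (2 + ((3 + cost e) + (\<Sum>i<?n. 7 + cost e + time p (?S i)))) (?S ?n)"
    using exec.Seq by fastforce
  then show ?case by (simp add: add.assoc)
qed

text \<open>
  Ite no register used as a loop bound is ever written, the number of iterations of each loop is
  known from the initial state.
\<close>

primrec bound_regs :: "prog \<Rightarrow> nat set" where
  "bound_regs (Asg r e) = {}"
| "bound_regs (Sto e1 e2) = {}"
| "bound_regs (p ;; q) = bound_regs p \<union> bound_regs q"
| "bound_regs (Ite e p q) = bound_regs p \<union> bound_regs q"
| "bound_regs (For r e p) = (case e of Reg q \<Rightarrow> {q} | _ \<Rightarrow> {}) \<union> bound_regs p"

fun bound_value :: "(nat \<Rightarrow> nat) \<Rightarrow> exp \<Rightarrow> nat" where
  "bound_value \<rho> (Num c) = c"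
| "bound_value \<rho> (Reg q) = \<rho> q"
| "bound_value \<rho> _ = 0"

primrec static_time :: "(nat \<Rightarrow> nat) \<Rightarrow> prog \<Rightarrow> nat" where
  "static_time \<rho> (Asg r e) = 1 + cost e"
| "static_time \<rho> (Sto e1 e2) = 1 + cost e1 + cost e2"
| "static_time \<rho> (p ;; q) = static_time \<rho> p + static_time \<rho> q"
| "static_time \<rho> (Ite e p q) = 1 + cost e + static_time \<rho> p + static_time \<rho> q"
| "static_time \<rho> (For r e p) = 5 + cost e + bound_value \<rho> e * (7 + cost e + static_time \<rho> p)"

text \<open>\<open>W\<close> stands for the registers written by the whole program. The induction
  descends to parts, and a bound register of the second part of a sequence must also survive the
  first part.\<close>

lemma time_le_static_time_aux:
  assumes "well_formed p" "bound_regs p \<inter> W = {}" "writes p \<subseteq> W" "\<And>q. q \<in> bound_regs p \<Longrightarrow> reg \<sigma> q \<le> \<rho> q"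
  shows "time p \<sigma> \<le> static_time \<rho> p"
  using assms
proof (induction p arbitrary: \<sigma>)
  case (Sq p q)
  have "time p \<sigma> \<le> static_time \<rho> p" using Sq by auto
  moreover have "time q (run p \<sigma>) \<le> static_time \<rho> q"
  proof (rule Sq.IH)
    show "reg (run p \<sigma>) x \<le> \<rho> x" if "x \<in> bound_regs q" for x
      using that Sq.prems run_frame[of x p \<sigma>] by fastforce
  qed (use Sq.prems in auto)
  ultimately show ?case by simp
next
  case (Ite e p q)
  then have "time p \<sigma> \<le> static_time \<rho> p" "time q \<sigma> \<le> static_time \<rho> q" by auto
  then show ?case by simp
next
  case (For r e p)
  let ?S = "\<lambda>j. iterate (run p) r j \<sigma>"
  have "reg (?S j) x = reg \<sigma> x" if "x \<in> bound_regs p" for j x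
    using that For.prems by (intro iterate_frame run_frame) auto
  then have "time p (?S j) \<le> static_time \<rho> p" for j
    using For.prems by (intro For.IH) auto
  then have "(\<Sum>j<eval \<sigma> e. 7 + cost e + time p (?S j)) \<le> eval \<sigma> e * (7 + cost e + static_time \<rho> p)"
    using sum_bounded_above[of "{..<eval \<sigma> e}" "\<lambda>j. 7 + cost e + time p (?S j)"
        "7 + cost e + static_time \<rho> p"] by simp
  moreover have "eval \<sigma> e \<le> bound_value \<rho> e"
    using For.prems by (cases e) auto
  ultimately show ?case
    by (simp del: sum.distrib) (meson le_trans mult_le_mono1)
qed auto

lemma time_le_static_time:
  assumes "well_formed p" "bound_regs p \<inter> writes p = {}" "\<And>q. q \<in> bound_regs p \<Longrightarrow> reg \<sigma> q \<le> \<rho> q"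
  shows "time p \<sigma> \<le> static_time \<rho> p"
  using time_le_static_time_aux[of p "writes p"] assms by auto

subsection \<open>Word length\<close>

definition bounded_by :: "nat \<Rightarrow> state \<Rightarrow> bool" where
  "bounded_by M \<sigma> \<longleftrightarrow> (\<forall>r. reg \<sigma> r \<le> M) \<and> (\<forall>a. mem \<sigma> a \<le> M)"

fun exp_consts :: "exp \<Rightarrow> nat set" where
  "exp_consts (Num c) = {c}"
| "exp_consts (Reg r) = {}"
| "exp_consts (Mem e) = exp_consts e"
| "exp_consts (Bin b e1 e2) = exp_consts e1 \<union> exp_consts e2"

primrec consts_of :: "prog \<Rightarrow> nat set" where
  "consts_of (Asg r e) = exp_consts e"
| "consts_of (Sto e1 e2) = exp_consts e1 \<union> exp_consts e2"
| "consts_of (p ;; q) = consts_of p \<union> consts_of q"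
| "consts_of (Ite e p q) = exp_consts e \<union> consts_of p \<union> consts_of q"
| "consts_of (For r e p) = exp_consts e \<union> consts_of p"

lemma bounded_by_mono: "bounded_by M \<sigma> \<Longrightarrow> M \<le> M' \<Longrightarrow> bounded_by M' \<sigma>"
  by (meson bounded_by_def le_trans)

lemma bounded_by_set_reg: "bounded_by M \<sigma> \<Longrightarrow> v \<le> M \<Longrightarrow> bounded_by M (set_reg r v \<sigma>)"
  by (auto simp: bounded_by_def)

lemma bounded_by_set_mem: "bounded_by M \<sigma> \<Longrightarrow> v \<le> M \<Longrightarrow> bounded_by M (set_mem a v \<sigma>)"
  by (auto simp: bounded_by_def)

lemma cost_pos: "1 \<le> cost e"
  by (induction e) auto


lemma apply_binop_le: "apply_binop b x y \<le> max 1 (max (x + y) (x * y))"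
proof (cases b)
  case Divide
  then show ?thesis using div_le_dividend[of x y] by (simp add: le_max_iff_disj trans_le_add1)
next
  case Modulo
  then show ?thesis using mod_less_eq_dividend[of x y] by (simp add: le_max_iff_disj trans_le_add1)
qed (auto simp: le_max_iff_disj)

text \<open>The result of squaring \<open>M\<close> exactly \<open>t\<close> times. Its additivity
  in \<open>t\<close> is what makes the bounds of consecutive program parts compose.\<close>

definition tower :: "nat \<Rightarrow> nat \<Rightarrow> nat" where
  "tower M t = M ^ 2 ^ t"

lemma tower_0: "tower M 0 = M"
  and tower_square: "tower M a * tower M a = tower M (Suc a)"
  and tower_tower: "tower (tower M a) b = tower M (a + b)"
  by (simp_all add: tower_def power_add[symmetric] power_mult[symmetric] mult_2)

lemma tower_mono: "2 \<le> M \<Longrightarrow> a \<le> b \<Longrightarrow> tower M a \<le> tower M b"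
  unfolding tower_def by (rule power_increasing) (auto intro: power_increasing)

lemma tower_ge: "2 \<le> M \<Longrightarrow> M \<le> tower M a"
  using tower_mono[of M 0 a] by (simp add: tower_0)

text \<open>As \<open>2 \<le> M\<close>, the square of a bound dominates sums as well as products,
  so a binary operation accounts for one squaring. Leaves need none, hence the offset
  \<open>Suc t\<close>.\<close>

lemma eval_le:
  assumes "bounded_by M \<sigma>" "exp_consts e \<subseteq> {..M}" "2 \<le> M" "cost e \<le> Suc t"
  shows "eval \<sigma> e \<le> tower M t"
  using assms
proof (induction e arbitrary: t)
  case (Bin b e1 e2)
  let ?x = "eval \<sigma> e1" and ?y = "eval \<sigma> e2"
  obtain t' where t': "t = Suc t'" "cost e1 \<le> Suc t'" "cost e2 \<le> Suc t'"
    using Bin.prems(4) cost_pos[of e1] cost_pos[of e2] by (cases t) auto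
  then have xy: "?x \<le> tower M t'" "?y \<le> tower M t'" using Bin by auto
  have z: "2 \<le> tower M t'" using tower_ge[OF \<open>2 \<le> M\<close>] \<open>2 \<le> M\<close> le_trans by blast
  have "?x * ?y \<le> tower M t' * tower M t'" using xy by (rule mult_le_mono)
  moreover have "?x + ?y \<le> 2 * tower M t'" using xy by linarith
  moreover have "2 * tower M t' \<le> tower M t' * tower M t'" using z by (rule mult_le_mono1)
  ultimately show ?case
    using apply_binop_le[of b ?x ?y] z by (simp add: tower_square t')
next
  case (Num c)
  then show ?case using tower_ge[OF \<open>2 \<le> M\<close>, of t] by simp
next
  case (Reg r)
  then show ?case using tower_ge[OF \<open>2 \<le> M\<close>, of t] by (auto simp: bounded_by_def intro: order_trans)
next
  case (Mem e)
  then show ?case using tower_ge[OF \<open>2 \<le> M\<close>, of t] by (auto simp: bounded_by_def intro: order_trans)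
qed

lemma fits_if_bounded:
  assumes "bounded_by M \<sigma>" "exp_consts e \<subseteq> {..M}" "2 \<le> M" "cost e \<le> Suc t" "tower M t < 2 ^ w"
  shows "fits w \<sigma> e"
  using assms
proof (induction e)
  case (Mem e)
  then show ?case using eval_le[of M \<sigma> "Mem e" t] by auto
next
  case (Bin b e1 e2)
  then show ?case using eval_le[of M \<sigma> "Bin b e1 e2" t] by auto
qed (use tower_ge[OF \<open>2 \<le> M\<close>, of t] in \<open>auto simp: bounded_by_def intro: le_less_trans order_trans\<close>)

text \<open>The induction generalises over \<open>M\<close>: what follows a program part starts from
  the tower that this part has reached, and \<open>tower_tower\<close> recombines the two exponents.
  In a loop the time spent up to round \<open>j\<close> plays the role of \<open>t\<close>.\<close>

lemma safe_if_bounded: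
  assumes "well_formed p" "bounded_by M \<sigma>" "consts_of p \<subseteq> {..M}" "2 \<le> M"
    "time p \<sigma> \<le> t" "tower M t < 2 ^ w"
  shows "safe w p \<sigma> \<and> bounded_by (tower M t) (run p \<sigma>)"
  using assms
proof (induction p arbitrary: M \<sigma> t)
  case (Asg r e)
  have "cost e \<le> Suc t" using Asg.prems by simp
  then show ?case
    using Asg.prems fits_if_bounded[of M \<sigma> e t w] eval_le[of M \<sigma> e t] tower_ge[of M t]
    by (auto intro!: bounded_by_set_reg intro: bounded_by_mono)
next
  case (Sto e1 e2)
  have "cost e1 \<le> Suc t" "cost e2 \<le> Suc t" using Sto.prems by simp_all
  then show ?case
    using Sto.prems fits_if_bounded[of M \<sigma> e1 t w] fits_if_bounded[of M \<sigma> e2 t w]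
      eval_le[of M \<sigma> e2 t] tower_ge[of M t]
    by (auto intro!: bounded_by_set_mem intro: bounded_by_mono)
next
  case (Sq p q)
  let ?t = "time p \<sigma>" and ?M = "tower M (time p \<sigma>)"
  have t: "?t \<le> t" using Sq.prems(5) by simp
  have M: "M \<le> ?M" by (rule tower_ge[OF Sq.prems(4)])
  have "?M \<le> tower M t" using Sq.prems(4) t by (rule tower_mono)
  then have "?M < 2 ^ w" using Sq.prems(6) by linarith
  then have 1: "safe w p \<sigma>" "bounded_by ?M (run p \<sigma>)"
    using Sq.IH(1)[of M \<sigma> ?t] Sq.prems by auto
  have e: "tower ?M (t - ?t) = tower M t"
    using t by (simp add: tower_tower)
  have "safe w q (run p \<sigma>) \<and> bounded_by (tower ?M (t - ?t)) (run q (run p \<sigma>))"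
  proof (rule Sq.IH(2))
    show "consts_of q \<subseteq> {..?M}" using Sq.prems(3) M by fastforce
    show "time q (run p \<sigma>) \<le> t - ?t" using Sq.prems(5) by simp
  qed (use Sq.prems 1 M e in auto)
  then show ?case using 1 e by simp
next
  case (Ite e p q)
  have "cost e \<le> Suc t" using Ite.prems(5) by simp
  then have "fits w \<sigma> e"
    using fits_if_bounded[of M \<sigma> e t w] Ite.prems by auto
  then show ?case
    using Ite.IH(1)[of M \<sigma> t] Ite.IH(2)[of M \<sigma> t] Ite.prems by auto
next
  case (For r e p)
  let ?n = "eval \<sigma> e" and ?S = "\<lambda>j. iterate (run p) r j \<sigma>"
  let ?t = "\<lambda>j. 5 + cost e + (\<Sum>i<j. 7 + cost e + time p (?S i))"
  have wf: "well_formed p" using For.prems by auto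
  have t: "?t j \<le> t" if "j \<le> ?n" for j
  proof -
    have "?t j \<le> ?t ?n" using that by (intro add_left_mono sum_mono2) auto
    then show ?thesis using For.prems(5) by simp
  qed
  have main: "bounded_by (tower M (?t j)) (?S j) \<and> (\<forall>i<j. safe w p (?S i))" if "j \<le> ?n" for j
    using that
  proof (induction j)
    case 0
    have "M \<le> tower M (?t 0)" by (rule tower_ge[OF For.prems(4)])
    then show ?case using For.prems(2)
      by (auto intro!: bounded_by_set_reg intro: bounded_by_mono)
  next
    case (Suc j)
    let ?M = "tower M (?t j)" and ?T = "time p (?S j)"
    have M: "M \<le> ?M" by (rule tower_ge[OF For.prems(4)])
    have le: "?t j + ?T \<le> ?t (Suc j)" by simp
    then have "?t j + ?T \<le> t" using t[OF Suc.prems] by linarith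
    then have "tower M (?t j + ?T) \<le> tower M t" by (rule tower_mono[OF For.prems(4)])
    then have lt: "tower ?M ?T < 2 ^ w" using For.prems(6) by (simp add: tower_tower)
    have s: "safe w p (?S j) \<and> bounded_by (tower ?M ?T) (run p (?S j))"
    proof (rule For.IH[OF wf])
      show "consts_of p \<subseteq> {..?M}" using For.prems(3) M by fastforce
      show "2 \<le> ?M" using M For.prems(4) by linarith
    qed (use Suc lt in auto)
    have "tower ?M ?T \<le> tower M (?t (Suc j))"
      unfolding tower_tower using le by (rule tower_mono[OF For.prems(4)])
    then have b: "bounded_by (tower M (?t (Suc j))) (run p (?S j))"
      using s bounded_by_mono by blast
    \<comment> \<open>The loop counter is a written value too. It is covered because every round
      takes at least one step and a tower is at least as large as its index.\<close>
    have "(\<Sum>i<Suc j. 1) \<le> (\<Sum>i<Suc j. 7 + cost e + time p (?S i))"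
      by (intro sum_mono) auto
    then have "Suc j \<le> ?t (Suc j)" by simp
    also have "\<dots> \<le> tower M (?t (Suc j))"
    proof -
      have "a \<le> tower M a" for a
        unfolding tower_def using For.prems(4)
        by (metis less_exp less_or_eq_imp_le order_trans power_gt_expt Suc_le_lessD numeral_2_eq_2)
      then show ?thesis .
    qed
    finally have "bounded_by (tower M (?t (Suc j))) (?S (Suc j))"
      using b by (simp only: iterate.simps bounded_by_set_reg)
    then show ?case using Suc s by (auto simp: less_Suc_eq)
  qed
  have "?n \<le> tower M t" using For.prems by (intro eval_le) auto
  moreover have "2 \<le> tower M t" using tower_ge[OF For.prems(4), of t] For.prems(4) by linarith
  moreover have "bounded_by (tower M t) (?S ?n)"
    using main[of ?n] tower_mono[OF For.prems(4) t[of ?n]] bounded_by_mono by blast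
  ultimately show ?case using main[of ?n] For.prems(6) by simp
qed

text \<open>The rule for loops whose number of rounds depends on \<open>n\<close>, where the
  invariant itself has to control the size of the numbers. The constants 6 and 8 come from
  \<open>time\<close>, since a loop bound costs one step.\<close>

lemma For_invariant:
  assumes "well_formed (For r e p)" and n: "eval \<sigma> e = n" "n < 2 ^ w" "1 < (2::nat) ^ w"
    and init: "I 0 (set_reg r 0 \<sigma>)"
    and step: "\<And>j \<sigma>'. j < n \<Longrightarrow> I j \<sigma>' \<Longrightarrow> reg \<sigma>' r = j \<Longrightarrow>
      I (Suc j) (set_reg r (Suc j) (run p \<sigma>')) \<and> safe w p \<sigma>' \<and> time p \<sigma>' \<le> T"
  shows "I n (run (For r e p) \<sigma>) \<and> safe w (For r e p) \<sigma> \<and>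
    time (For r e p) \<sigma> \<le> 6 + n * (8 + T)"
proof -
  let ?S = "\<lambda>j. iterate (run p) r j \<sigma>"
  have inv: "I j (?S j)" if "j \<le> n" for j
    using that by (induction j) (use init step in auto)
  have s: "safe w p (?S j)" and t: "time p (?S j) \<le> T" if "j < n" for j
    using step[OF that inv] that by auto
  have e: "cost e \<le> 1" using assms(1) by (cases e) auto
  have "(\<Sum>j<n. 7 + cost e + time p (?S j)) \<le> n * (8 + T)"
  proof -
    have "7 + cost e + time p (?S j) \<le> 8 + T" if "j < n" for j
      using t[OF that] e by linarith
    then show ?thesis
      using sum_bounded_above[of "{..<n}" "\<lambda>j. 7 + cost e + time p (?S j)" "8 + T"] by simp
  qed
  then have "5 + cost e + (\<Sum>j<n. 7 + cost e + time p (?S j)) \<le> 6 + n * (8 + T)"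
    using e by linarith
  then show ?thesis using inv[of n] s n by simp
qed

section \<open>Positional notation\<close>

text \<open>The least significant digit comes first, so that consuming the leading columns of a
  tuple is a division by a power of the base.\<close>

fun dvalue :: "nat \<Rightarrow> nat list \<Rightarrow> nat" where
  "dvalue b [] = 0"
| "dvalue b (x # xs) = x + b * dvalue b xs"

lemma dvalue_snoc: "dvalue b (xs @ [x]) = dvalue b xs + b ^ length xs * x"
  by (induction xs) (auto simp: algebra_simps)

lemma dvalue_less: "set xs \<subseteq> {..<b} \<Longrightarrow> dvalue b xs < b ^ length xs"
proof (induction xs)
  case (Cons x xs)
  then have "x < b" "Suc (dvalue b xs) \<le> b ^ length xs" by auto
  then have "x + b * dvalue b xs < b * Suc (dvalue b xs)" by simp
  also have "\<dots> \<le> b * b ^ length xs" using Cons by (intro mult_le_mono2) auto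
  finally show ?case by simp
qed simp

lemma dvalue_div_mod:
  "set xs \<subseteq> {..<b} \<Longrightarrow> c < length xs \<Longrightarrow> dvalue b xs div b ^ c mod b = xs ! c"
proof (induction xs arbitrary: c)
  case (Cons x xs)
  then have "x < b" by simp
  then show ?case using Cons by (cases c) (auto simp: div_mult2_eq)
qed simp

lemma dvalue_digits: "T < b ^ L \<Longrightarrow> dvalue b (map (\<lambda>c. T div b ^ c mod b) [0..<L]) = T"
proof (induction L arbitrary: T)
  case (Suc L)
  have "T div b < b ^ L" using Suc.prems by (simp add: less_mult_imp_div_less mult.commute)
  moreover have "map (\<lambda>c. T div b ^ c mod b) [0..<Suc L] =
      T mod b # map (\<lambda>c. T div b div b ^ c mod b) [0..<L]"
    by (simp add: upt_conv_Cons map_Suc_upt[symmetric] div_mult2_eq del: upt_Suc)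
  ultimately show ?case using Suc.IH[of "T div b"] by (simp del: upt_Suc)
qed simp

lemma bij_betw_dvalue:
  "bij_betw (dvalue b) {xs. length xs = L \<and> set xs \<subseteq> {..<b}} {..<b ^ L}"
proof (rule bij_betw_byWitness[where f' = "\<lambda>T. map (\<lambda>c. T div b ^ c mod b) [0..<L]"])
  show "\<forall>xs\<in>{xs. length xs = L \<and> set xs \<subseteq> {..<b}}.
      map (\<lambda>c. dvalue b xs div b ^ c mod b) [0..<L] = xs"
    by (auto intro!: nth_equalityI simp: dvalue_div_mod)
  show "\<forall>T\<in>{..<b ^ L}. dvalue b (map (\<lambda>c. T div b ^ c mod b) [0..<L]) = T"
    by (simp add: dvalue_digits)
  show "dvalue b ` {xs. length xs = L \<and> set xs \<subseteq> {..<b}} \<subseteq> {..<b ^ L}"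
    using dvalue_less by auto
  show "(\<lambda>T. map (\<lambda>c. T div b ^ c mod b) [0..<L]) ` {..<b ^ L} \<subseteq>
      {xs. length xs = L \<and> set xs \<subseteq> {..<b}}"
  proof (clarsimp)
    fix T i assume "T < b ^ L" "i < L"
    then have "b \<noteq> 0" by (cases b; cases L) auto
    then show "T div b ^ i mod b < b" by simp
  qed
qed

lemma card_lists_map_eq:
  assumes "finite A"
  shows "card {ts. set ts \<subseteq> A \<and> map \<phi> ts = xs} = prod_list (map (\<lambda>x. card {t \<in> A. \<phi> t = x}) xs)"
proof (induction xs)
  case Nil
  have "{ts. set ts \<subseteq> A \<and> map \<phi> ts = []} = {[]}" by auto
  then show ?case by simp
next
  case (Cons x xs)
  have "{ts. set ts \<subseteq> A \<and> map \<phi> ts = x # xs} =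
      (\<lambda>(t, ts). t # ts) ` ({t \<in> A. \<phi> t = x} \<times> {ts. set ts \<subseteq> A \<and> map \<phi> ts = xs})"
    by (auto simp: image_iff map_eq_Cons_conv)
  then have "card {ts. set ts \<subseteq> A \<and> map \<phi> ts = x # xs} =
      card ({t \<in> A. \<phi> t = x} \<times> {ts. set ts \<subseteq> A \<and> map \<phi> ts = xs})"
    by (simp add: card_image inj_on_def)
  then show ?case using Cons by (simp add: card_cartesian_product)
qed

text \<open>The lists are grouped by their sequences of \<open>\<phi>\<close>-values, on which
  \<open>P\<close> alone depends. Each group is a product of fibres of \<open>\<phi>\<close>, and
  numbers below \<open>b ^ L\<close> enumerate the groups.\<close>

lemma card_lists_by_dvalue:
  assumes "finite A" and \<phi>: "\<And>t. t \<in> A \<Longrightarrow> \<phi> t < b"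
  shows "card {ts. length ts = L \<and> set ts \<subseteq> A \<and> P (dvalue b (map \<phi> ts))} =
    (\<Sum>T<b ^ L. if P T then \<Prod>c<L. card {t \<in> A. \<phi> t = T div b ^ c mod b} else 0)"
proof -
  let ?X = "{xs. length xs = L \<and> set xs \<subseteq> {..<b}}"
  let ?F = "\<lambda>xs. {ts. set ts \<subseteq> A \<and> map \<phi> ts = xs}"
  have fin: "finite ?X" using finite_lists_length_eq[of "{..<b}" L] by (simp add: conj_commute)
  have finF: "finite (?F xs)" for xs
    by (rule finite_subset[OF _ finite_lists_length_eq[OF assms(1), of "length xs"]]) auto
  have "{ts. length ts = L \<and> set ts \<subseteq> A \<and> P (dvalue b (map \<phi> ts))} =
      (\<Union>xs\<in>{xs \<in> ?X. P (dvalue b xs)}. ?F xs)"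
    using \<phi> by (auto simp: subset_iff)
  also have "card \<dots> = (\<Sum>xs\<in>{xs \<in> ?X. P (dvalue b xs)}. card (?F xs))"
    using finF by (intro card_UN_disjoint finite_subset[OF _ fin]) auto
  also have "\<dots> = (\<Sum>xs\<in>?X. if P (dvalue b xs) then card (?F xs) else 0)"
    by (rule sum.inter_filter[OF fin])
  also have "\<dots> = (\<Sum>xs\<in>?X. if P (dvalue b xs)
      then \<Prod>c<L. card {t \<in> A. \<phi> t = dvalue b xs div b ^ c mod b} else 0)"
  proof (rule sum.cong[OF refl])
    fix xs assume xs: "xs \<in> ?X"
    have "card (?F xs) = prod_list (map (\<lambda>x. card {t \<in> A. \<phi> t = x}) xs)"
      by (rule card_lists_map_eq[OF assms(1)])
    also have "\<dots> = (\<Prod>c<L. card {t \<in> A. \<phi> t = xs ! c})"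
      using xs by (auto simp: prod.list_conv_set_nth atLeast0LessThan)
    also have "\<dots> = (\<Prod>c<L. card {t \<in> A. \<phi> t = dvalue b xs div b ^ c mod b})"
      using xs by (intro prod.cong refl) (simp add: dvalue_div_mod)
    finally show "(if P (dvalue b xs) then card (?F xs) else 0) = (if P (dvalue b xs)
      then \<Prod>c<L. card {t \<in> A. \<phi> t = dvalue b xs div b ^ c mod b} else 0)" by simp
  qed
  also have "\<dots> = (\<Sum>T<b ^ L. if P T then \<Prod>c<L. card {t \<in> A. \<phi> t = T div b ^ c mod b} else 0)"
    using sum.reindex_bij_betw[OF bij_betw_dvalue[where b = b and L = L],
        of "\<lambda>T. if P T then \<Prod>c<L. card {t \<in> A. \<phi> t = T div b ^ c mod b} else 0"] by simp
  finally show ?thesis .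
qed

section \<open>Deciding adjacency in a factored graph\<close>

text \<open>
  Adjacency of two tuples is decided by reading the formula from left to right, consuming one
  column of the tuples at each input graph. A subformula is read in mode 1 if the corresponding
  segments have to be adjacent, in mode 2 if they have to be equal and a vertex, and in mode 3 if
  the subformula is not used and has to consume nothing. At each operation one bit selects how the
  mode is passed on to the operands.
\<close>

definition node :: "nat \<Rightarrow> formula \<Rightarrow> formula \<Rightarrow> formula" where
  "node tok = (if tok = 1 then Cart else if tok = 2 then Tensor else Cup)"

lemma node_induct [case_names Input node]:
  assumes "\<And>i. P (Input i)"
    and "\<And>tok f1 f2. tok \<in> {1, 2, 3} \<Longrightarrow> P f1 \<Longrightarrow> P f2 \<Longrightarrow> P (node tok f1 f2)"
  shows "P f"
proof (induction f)
  case (Cart f1 f2)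
  then show ?case using assms(2)[of 1 f1 f2] by (simp add: node_def)
next
  case (Tensor f1 f2)
  then show ?case using assms(2)[of 2 f1 f2] by (simp add: node_def)
next
  case (Cup f1 f2)
  then show ?case using assms(2)[of 3 f1 f2] by (simp add: node_def)
qed (rule assms(1))

lemma operations_node [simp]: "operations (node tok f1 f2) = operations f1 + operations f2 + 1"
  and inputs_node [simp]: "inputs (node tok f1 f2) = inputs f1 \<union> inputs f2"
  and encode_node: "tok \<in> {1, 2, 3} \<Longrightarrow>
    encode_formula (node tok f1 f2) = tok # encode_formula f1 @ encode_formula f2"
  by (auto simp: node_def)

text \<open>In a Cartesian product adjacency holds through one factor while the other is fixed: mode
  1 splits into modes 1 and 2, and the bit tells which operand is fixed. The operand of a union that
  is passed over gets mode 3. Otherwise a requirement on a product is the same requirement on both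
  factors.\<close>

definition left_mode :: "nat \<Rightarrow> nat \<Rightarrow> nat \<Rightarrow> nat" where
  "left_mode tok M ch = (if tok = 3 then if ch = 0 then 3 else M
     else if tok = 1 \<and> M = 1 \<and> ch \<noteq> 0 then 2 else M)"

definition right_mode :: "nat \<Rightarrow> nat \<Rightarrow> nat \<Rightarrow> nat" where
  "right_mode tok M ch = (if tok = 3 then if ch = 0 then M else 3
     else if tok = 1 \<and> M = 1 \<and> ch = 0 then 2 else M)"

text \<open>The lower bit of the digit records adjacency, the upper one equality at a vertex of the
  input graph. Both may be set, as input graphs may have loops; hence base 4.\<close>

definition leaf :: "nat \<Rightarrow> nat \<Rightarrow> nat \<Rightarrow> nat \<Rightarrow> nat \<Rightarrow> nat" where
  "leaf D b i M X = (let d = X mod b div D div 4 ^ i mod 4 in if M = 1 then d mod 2 else d div 2)"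

definition pass_operands :: "nat \<Rightarrow> (nat \<Rightarrow> nat \<times> 'a \<Rightarrow> 'b) \<Rightarrow> (nat \<Rightarrow> 'b \<Rightarrow> 'c) \<Rightarrow> nat \<Rightarrow> nat \<times> 'a \<Rightarrow> 'c" where
  "pass_operands tok p1 p2 M s = (let ch = fst s mod 2 in
     p2 (right_mode tok M ch) (p1 (left_mode tok M ch) (fst s div 2, snd s)))"

text \<open>The state consists of the remaining choice bits, the remaining columns, the number of
  columns consumed and a product of test results, which is 0 once a test has failed. Every node
  takes one bit, inputs included, so the alignment of bits and nodes does not depend on the choices
  made.\<close>

primrec pass :: "nat \<Rightarrow> nat \<Rightarrow> formula \<Rightarrow> nat \<Rightarrow> nat \<times> nat \<times> nat \<times> nat \<Rightarrow> nat \<times> nat \<times> nat \<times> nat" where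
  "pass D b (Input i) = (\<lambda>M (bits, X, c, g).
    if M = 3 then (bits div 2, X, c, g) else (bits div 2, X div b, c + 1, g * leaf D b i M X))"
| "pass D b (Cart f1 f2) = pass_operands 1 (pass D b f1) (pass D b f2)"
| "pass D b (Tensor f1 f2) = pass_operands 2 (pass D b f1) (pass D b f2)"
| "pass D b (Cup f1 f2) = pass_operands 3 (pass D b f1) (pass D b f2)"

definition accepts_operands ::
  "nat \<Rightarrow> nat \<Rightarrow> (nat \<Rightarrow> nat \<Rightarrow> nat \<Rightarrow> bool) \<Rightarrow> (nat \<Rightarrow> nat \<Rightarrow> nat \<Rightarrow> bool) \<Rightarrow> nat \<Rightarrow> nat \<Rightarrow> nat \<Rightarrow> bool" where
  "accepts_operands b tok a1 a2 M X l \<longleftrightarrow> (\<exists>ch<2. \<exists>l1\<le>l. a1 (left_mode tok M ch) X l1 \<and>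
    a2 (right_mode tok M ch) (X div b ^ l1) (l - l1))"

text \<open>The nondeterministic counterpart of \<open>pass\<close>, with \<open>l\<close> columns
  to be consumed. The split point is guessed here, whereas in \<open>pass\<close> it results from
  the number of columns that the first operand happens to consume.\<close>

primrec accepts :: "nat \<Rightarrow> nat \<Rightarrow> formula \<Rightarrow> nat \<Rightarrow> nat \<Rightarrow> nat \<Rightarrow> bool" where
  "accepts D b (Input i) = (\<lambda>M X l. if M = 3 then l = 0 else l = 1 \<and> leaf D b i M X = 1)"
| "accepts D b (Cart f1 f2) = accepts_operands b 1 (accepts D b f1) (accepts D b f2)"
| "accepts D b (Tensor f1 f2) = accepts_operands b 2 (accepts D b f1) (accepts D b f2)"
| "accepts D b (Cup f1 f2) = accepts_operands b 3 (accepts D b f1) (accepts D b f2)"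

lemma pass_node: "tok \<in> {1, 2, 3} \<Longrightarrow> pass D b (node tok f1 f2) M (bits, s) =
    pass D b f2 (right_mode tok M (bits mod 2))
      (pass D b f1 (left_mode tok M (bits mod 2)) (bits div 2, s))"
  by (auto simp: node_def pass_operands_def Let_def)

lemma accepts_node: "tok \<in> {1, 2, 3} \<Longrightarrow> accepts D b (node tok f1 f2) M X l \<longleftrightarrow>
    (\<exists>ch<2. \<exists>l1\<le>l. accepts D b f1 (left_mode tok M ch) X l1 \<and>
      accepts D b f2 (right_mode tok M ch) (X div b ^ l1) (l - l1))"
  by (auto simp: node_def accepts_operands_def)

text \<open>A binary tree has one leaf more than inner nodes. This number counts the choice bits as
  well as the steps of the stack machine further below.\<close>

definition nodes :: "formula \<Rightarrow> nat" where
  "nodes f = 2 * operations f + 1"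

lemma leaf_le_1: "leaf D b i M X \<le> 1"
proof -
  have "x mod 4 div 2 \<le> 1" for x :: nat by (metis less_Suc_eq_le less_mult_imp_div_less mod_less_divisor mult_2 numeral_Bit0 zero_less_numeral One_nat_def Suc_1)
  then show ?thesis by (auto simp: leaf_def Let_def)
qed

lemma pass_sound:
  "pass D b f M (bits, X, c, g) = (bits', X', c', g') \<Longrightarrow>
    bits' = bits div 2 ^ nodes f \<and>
    (\<exists>l. c' = c + l \<and> X' = X div b ^ l \<and> (g' \<noteq> 0 \<longrightarrow> g \<noteq> 0 \<and> accepts D b f M X l))"
proof (induction f arbitrary: M bits X c g bits' X' c' g' rule: node_induct)
  case (Input i)
  show ?case
  proof (cases "M = 3")
    case True
    then show ?thesis using Input by (auto simp: nodes_def)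
  next
    case False
    then show ?thesis using Input leaf_le_1[of D b i M X]
      by (auto simp: nodes_def intro!: exI[of _ 1])
  qed
next
  case (node tok f1 f2)
  let ?L = "left_mode tok M (bits mod 2)" and ?R = "right_mode tok M (bits mod 2)"
  obtain b1 X1 c1 g1 where 1: "pass D b f1 ?L (bits div 2, X, c, g) = (b1, X1, c1, g1)"
    by (rule prod_cases4)
  have 2: "pass D b f2 ?R (b1, X1, c1, g1) = (bits', X', c', g')"
    using node 1 by (simp add: pass_node)
  from node.IH(1)[OF 1] obtain l1 where l1: "b1 = bits div 2 div 2 ^ nodes f1" "c1 = c + l1"
    "X1 = X div b ^ l1" "g1 \<noteq> 0 \<longrightarrow> g \<noteq> 0 \<and> accepts D b f1 ?L X l1" by auto
  from node.IH(2)[OF 2] obtain l2 where l2: "bits' = b1 div 2 ^ nodes f2" "c' = c1 + l2"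
    "X' = X1 div b ^ l2" "g' \<noteq> 0 \<longrightarrow> g1 \<noteq> 0 \<and> accepts D b f2 ?R X1 l2" by auto
  have "2 ^ nodes (node tok f1 f2) = 2 * 2 ^ nodes f1 * (2::nat) ^ nodes f2"
    by (simp add: nodes_def power_add)
  then have "bits' = bits div 2 ^ nodes (node tok f1 f2)"
    by (simp add: l1 l2 div_mult2_eq)
  moreover have "accepts D b (node tok f1 f2) M X (l1 + l2)" "g \<noteq> 0" if "g' \<noteq> 0"
    using that l1 l2 by (simp_all add: accepts_node[OF node.hyps])
      (intro exI[of _ "bits mod 2"] conjI exI[of _ l1], auto)
  ultimately show ?case using l1 l2
    by (intro conjI exI[of _ "l1 + l2"]) (auto simp: power_add div_mult2_eq)
qed

text \<open>The surplus \<open>bits'\<close> and the start value \<open>c\<close> are arbitrary, so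
  that in the induction the bits of the second operand can follow those of the first.\<close>

lemma pass_complete:
  "accepts D b f M X l \<Longrightarrow> \<exists>bits<2 ^ nodes f. \<forall>bits' c.
    pass D b f M (bits + 2 ^ nodes f * bits', X, c, 1) = (bits', X div b ^ l, c + l, 1)"
proof (induction f arbitrary: M X l rule: node_induct)
  case (Input i)
  then show ?case by (intro exI[of _ 0]) (auto simp: nodes_def split: if_splits)
next
  case (node tok f1 f2)
  then obtain ch l1 where ch: "ch < 2" "l1 \<le> l"
    and 1: "accepts D b f1 (left_mode tok M ch) X l1"
    and 2: "accepts D b f2 (right_mode tok M ch) (X div b ^ l1) (l - l1)"
    by (auto simp: accepts_node)
  from node.IH(1)[OF 1] obtain b1 where b1: "b1 < 2 ^ nodes f1" "\<And>bits' c.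
    pass D b f1 (left_mode tok M ch) (b1 + 2 ^ nodes f1 * bits', X, c, 1) =
      (bits', X div b ^ l1, c + l1, 1)" by blast
  from node.IH(2)[OF 2] obtain b2 where b2: "b2 < 2 ^ nodes f2" "\<And>bits' c.
    pass D b f2 (right_mode tok M ch) (b2 + 2 ^ nodes f2 * bits', X div b ^ l1, c, 1) =
      (bits', X div b ^ l1 div b ^ (l - l1), c + (l - l1), 1)" by blast
  \<comment> \<open>From the lowest bit upwards: the choice at the root, the bits of the first
    operand, the bits of the second.\<close>
  let ?b = "ch + 2 * (b1 + 2 ^ nodes f1 * b2)"
  have n: "2 ^ nodes (node tok f1 f2) = 2 * (2 ^ nodes f1 * (2::nat) ^ nodes f2)"
    by (simp add: nodes_def power_add)
  have "Suc b2 * 2 ^ nodes f1 \<le> 2 ^ nodes f2 * 2 ^ nodes f1"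
    using b2(1) by (intro mult_le_mono1) auto
  then have "b1 + 2 ^ nodes f1 * b2 < 2 ^ nodes f1 * 2 ^ nodes f2"
    using b1(1) by (simp add: algebra_simps)
  moreover have "ch + 2 * a < 2 * p" if "a < p" for a p :: nat using that ch(1) by linarith
  ultimately have lt: "?b < 2 ^ nodes (node tok f1 f2)" unfolding n by blast
  have "pass D b (node tok f1 f2) M (?b + 2 ^ nodes (node tok f1 f2) * bits', X, c, 1) =
      (bits', X div b ^ l, c + l, 1)" for bits' c
  proof -
    have e: "?b + 2 ^ nodes (node tok f1 f2) * bits' =
        ch + 2 * (b1 + 2 ^ nodes f1 * (b2 + 2 ^ nodes f2 * bits'))"
      unfolding n by (simp add: algebra_simps)
    have m1: "(ch + 2 * k) mod 2 = ch" and m2: "(ch + 2 * k) div 2 = k" for k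
      using ch(1) by (auto simp: less_2_cases_iff)
    have "X div b ^ l1 div b ^ (l - l1) = X div b ^ l"
      using ch(2) by (simp add: div_mult2_eq[symmetric] power_add[symmetric])
    then show ?thesis
      unfolding e pass_node[OF node.hyps] m1 m2 b1(2) b2(2) using ch(2) by simp
  qed
  then show ?case using lt by blast
qed

lemma ex_pass_iff_accepts:
  "(\<exists>bits<2 ^ nodes f. \<exists>bits' X' g. pass D b f M (bits, X, 0, 1) = (bits', X', l, g) \<and> g \<noteq> 0) \<longleftrightarrow>
    accepts D b f M X l"
proof
  assume "accepts D b f M X l"
  from pass_complete[OF this] obtain bits where "bits < 2 ^ nodes f"
    "\<And>bits' c. pass D b f M (bits + 2 ^ nodes f * bits', X, c, 1) = (bits', X div b ^ l, c + l, 1)"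
    by blast
  from this(1) this(2)[of 0 0]
  show "\<exists>bits<2 ^ nodes f. \<exists>bits' X' g. pass D b f M (bits, X, 0, 1) = (bits', X', l, g) \<and> g \<noteq> 0"
    by auto
qed (auto dest!: pass_sound)

subsection \<open>The graph denoted by a formula\<close>

lemma pverts_node:
  "pverts (denoted_graph (node tok f1 f2) Gs) = (if tok = 1 \<or> tok = 2
     then {v @ u | v u. v \<in> pverts (denoted_graph f1 Gs) \<and> u \<in> pverts (denoted_graph f2 Gs)}
     else pverts (denoted_graph f1 Gs) \<union> pverts (denoted_graph f2 Gs))"
  by (auto simp: node_def flatten_def map_graph_def cartesian_product_def tensor_product_def
      graph_union_def)

lemma mem_image_map_prod: "(x, y) \<in> map_prod F F ` A \<longleftrightarrow> (\<exists>a b. x = F a \<and> y = F b \<and> (a, b) \<in> A)"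
  by force

lemma parcs_Cart:
  "(x, y) \<in> parcs (denoted_graph (Cart f1 f2) Gs) \<longleftrightarrow> (\<exists>v u u'. x = v @ u \<and> y = v @ u' \<and>
      v \<in> pverts (denoted_graph f1 Gs) \<and> (u, u') \<in> parcs (denoted_graph f2 Gs)) \<or>
    (\<exists>v v' u. x = v @ u \<and> y = v' @ u \<and>
      u \<in> pverts (denoted_graph f2 Gs) \<and> (v, v') \<in> parcs (denoted_graph f1 Gs))"
  by (simp add: flatten_def map_graph_def cartesian_product_def mem_image_map_prod) blast

lemma parcs_Tensor:
  "(x, y) \<in> parcs (denoted_graph (Tensor f1 f2) Gs) \<longleftrightarrow> (\<exists>v v' u u'. x = v @ u \<and> y = v' @ u' \<and>
      (v, v') \<in> parcs (denoted_graph f1 Gs) \<and> (u, u') \<in> parcs (denoted_graph f2 Gs))"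
  by (simp add: flatten_def map_graph_def tensor_product_def mem_image_map_prod) blast

lemma parcs_Cup:
  "(x, y) \<in> parcs (denoted_graph (Cup f1 f2) Gs) \<longleftrightarrow>
    (x, y) \<in> parcs (denoted_graph f1 Gs) \<or> (x, y) \<in> parcs (denoted_graph f2 Gs)"
  by (simp add: graph_union_def)

text \<open>Products extend adjacent or equal segments by adjacent or equal segments. Consequently
  both ends of an arc can be split at the same position, and all vertices of a clique have equally
  many columns.\<close>

lemma length_eq_if_adjacent: "(x, y) \<in> parcs (denoted_graph f Gs) \<Longrightarrow> length x = length y"
proof (induction f arbitrary: x y)
  case (Input i)
  then show ?case by (auto simp: map_graph_def)
next
  case (Cart f1 f2)
  then show ?case by (fastforce simp: parcs_Cart simp del: denoted_graph.simps)
next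
  case (Tensor f1 f2)
  then show ?case by (fastforce simp: parcs_Tensor simp del: denoted_graph.simps)
next
  case (Cup f1 f2)
  then show ?case by (auto simp: parcs_Cup simp del: denoted_graph.simps)
qed

lemma length_vertex_le: "x \<in> pverts (denoted_graph f Gs) \<Longrightarrow> length x \<le> operations f + 1"
proof (induction f arbitrary: x rule: node_induct)
  case (Input i)
  then show ?case by (auto simp: map_graph_def)
next
  case (node tok f1 f2)
  then show ?case by (fastforce simp: pverts_node split: if_splits)
qed

lemma set_vertex_subset:
  "x \<in> pverts (denoted_graph f Gs) \<Longrightarrow> inputs f \<subseteq> {..<length Gs} \<Longrightarrow>
    set x \<subseteq> (\<Union>G\<in>set Gs. pverts G)"
proof (induction f arbitrary: x rule: node_induct)
  case (Input i)
  then show ?case using nth_mem by (fastforce simp: map_graph_def)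
next
  case (node tok f1 f2)
  have "set v \<subseteq> (\<Union>G\<in>set Gs. pverts G)" if "v \<in> pverts (denoted_graph f1 Gs)" for v
    using node that by simp
  moreover have "set v \<subseteq> (\<Union>G\<in>set Gs. pverts G)" if "v \<in> pverts (denoted_graph f2 Gs)" for v
    using node that by simp
  moreover have "x \<in> pverts (denoted_graph f1 Gs) \<or> x \<in> pverts (denoted_graph f2 Gs) \<or>
      (\<exists>v u. x = v @ u \<and> v \<in> pverts (denoted_graph f1 Gs) \<and> u \<in> pverts (denoted_graph f2 Gs))"
    using node.prems(1) by (auto simp: pverts_node split: if_splits)
  ultimately show ?case by (elim disjE exE conjE) simp_all
qed

definition related :: "formula \<Rightarrow> 'a pair_pre_digraph list \<Rightarrow> nat \<Rightarrow> 'a list \<Rightarrow> 'a list \<Rightarrow> bool" where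
  "related f Gs M x y \<longleftrightarrow> (if M = 1 then (x, y) \<in> parcs (denoted_graph f Gs)
     else if M = 2 then x = y \<and> x \<in> pverts (denoted_graph f Gs) else x = [] \<and> y = [])"

lemma ex_append_eq:
  "(\<exists>v v' u u'. x = v @ u \<and> y = v' @ u' \<and> length v = length v' \<and> P v v' u u') \<longleftrightarrow>
    (\<exists>l\<le>length x. l \<le> length y \<and> P (take l x) (take l y) (drop l x) (drop l y))"
proof safe
  fix v v' u u' assume "length v = length v'" "P v v' u u'"
  then show "\<exists>l\<le>length (v @ u). l \<le> length (v' @ u') \<and>
      P (take l (v @ u)) (take l (v' @ u')) (drop l (v @ u)) (drop l (v' @ u'))"
    by (intro exI[of _ "length v"]) auto
next
  fix l assume "l \<le> length x" "l \<le> length y" "P (take l x) (take l y) (drop l x) (drop l y)"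
  then show "\<exists>v v' u u'. x = v @ u \<and> y = v' @ u' \<and> length v = length v' \<and> P v v' u u'"
    by (intro exI[of _ "take l x"] exI[of _ "take l y"] exI[of _ "drop l x"] exI[of _ "drop l y"])
      auto
qed

text \<open>Related segments have equal lengths in every mode, so one position \<open>l\<close> for
  both tuples accounts for all ways of splitting them. What remains is a comparison of the three
  tokens with the three modes.\<close>

lemma related_node:
  assumes "tok \<in> {1, 2, 3}" "M \<in> {1, 2, 3}" "length x = length y"
  shows "related (node tok f1 f2) Gs M x y \<longleftrightarrow> (\<exists>ch<2. \<exists>l\<le>length x.
    related f1 Gs (left_mode tok M ch) (take l x) (take l y) \<and>
    related f2 Gs (right_mode tok M ch) (drop l x) (drop l y))" (is "_ \<longleftrightarrow> ?rhs")
proof -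
  have two: "(\<exists>ch<2. P ch) \<longleftrightarrow> P 0 \<or> P 1" for P :: "nat \<Rightarrow> bool"
    by (auto simp: less_2_cases_iff)
  have "?rhs \<longleftrightarrow> (\<exists>ch<2. \<exists>v v' u u'. x = v @ u \<and> y = v' @ u' \<and> length v = length v' \<and>
      related f1 Gs (left_mode tok M ch) v v' \<and> related f2 Gs (right_mode tok M ch) u u')"
    unfolding ex_append_eq using assms(3) by auto
  also have "\<dots> \<longleftrightarrow> related (node tok f1 f2) Gs M x y"
  proof -
    define E1 E2 V1 V2 where "E1 = parcs (denoted_graph f1 Gs)" "E2 = parcs (denoted_graph f2 Gs)"
      "V1 = pverts (denoted_graph f1 Gs)" "V2 = pverts (denoted_graph f2 Gs)"
    note defs = this[symmetric]
    have len: "(v, v') \<in> E1 \<Longrightarrow> length v = length v'" "(v, v') \<in> E2 \<Longrightarrow> length v = length v'" for v v'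
      using length_eq_if_adjacent by (auto simp: E1_E2_V1_V2_def)
    have V: "z \<in> pverts (denoted_graph (node tok f1 f2) Gs) \<longleftrightarrow> (if tok = 3 then z \<in> V1 \<or> z \<in> V2
       else \<exists>v u. z = v @ u \<and> v \<in> V1 \<and> u \<in> V2)" for z
      using assms(1) by (auto simp: pverts_node defs)
    have E: "(x, y) \<in> parcs (denoted_graph (node tok f1 f2) Gs) \<longleftrightarrow>
      (if tok = 1 then
        (\<exists>v u u'. x = v @ u \<and> y = v @ u' \<and> v \<in> V1 \<and> (u, u') \<in> E2) \<or>
        (\<exists>v v' u. x = v @ u \<and> y = v' @ u \<and> u \<in> V2 \<and> (v, v') \<in> E1)
       else if tok = 2 then (\<exists>v v' u u'. x = v @ u \<and> y = v' @ u' \<and> (v, v') \<in> E1 \<and> (u, u') \<in> E2)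
       else (x, y) \<in> E1 \<or> (x, y) \<in> E2)"
      using assms(1) by (auto simp: node_def parcs_Cart parcs_Tensor parcs_Cup defs
        simp del: denoted_graph.simps)
    have R: "related f1 Gs k v v' \<longleftrightarrow> (if k = 1 then (v, v') \<in> E1 else
        if k = 2 then v = v' \<and> v \<in> V1 else v = [] \<and> v' = [])"
      "related f2 Gs k v v' \<longleftrightarrow> (if k = 1 then (v, v') \<in> E2 else
        if k = 2 then v = v' \<and> v \<in> V2 else v = [] \<and> v' = [])" for k v v'
      by (simp_all add: related_def defs)
    have "(tok = 1 \<or> tok = 2 \<or> tok = 3) \<and> (M = 1 \<or> M = 2 \<or> M = 3)" using assms by auto
    then show ?thesis
      using assms(3) unfolding related_def[of "node tok f1 f2"] V E
      apply (elim conjE disjE)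
      subgoal by (auto simp: two R left_mode_def right_mode_def dest: len intro: exI[of _ 0])
      subgoal by (auto simp: two R left_mode_def right_mode_def dest: len intro: exI[of _ 0])
      subgoal by (auto simp: two R left_mode_def right_mode_def dest: len intro: exI[of _ 0])
      subgoal by (auto simp: two R left_mode_def right_mode_def dest: len intro: exI[of _ 0]) (metis len)
      subgoal by (auto simp: two R left_mode_def right_mode_def dest: len intro: exI[of _ 0]) (metis append_Nil list.size(3))
      subgoal by (auto simp: two R left_mode_def right_mode_def dest: len intro: exI[of _ 0])
      subgoal by (auto simp: two R left_mode_def right_mode_def dest: len intro: exI[of _ 0])
      subgoal by (auto simp: two R left_mode_def right_mode_def dest: len intro: exI[of _ 0])
      subgoal by (auto simp: two R left_mode_def right_mode_def dest: len intro: exI[of _ 0])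
      done
  qed
  finally show ?thesis by simp
qed

text \<open>
  The number \<open>X\<close> describes the columns of a pair of tuples: for each column its base \<open>b\<close> digit
  contains, starting at factor \<open>D\<close>, one base 4 digit for each input graph.
\<close>

definition describes ::
  "nat \<Rightarrow> nat \<Rightarrow> 'a pair_pre_digraph list \<Rightarrow> nat \<Rightarrow> 'a list \<Rightarrow> 'a list \<Rightarrow> bool" where
  "describes D b Gs X xs ys \<longleftrightarrow> length xs = length ys \<and>
    (\<forall>c<length xs. \<forall>i<length Gs. X div b ^ c mod b div D div 4 ^ i mod 4 =
      of_bool ((xs ! c, ys ! c) \<in> parcs (Gs ! i)) +
      2 * of_bool (xs ! c = ys ! c \<and> xs ! c \<in> pverts (Gs ! i)))"

lemma accepts_iff_related:
  assumes "describes D b Gs X xs ys" "inputs f \<subseteq> {..<length Gs}" "M \<in> {1, 2, 3}" "l \<le> length xs"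
  shows "accepts D b f M X l \<longleftrightarrow> related f Gs M (take l xs) (take l ys)"
  using assms
proof (induction f arbitrary: M X xs ys l rule: node_induct)
  case (Input i)
  have i: "i < length Gs" and len: "length xs = length ys"
    using Input by (auto simp: describes_def)
  show ?case
  proof (cases "M = 3")
    case True
    then show ?thesis using Input len by (auto simp: related_def)
  next
    case M: False
    show ?thesis
    proof (cases "l = 1")
      case True
      then have ne: "0 < length xs" "take l xs = [xs ! 0]" "take l ys = [ys ! 0]"
        using Input len by (cases xs; cases ys; simp)+
      then have "X mod b div D div 4 ^ i mod 4 = of_bool ((xs ! 0, ys ! 0) \<in> parcs (Gs ! i)) +
          2 * of_bool (xs ! 0 = ys ! 0 \<and> xs ! 0 \<in> pverts (Gs ! i))"
        using Input i unfolding describes_def by (metis div_by_1 power_0)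
      then have d: "leaf D b i M X = (if M = 1 then of_bool ((xs ! 0, ys ! 0) \<in> parcs (Gs ! i))
          else of_bool (xs ! 0 = ys ! 0 \<and> xs ! 0 \<in> pverts (Gs ! i)))"
        by (auto simp: leaf_def Let_def)
      have M: "M = 1 \<or> M = 2" using M Input(3) by auto
      have "accepts D b (Input i) M X l \<longleftrightarrow> leaf D b i M X = 1" using M True by auto
      also have "\<dots> \<longleftrightarrow> (if M = 1 then (xs ! 0, ys ! 0) \<in> parcs (Gs ! i)
          else xs ! 0 = ys ! 0 \<and> xs ! 0 \<in> pverts (Gs ! i))"
        unfolding d by auto
      also have "\<dots> \<longleftrightarrow> related (Input i) Gs M [xs ! 0] [ys ! 0]"
        using M by (auto simp: related_def map_graph_def mem_image_map_prod)
      finally show ?thesis by (simp only: ne)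
    next
      case False
      then show ?thesis using M Input len
        by (auto simp: related_def map_graph_def dest: arg_cong[of _ _ length])
    qed
  qed
next
  case (node tok f1 f2)
  have len: "length xs = length ys" using node by (auto simp: describes_def)
  have "accepts D b (node tok f1 f2) M X l \<longleftrightarrow> (\<exists>ch<2. \<exists>l1\<le>l.
      related f1 Gs (left_mode tok M ch) (take l1 (take l xs)) (take l1 (take l ys)) \<and>
      related f2 Gs (right_mode tok M ch) (drop l1 (take l xs)) (drop l1 (take l ys)))"
    unfolding accepts_node[OF node.hyps]
  proof (intro ex_cong1 conj_cong refl)
    fix ch l1 assume l1: "l1 \<le> l"
    have m: "left_mode tok M ch \<in> {1, 2, 3}" "right_mode tok M ch \<in> {1, 2, 3}"
      using node.prems(3) by (auto simp: left_mode_def right_mode_def)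
    show "accepts D b f1 (left_mode tok M ch) X l1 \<longleftrightarrow>
        related f1 Gs (left_mode tok M ch) (take l1 (take l xs)) (take l1 (take l ys))"
      using node.IH(1)[of X xs ys _ l1] node.prems l1 m by (simp add: min_def)
    \<comment> \<open>Columns are digits with the first column lowest, so the division discards the
      columns used by the first operand, and the second operand again sees a description of what is
      left.\<close>
    have "describes D b Gs (X div b ^ l1) (drop l1 xs) (drop l1 ys)"
      unfolding describes_def
    proof (intro conjI allI impI)
      fix c i assume "c < length (drop l1 xs)" "i < length Gs"
      then show "X div b ^ l1 div b ^ c mod b div D div 4 ^ i mod 4 =
          of_bool ((drop l1 xs ! c, drop l1 ys ! c) \<in> parcs (Gs ! i)) +
          2 * of_bool (drop l1 xs ! c = drop l1 ys ! c \<and> drop l1 xs ! c \<in> pverts (Gs ! i))"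
        using node.prems(1) len unfolding describes_def
        by (auto simp: div_mult2_eq[symmetric] power_add[symmetric])
    qed (use len in simp)
    then show "accepts D b f2 (right_mode tok M ch) (X div b ^ l1) (l - l1) \<longleftrightarrow>
        related f2 Gs (right_mode tok M ch) (drop l1 (take l xs)) (drop l1 (take l ys))"
      using node.IH(2)[of "X div b ^ l1" "drop l1 xs" "drop l1 ys" _ "l - l1"] node.prems l1 m
      by (simp add: drop_take)
  qed
  also have "\<dots> \<longleftrightarrow> related (node tok f1 f2) Gs M (take l xs) (take l ys)"
    using related_node[OF node.hyps node.prems(3), of "take l xs" "take l ys"] len node.prems(4)
    by (simp add: min_def)
  finally show ?case .
qed

section \<open>Counting cliques column by column\<close>

text \<open>
  A number \<open>t < length U ^ s\<close> stands for an \<open>s\<close>-tuple of input vertices, namely the entries in the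
  same column of \<open>s\<close> vertices of the factored graph. Its code records the adjacencies,
  equalities and memberships of the entries in all input graphs.
\<close>

definition entry :: "'a list \<Rightarrow> nat \<Rightarrow> nat \<Rightarrow> 'a" where
  "entry U t p = U ! (t div length U ^ p mod length U)"

definition col_digit :: "'a pair_pre_digraph list \<Rightarrow> nat \<Rightarrow> 'a list \<Rightarrow> nat \<Rightarrow> nat \<Rightarrow> nat" where
  "col_digit Gs s U t e = (let pq = e div length Gs; i = e mod length Gs;
      v = entry U t (pq div s); u = entry U t (pq mod s) in
    of_bool ((v, u) \<in> parcs (Gs ! i)) + 2 * of_bool (v = u \<and> v \<in> pverts (Gs ! i)))"

definition col_code :: "'a pair_pre_digraph list \<Rightarrow> nat \<Rightarrow> 'a list \<Rightarrow> nat \<Rightarrow> nat" where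
  "col_code Gs s U t = dvalue 4 (map (col_digit Gs s U t) [0..<s * s * length Gs])"

text \<open>The number \<open>pq\<close> stands for the rows \<open>pq div s\<close> and
  \<open>pq mod s\<close>, and \<open>D\<close> is the place value of their block of
  \<open>m\<close> base 4 digits within a column code. On the diagonal mode 1 has to fail, which
  excludes loops, and mode 2 has to succeed, which makes the row a vertex.\<close>

definition valid :: "nat \<Rightarrow> nat \<Rightarrow> formula \<Rightarrow> nat \<Rightarrow> nat \<Rightarrow> bool" where
  "valid s m f L T \<longleftrightarrow> (\<forall>pq<s * s. let D = 4 ^ (pq * m); b = 4 ^ (s * s * m) in
    (accepts D b f 1 T L \<longleftrightarrow> pq div s \<noteq> pq mod s) \<and>
    (pq div s = pq mod s \<longrightarrow> accepts D b f 2 T L))"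

lemma col_code_less: "col_code Gs s U t < 4 ^ (s * s * length Gs)"
proof -
  have "set (map (col_digit Gs s U t) [0..<s * s * length Gs]) \<subseteq> {..<4}"
    by (auto simp: col_digit_def Let_def)
  from dvalue_less[OF this] show ?thesis by (simp add: col_code_def)
qed

lemma all_pairs_less: "(\<forall>pq<s * s. P (pq div s) (pq mod s)) \<longleftrightarrow> (\<forall>p<s. \<forall>q<s. P p q)" for s :: nat
proof safe
  fix p q assume *: "\<forall>pq<s * s. P (pq div s) (pq mod s)" and pq: "p < s" "q < s"
  have "p * s + q < Suc p * s" using pq by simp
  also have "\<dots> \<le> s * s" using pq by (intro mult_le_mono1) auto
  finally show "P p q" using * pq by force
next
  fix pq assume *: "\<forall>p<s. \<forall>q<s. P p q" and pq: "pq < s * s"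
  then have "0 < s" by (cases s) auto
  then show "P (pq div s) (pq mod s)" using * pq by (simp add: less_mult_imp_div_less)
qed

text \<open>A transposition: \<open>ts\<close> lists the columns of a matrix of input vertices, the
  result lists its \<open>s\<close> rows, which are the candidate vertices of the clique.\<close>

definition rows :: "nat \<Rightarrow> 'a list \<Rightarrow> nat list \<Rightarrow> 'a list list" where
  "rows s U ts = map (\<lambda>p. map (\<lambda>t. entry U t p) ts) [0..<s]"

lemma describes_rows:
  assumes "pq < s * s"
  shows "describes (4 ^ (pq * length Gs)) (4 ^ (s * s * length Gs)) Gs
    (dvalue (4 ^ (s * s * length Gs)) (map (col_code Gs s U) ts))
    (rows s U ts ! (pq div s)) (rows s U ts ! (pq mod s))"
proof -
  let ?m = "length Gs" and ?b = "4 ^ (s * s * length Gs) :: nat"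
  have s: "0 < s" using assms by (cases s) auto
  have pq: "pq div s < s" "pq mod s < s" using s assms by (simp_all add: less_mult_imp_div_less)
  show ?thesis
    unfolding describes_def
  proof (intro conjI allI impI)
    show "length (rows s U ts ! (pq div s)) = length (rows s U ts ! (pq mod s))"
      using pq by (simp add: rows_def)
    fix c i assume "c < length (rows s U ts ! (pq div s))" and i: "i < ?m"
    then have c: "c < length ts" using pq by (simp add: rows_def)
    have "set (map (col_code Gs s U) ts) \<subseteq> {..<?b}" using col_code_less by auto
    then have 1: "dvalue ?b (map (col_code Gs s U) ts) div ?b ^ c mod ?b = col_code Gs s U (ts ! c)"
      using c by (subst dvalue_div_mod) auto
    let ?e = "pq * ?m + i"
    have "?e < Suc pq * ?m" using i by simp
    also have "\<dots> \<le> s * s * ?m" using assms by (intro mult_le_mono1) auto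
    finally have e: "?e < s * s * ?m" .
    have "set (map (col_digit Gs s U (ts ! c)) [0..<s * s * ?m]) \<subseteq> {..<4}"
      by (auto simp: col_digit_def Let_def)
    from dvalue_div_mod[OF this, of ?e] e
    have "col_code Gs s U (ts ! c) div 4 ^ ?e mod 4 = col_digit Gs s U (ts ! c) ?e"
      by (simp add: col_code_def)
    moreover have "?e div ?m = pq" using i by (intro div_nat_eqI) (auto simp: algebra_simps)
    moreover have "?e mod ?m = i" using i by simp
    ultimately show "dvalue ?b (map (col_code Gs s U) ts) div ?b ^ c mod ?b div 4 ^ (pq * ?m) div 4 ^ i mod 4 =
        of_bool ((rows s U ts ! (pq div s) ! c, rows s U ts ! (pq mod s) ! c) \<in> parcs (Gs ! i)) +
        2 * of_bool (rows s U ts ! (pq div s) ! c = rows s U ts ! (pq mod s) ! c \<and>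
          rows s U ts ! (pq div s) ! c \<in> pverts (Gs ! i))"
      unfolding 1 using c pq
      by (simp add: rows_def col_digit_def Let_def div_mult2_eq[symmetric] power_add[symmetric])
  qed
qed

lemma valid_iff_rows:
  assumes "inputs f \<subseteq> {..<length Gs}"
  shows "valid s (length Gs) f (length ts)
      (dvalue (4 ^ (s * s * length Gs)) (map (col_code Gs s U) ts)) \<longleftrightarrow>
    (\<forall>p<s. \<forall>q<s. ((rows s U ts ! p, rows s U ts ! q) \<in> parcs (denoted_graph f Gs) \<longleftrightarrow> p \<noteq> q) \<and>
      (p = q \<longrightarrow> rows s U ts ! p \<in> pverts (denoted_graph f Gs)))" (is "?l \<longleftrightarrow> ?r")
proof -
  let ?G = "denoted_graph f Gs" and ?R = "\<lambda>p. rows s U ts ! p"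
  have "?l \<longleftrightarrow> (\<forall>pq<s * s. ((?R (pq div s), ?R (pq mod s)) \<in> parcs ?G \<longleftrightarrow> pq div s \<noteq> pq mod s) \<and>
      (pq div s = pq mod s \<longrightarrow> ?R (pq div s) \<in> pverts ?G))"
    unfolding valid_def Let_def
  proof (intro all_cong)
    fix pq assume pq: "pq < s * s"
    then have "0 < s" by (cases s) auto
    then have "length (?R (pq div s)) = length ts" "length (?R (pq mod s)) = length ts"
      using pq by (simp_all add: rows_def less_mult_imp_div_less)
    then have "accepts (4 ^ (pq * length Gs)) (4 ^ (s * s * length Gs)) f M
        (dvalue (4 ^ (s * s * length Gs)) (map (col_code Gs s U) ts)) (length ts) \<longleftrightarrow>
        related f Gs M (?R (pq div s)) (?R (pq mod s))" if "M \<in> {1, 2, 3}" for M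
      using accepts_iff_related[OF describes_rows[OF pq] assms that, of "length ts"] by simp
    then show "((accepts (4 ^ (pq * length Gs)) (4 ^ (s * s * length Gs)) f 1
        (dvalue (4 ^ (s * s * length Gs)) (map (col_code Gs s U) ts)) (length ts)) =
        (pq div s \<noteq> pq mod s) \<and> (pq div s = pq mod s \<longrightarrow>
        accepts (4 ^ (pq * length Gs)) (4 ^ (s * s * length Gs)) f 2
        (dvalue (4 ^ (s * s * length Gs)) (map (col_code Gs s U) ts)) (length ts))) =
      (((?R (pq div s), ?R (pq mod s)) \<in> parcs ?G \<longleftrightarrow> pq div s \<noteq> pq mod s) \<and>
      (pq div s = pq mod s \<longrightarrow> ?R (pq div s) \<in> pverts ?G))"
      by (auto simp: related_def)
  qed
  also have "\<dots> \<longleftrightarrow> ?r"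
    using all_pairs_less[of s "\<lambda>p q. ((?R p, ?R q) \<in> parcs ?G \<longleftrightarrow> p \<noteq> q) \<and>
      (p = q \<longrightarrow> ?R p \<in> pverts ?G)"] by simp
  finally show ?thesis .
qed

text \<open>A matrix is determined by its columns, and a column by the \<open>s\<close> digits in
  base \<open>length U\<close> of a number. Since \<open>U\<close> is distinct, digits and input
  vertices are interchangeable.\<close>

lemma bij_betw_rows:
  assumes "distinct U" "1 \<le> s"
  shows "bij_betw (rows s U) {ts. length ts = L \<and> set ts \<subseteq> {..<length U ^ s}}
    {as. length as = s \<and> (\<forall>a\<in>set as. length a = L \<and> set a \<subseteq> set U)}"
  unfolding bij_betw_def
proof (intro conjI subset_antisym subsetI)
  let ?u = "length U"
  \<comment> \<open>With \<open>1 \<le> s\<close> an empty \<open>U\<close> leaves no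
    \<open>t\<close> at all; for \<open>s = 0\<close> the power would be 1.\<close>
  have lt: "0 < ?u" if "t < ?u ^ s" for t using that assms(2) by (cases "?u = 0"; cases s) auto
  show "inj_on (rows s U) {ts. length ts = L \<and> set ts \<subseteq> {..<?u ^ s}}"
  proof (intro inj_onI)
    fix ts ts' assume ts: "ts \<in> {ts. length ts = L \<and> set ts \<subseteq> {..<?u ^ s}}"
      and ts': "ts' \<in> {ts. length ts = L \<and> set ts \<subseteq> {..<?u ^ s}}"
      and eq: "rows s U ts = rows s U ts'"
    show "ts = ts'"
    proof (rule nth_equalityI)
      fix c assume c: "c < length ts"
      then have less: "ts ! c < ?u ^ s" "ts' ! c < ?u ^ s"
        using ts ts' by (auto simp: subset_iff)
      have "ts ! c div ?u ^ p mod ?u = ts' ! c div ?u ^ p mod ?u" if "p < s" for p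
      proof -
        have "rows s U ts ! p ! c = rows s U ts' ! p ! c" using eq by simp
        then show ?thesis using that c ts ts' lt[OF less(1)] assms(1)
          by (simp add: rows_def entry_def nth_eq_iff_index_eq)
      qed
      then have "map (\<lambda>p. ts ! c div ?u ^ p mod ?u) [0..<s] = map (\<lambda>p. ts' ! c div ?u ^ p mod ?u) [0..<s]"
        by simp
      then show "ts ! c = ts' ! c" using dvalue_digits less by metis
    qed (use ts ts' in auto)
  qed
  show "as \<in> {as. length as = s \<and> (\<forall>a\<in>set as. length a = L \<and> set a \<subseteq> set U)}"
    if "as \<in> rows s U ` {ts. length ts = L \<and> set ts \<subseteq> {..<?u ^ s}}" for as
    using that lt by (fastforce simp: rows_def entry_def)
  fix as assume as: "as \<in> {as. length as = s \<and> (\<forall>a\<in>set as. length a = L \<and> set a \<subseteq> set U)}"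
  have "\<exists>j<?u. U ! j = as ! p ! c" if "p < s" "c < L" for p c
    using as that nth_mem[of p as] nth_mem[of c "as ! p"] by (auto simp: in_set_conv_nth subset_iff)
  then obtain j where j: "\<And>p c. p < s \<Longrightarrow> c < L \<Longrightarrow> j p c < ?u \<and> U ! j p c = as ! p ! c"
    by metis
  define ts where "ts = map (\<lambda>c. dvalue ?u (map (\<lambda>p. j p c) [0..<s])) [0..<L]"
  have sub: "set (map (\<lambda>p. j p c) [0..<s]) \<subseteq> {..<?u}" if "c < L" for c
    using j that by auto
  have "dvalue ?u (map (\<lambda>p. j p c) [0..<s]) < ?u ^ s" if "c < L" for c
    using dvalue_less[OF sub[OF that]] by simp
  then have "length ts = L \<and> set ts \<subseteq> {..<?u ^ s}" by (auto simp: ts_def)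
  moreover have "as = rows s U ts"
  proof (rule nth_equalityI)
    fix p assume p: "p < length as"
    show "as ! p = rows s U ts ! p"
    proof (rule nth_equalityI)
      fix c assume "c < length (as ! p)"
      then have c: "c < L" using p as by auto
      then show "as ! p ! c = rows s U ts ! p ! c"
        using p as dvalue_div_mod[OF sub[OF c], of p] j[of p c] by (simp add: rows_def ts_def entry_def)
    qed (use p as in \<open>auto simp: rows_def ts_def\<close>)
  qed (use as in \<open>simp add: rows_def\<close>)
  ultimately show "as \<in> rows s U ` {ts. length ts = L \<and> set ts \<subseteq> {..<?u ^ s}}" by blast
qed

definition clique_tuples :: "nat \<Rightarrow> 'a pair_pre_digraph \<Rightarrow> 'a list set" where
  "clique_tuples s G = {as. length as = s \<and>
    (\<forall>p<s. \<forall>q<s. ((as ! p, as ! q) \<in> parcs G \<longleftrightarrow> p \<noteq> q) \<and> (p = q \<longrightarrow> as ! p \<in> pverts G))}"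

lemma exact_copies_clique:
  assumes "complete_digraph s (with_proj H)" "distinct bs" "set bs = pverts H"
  shows "exact_copies H bs G = clique_tuples s G"
proof -
  have s: "length bs = s" and arcs: "parcs H = {(u, v). u \<in> pverts H \<and> v \<in> pverts H \<and> u \<noteq> v}"
    using assms by (auto simp: complete_digraph_pair_def distinct_card[symmetric])
  have "(bs ! i, bs ! j) \<in> parcs H \<longleftrightarrow> i \<noteq> j" if "i < s" "j < s" for i j
    using that nth_mem[of i bs] nth_mem[of j bs] nth_eq_iff_index_eq[OF assms(2), of i j]
    by (simp add: arcs s assms(3))
  then have adj: "(\<forall>i<s. \<forall>j<s. (as ! i, as ! j) \<in> parcs G \<longleftrightarrow> (bs ! i, bs ! j) \<in> parcs H) \<longleftrightarrow>
      (\<forall>p<s. \<forall>q<s. (as ! p, as ! q) \<in> parcs G \<longleftrightarrow> p \<noteq> q)" for as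
    by simp
  have d: "distinct as" if "\<forall>p<s. \<forall>q<s. (as ! p, as ! q) \<in> parcs G \<longleftrightarrow> p \<noteq> q" "length as = s" for as
    unfolding distinct_conv_nth
  proof (intro allI impI notI)
    fix p q assume pq: "p < length as" "q < length as" "p \<noteq> q" and eq: "as ! p = as ! q"
    have "(as ! p, as ! q) \<in> parcs G" "(as ! p, as ! p) \<notin> parcs G" using that pq by simp_all
    then show False unfolding eq by simp
  qed
  have v: "set as \<subseteq> pverts G \<longleftrightarrow> (\<forall>p<s. as ! p \<in> pverts G)" if "length as = s" for as
    using that by (auto simp: in_set_conv_nth subset_iff)
  have c1: "as \<in> exact_copies H bs G \<longleftrightarrow> length as = s \<and> distinct as \<and> set as \<subseteq> pverts G \<and>
      (\<forall>p<s. \<forall>q<s. (as ! p, as ! q) \<in> parcs G \<longleftrightarrow> p \<noteq> q)" for as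
    unfolding exact_copies_def s mem_Collect_eq adj ..
  have c2: "as \<in> clique_tuples s G \<longleftrightarrow> length as = s \<and> (\<forall>p<s. as ! p \<in> pverts G) \<and>
      (\<forall>p<s. \<forall>q<s. (as ! p, as ! q) \<in> parcs G \<longleftrightarrow> p \<noteq> q)" for as
    unfolding clique_tuples_def by auto
  have "as \<in> exact_copies H bs G \<longleftrightarrow> as \<in> clique_tuples s G" for as
    unfolding c1 c2 using d[of as] v[of as] by argo
  then show ?thesis by (rule set_eqI)
qed

text \<open>Cliques are sorted by the common length \<open>L\<close> of their vertices and then by
  the sequence \<open>T\<close> of column codes. The range of \<open>T\<close> is
  \<open>b ^ E\<close> for every \<open>L\<close>, so that the program can use one fixed loop bound;
  the guard \<open>T < b ^ L\<close> removes the surplus.\<close>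

theorem card_clique_tuples:
  fixes Gs :: "'a pair_pre_digraph list"
  assumes f: "inputs f \<subseteq> {..<length Gs}" and s: "1 \<le> s"
    and U: "distinct U" "set U = (\<Union>G\<in>set Gs. pverts G)" and E: "operations f + 1 < E"
  defines "b \<equiv> 4 ^ (s * s * length Gs)"
  shows "card (clique_tuples s (denoted_graph f Gs)) =
    (\<Sum>L<E. \<Sum>T<b ^ E. if T < b ^ L \<and> valid s (length Gs) f L T
      then \<Prod>c<L. card {t \<in> {..<length U ^ s}. col_code Gs s U t = T div b ^ c mod b} else 0)"
proof -
  let ?G = "denoted_graph f Gs" and ?A = "{..<length U ^ s}"
  define S where "S L = {as \<in> clique_tuples s ?G. \<forall>a\<in>set as. length a = L}" for L
  define X where "X L = {ts. length ts = L \<and> set ts \<subseteq> ?A}" for L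
  define Y where "Y L = {as. length as = s \<and> (\<forall>a\<in>set as. length a = L \<and> set a \<subseteq> set U)}" for L
  have bij: "bij_betw (rows s U) (X L) (Y L)" for L
    unfolding X_def Y_def by (rule bij_betw_rows[OF U(1) s])
  have finX: "finite (X L)" for L
    using finite_lists_length_eq[of ?A L] by (simp add: X_def conj_commute)
  have SY: "S L \<subseteq> Y L" for L
  proof
    fix as assume as: "as \<in> S L"
    then have "set a \<subseteq> set U" if "a \<in> set as" for a
      using that set_vertex_subset[OF _ f] unfolding U(2)
      by (fastforce simp: S_def clique_tuples_def in_set_conv_nth)
    then show "as \<in> Y L" using as by (auto simp: S_def Y_def clique_tuples_def)
  qed
  have finS: "finite (S L)" for L
    using finite_subset[OF SY] bij_betw_finite[OF bij] finX by blast
  have "clique_tuples s ?G = (\<Union>L<E. S L)"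
  proof (intro subset_antisym subsetI)
    fix as assume as: "as \<in> clique_tuples s ?G"
    then have len: "length as = s" by (simp add: clique_tuples_def)
    \<comment> \<open>Because of \<open>1 \<le> s\<close> there is a row 0, and it is adjacent to
      all other rows.\<close>
    have "length (as ! p) = length (as ! 0)" if "p < s" for p
      using as that s length_eq_if_adjacent[of "as ! p" "as ! 0" f Gs]
      by (cases "p = 0") (auto simp: clique_tuples_def)
    then have "as \<in> S (length (as ! 0))" using as len by (auto simp: S_def in_set_conv_nth)
    moreover have "as ! 0 \<in> pverts ?G" using as s unfolding clique_tuples_def by force
    ultimately show "as \<in> (\<Union>L<E. S L)" using length_vertex_le E by fastforce
  qed (auto simp: S_def)
  moreover have "S L \<inter> S L' = {}" if "L \<noteq> L'" for L L'
  proof -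
    have False if "as \<in> S L" "as \<in> S L'" for as
    proof -
      have "as ! 0 \<in> set as" using that s by (auto simp: S_def clique_tuples_def)
      then show False using that \<open>L \<noteq> L'\<close> by (auto simp: S_def)
    qed
    then show ?thesis by blast
  qed
  ultimately have "card (clique_tuples s ?G) = (\<Sum>L<E. card (S L))"
    using finS by (simp add: card_UN_disjoint)
  also have "\<dots> = (\<Sum>L<E. \<Sum>T<b ^ E. if T < b ^ L \<and> valid s (length Gs) f L T
      then \<Prod>c<L. card {t \<in> ?A. col_code Gs s U t = T div b ^ c mod b} else 0)"
  proof (rule sum.cong[OF refl])
    fix L assume L: "L \<in> {..<E}"
    let ?V = "{ts \<in> X L. valid s (length Gs) f L (dvalue b (map (col_code Gs s U) ts))}"
    have V: "valid s (length Gs) f L (dvalue b (map (col_code Gs s U) ts)) \<longleftrightarrow> rows s U ts \<in> S L"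
      if ts: "ts \<in> X L" for ts
    proof -
      have "rows s U ts \<in> Y L" using bij ts by (auto simp: bij_betw_def)
      then have "rows s U ts \<in> S L \<longleftrightarrow> rows s U ts \<in> clique_tuples s ?G"
        by (auto simp: S_def Y_def)
      also have "\<dots> \<longleftrightarrow> valid s (length Gs) f (length ts) (dvalue b (map (col_code Gs s U) ts))"
        unfolding b_def valid_iff_rows[OF f] clique_tuples_def by (simp add: rows_def)
      also have "length ts = L" using ts by (simp add: X_def)
      finally show ?thesis ..
    qed
    have "rows s U ` ?V = S L"
    proof (intro subset_antisym subsetI)
      fix as assume "as \<in> S L"
      moreover from this obtain ts where "ts \<in> X L" "as = rows s U ts"
        using SY bij unfolding bij_betw_def by blast
      ultimately show "as \<in> rows s U ` ?V" using V by auto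
    qed (use V in auto)
    moreover have "card (rows s U ` ?V) = card ?V"
      by (rule card_image, rule inj_on_subset[OF bij_betw_imp_inj_on[OF bij]]) auto
    ultimately have "card (S L) = card ?V" by simp
    also have "?V = {ts. length ts = L \<and> set ts \<subseteq> ?A \<and>
        valid s (length Gs) f L (dvalue b (map (col_code Gs s U) ts))}"
      by (auto simp: X_def)
    also have "card \<dots> = (\<Sum>T<b ^ L. if valid s (length Gs) f L T
        then \<Prod>c<L. card {t \<in> ?A. col_code Gs s U t = T div b ^ c mod b} else 0)"
      by (rule card_lists_by_dvalue) (auto simp: b_def col_code_less)
    also have "\<dots> = (\<Sum>T<b ^ E. if T < b ^ L \<and> valid s (length Gs) f L T
        then \<Prod>c<L. card {t \<in> ?A. col_code Gs s U t = T div b ^ c mod b} else 0)"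
    proof (rule sum.mono_neutral_cong_left)
      have "b ^ L \<le> b ^ E" using L by (intro power_increasing) (auto simp: b_def)
      then show "{..<b ^ L} \<subseteq> {..<b ^ E}" by auto
    qed auto
    finally show "card (S L) = (\<Sum>T<b ^ E. if T < b ^ L \<and> valid s (length Gs) f L T
        then \<Prod>c<L. card {t \<in> ?A. col_code Gs s U t = T div b ^ c mod b} else 0)" .
  qed
  finally show ?thesis .
qed

section \<open>The program\<close>

abbreviation Add :: "exp \<Rightarrow> exp \<Rightarrow> exp" (infixl \<open>\<oplus>\<close> 65) where "x \<oplus> y \<equiv> Bin Plus x y"
abbreviation Mul :: "exp \<Rightarrow> exp \<Rightarrow> exp" (infixl \<open>\<otimes>\<close> 70) where "x \<otimes> y \<equiv> Bin Times x y"
abbreviation Quot :: "exp \<Rightarrow> exp \<Rightarrow> exp" (infixl \<open>quot\<close> 70) where "x quot y \<equiv> Bin Divide x y"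
abbreviation Rem :: "exp \<Rightarrow> exp \<Rightarrow> exp" (infixl \<open>rem\<close> 70) where "x rem y \<equiv> Bin Modulo x y"
abbreviation Lt :: "exp \<Rightarrow> exp \<Rightarrow> exp" (infix \<open>\<lessdot>\<close> 50) where "x \<lessdot> y \<equiv> Bin Less x y"
abbreviation Eq :: "exp \<Rightarrow> exp \<Rightarrow> exp" (infix \<open>\<doteq>\<close> 50) where "x \<doteq> y \<equiv> Bin Equal x y"

abbreviation (input) "rRes \<equiv> 0 :: nat"
abbreviation (input) "rE \<equiv> 2 :: nat"    \<comment> \<open>address after the formula\<close>
abbreviation (input) "rNeed \<equiv> 3 :: nat"
abbreviation (input) "rM \<equiv> 4 :: nat"    \<comment> \<open>number of input graphs\<close>
abbreviation (input) "rA \<equiv> 5 :: nat"    \<comment> \<open>address after the input\<close>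
abbreviation (input) "rU \<equiv> 6 :: nat"    \<comment> \<open>number of input vertices\<close>
abbreviation (input) "rUS \<equiv> 7 :: nat"   \<comment> \<open>number of \<open>s\<close>-tuples of input vertices\<close>
abbreviation (input) "rFM \<equiv> 8 :: nat"   \<comment> \<open>\<open>4 ^ m\<close>\<close>
abbreviation (input) "rB \<equiv> 9 :: nat"    \<comment> \<open>\<open>b = 4 ^ (s * s * m)\<close>\<close>
abbreviation (input) "rBE \<equiv> 10 :: nat"  \<comment> \<open>\<open>b ^ E\<close>\<close>
abbreviation (input) "rTE \<equiv> 11 :: nat"  \<comment> \<open>\<open>2 ^ E\<close>\<close>

abbreviation (input) "rI \<equiv> 12 :: nat"
abbreviation (input) "rN \<equiv> 13 :: nat"
abbreviation (input) "rPtr \<equiv> 14 :: nat"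
abbreviation (input) "rJ \<equiv> 15 :: nat"
abbreviation (input) "rV \<equiv> 16 :: nat"
abbreviation (input) "rT \<equiv> 17 :: nat"
abbreviation (input) "rTau \<equiv> 18 :: nat"
abbreviation (input) "rPw \<equiv> 19 :: nat"
abbreviation (input) "rPQ \<equiv> 20 :: nat"
abbreviation (input) "rX \<equiv> 21 :: nat"
abbreviation (input) "rY \<equiv> 22 :: nat"
abbreviation (input) "rS \<equiv> 23 :: nat"
abbreviation (input) "rP1 \<equiv> 24 :: nat"
abbreviation (input) "rP2 \<equiv> 25 :: nat"

text \<open>
  The memory behind the input consists of four interleaved unbounded arrays: array 0 contains at
  index \<open>v * m + i\<close> the position, counted from 1, of vertex \<open>v\<close> in the \<open>i\<close>-th input graph, and 0 if
  it is not a vertex of that graph; array 1 lists all input vertices; array 2 counts the tuples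
  with a given code; array 3 marks the vertices that are already listed.
\<close>

definition cell :: "nat \<Rightarrow> nat \<Rightarrow> nat \<Rightarrow> nat" where
  "cell A r x = A + 4 * x + r"

definition Cell :: "nat \<Rightarrow> exp \<Rightarrow> exp" where
  "Cell r e = Reg rA \<oplus> Num 4 \<otimes> e \<oplus> Num r"

lemma eval_Cell [simp]: "eval \<sigma> (Cell r e) = cell (reg \<sigma> rA) r (eval \<sigma> e)"
  by (simp add: Cell_def cell_def)

lemma cost_Cell [simp]: "cost (Cell r e) = 6 + cost e"
  by (simp add: Cell_def)

lemma exp_consts_Cell [simp]: "exp_consts (Cell r e) = {4, r} \<union> exp_consts e"
  by (auto simp: Cell_def)

lemma cell_eq_iff: "r < 4 \<Longrightarrow> r' < 4 \<Longrightarrow> cell A r x = cell A r' x' \<longleftrightarrow> r = r' \<and> x = x'"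
  unfolding cell_def by presburger

lemma cell_ge: "A \<le> cell A r x"
  by (simp add: cell_def)

lemma mult_add_eq_iff: "i < m \<Longrightarrow> i' < m \<Longrightarrow> v * m + i = v' * m + i' \<longleftrightarrow> v = v' \<and> i = (i' :: nat)"
  by (metis add.commute div_mult_self3 div_less add_0_right less_nat_zero_code mod_less mod_mult_self1 not_gr_zero)

text \<open>There is no empty program, so a scratch register is copied onto itself;
  \<open>rV\<close> therefore counts as written wherever \<open>skip\<close> occurs.\<close>

abbreviation "skip \<equiv> Asg rV (Reg rV)"

text \<open>Division of \<open>r\<close> by \<open>b ^ k\<close>, where \<open>k\<close> may be an
  arbitrary expression and hence cannot be a loop bound. The loop runs for \<open>n\<close> rounds,
  an upper bound for \<open>k\<close> where it is used, and idles after the first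
  \<open>k\<close>.\<close>

definition shift :: "nat \<Rightarrow> nat \<Rightarrow> exp \<Rightarrow> exp \<Rightarrow> exp \<Rightarrow> prog" where
  "shift r l b k n = For l n (Ite (Reg l \<lessdot> k) (Asg r (Reg r quot b)) (Asg r (Reg r)))"

definition walk :: prog where
  "walk = Asg rA (Reg rE) ;;
    For rI (Reg rM) (
      Asg rN (Mem (Reg rA)) ;;
      Asg rA (Reg rA \<oplus> Num 1 \<oplus> Reg rN \<oplus> Reg rN \<otimes> Reg rN)) ;;
    Asg rN (Num 0)"

text \<open>Vertex names serve directly as addresses. They may be far larger than \<open>n\<close>,
  but the memory behind the input is 0 from the start, so each vertex is handled in constant time
  and no table has to be cleared.\<close>

definition fill_step :: prog where
  "fill_step =
    Asg rV (Mem (Reg rPtr \<oplus> Num 1 \<oplus> Reg rJ)) ;;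
    Ite (Mem (Cell 3 (Reg rV))) skip (
      Sto (Cell 3 (Reg rV)) (Num 1) ;; Sto (Cell 1 (Reg rU)) (Reg rV) ;;
      Asg rU (Reg rU \<oplus> Num 1)) ;;
    Sto (Cell 0 (Reg rV \<otimes> Reg rM \<oplus> Reg rI)) (Reg rJ \<oplus> Num 1)"

definition fill_graph :: prog where
  "fill_graph = Asg rN (Mem (Reg rPtr)) ;; For rJ (Reg rN) fill_step ;;
    Asg rPtr (Reg rPtr \<oplus> Num 1 \<oplus> Reg rN \<oplus> Reg rN \<otimes> Reg rN)"

definition fill :: prog where
  "fill = Asg rPtr (Reg rE) ;; For rI (Reg rM) fill_graph"

text \<open>The product of the two positions is nonzero iff both vertices belong to the graph.
  Decreased by 1 they give row and column of the adjacency matrix, and they are equal iff the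
  vertices are.\<close>

definition digit_step :: prog where
  "digit_step =
    Asg rN (Mem (Reg rPtr)) ;;
    Asg rP1 (Mem (Cell 0 (Reg rX \<otimes> Reg rM \<oplus> Reg rI))) ;;
    Asg rP2 (Mem (Cell 0 (Reg rY \<otimes> Reg rM \<oplus> Reg rI))) ;;
    Ite (Reg rP1 \<otimes> Reg rP2)
      (Asg rTau (Reg rTau \<oplus> Reg rPw \<otimes>
        (Mem (Reg rPtr \<oplus> Num 1 \<oplus> Reg rN \<oplus> Bin Minus (Reg rP1) (Num 1) \<otimes> Reg rN \<oplus>
          Bin Minus (Reg rP2) (Num 1)) \<oplus> Num 2 \<otimes> (Reg rP1 \<doteq> Reg rP2))))
      skip ;;
    Asg rPw (Reg rPw \<otimes> Num 4) ;;
    Asg rPtr (Reg rPtr \<oplus> Num 1 \<oplus> Reg rN \<oplus> Reg rN \<otimes> Reg rN)"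

definition load_entry :: "nat \<Rightarrow> nat \<Rightarrow> exp \<Rightarrow> prog" where
  "load_entry s r k = Asg r (Reg rT) ;; shift r rS (Reg rU) k (Num s) ;;
    Asg r (Mem (Cell 1 (Reg r rem Reg rU)))"

definition tuple_code :: "nat \<Rightarrow> prog" where
  "tuple_code s = Asg rTau (Num 0) ;; Asg rPw (Num 1) ;;
    For rPQ (Num (s * s)) (
      load_entry s rX (Reg rPQ quot Num s) ;; load_entry s rY (Reg rPQ rem Num s) ;;
      Asg rPtr (Reg rE) ;; For rI (Reg rM) digit_step)"

text \<open>After a tuple has been coded, scratch registers may hold numbers near the tower bound.
  Resetting them restores the bound \<open>M\<close>; otherwise the bound would be raised to a tower
  again for each tuple.\<close>

definition clear :: prog where
  "clear = Asg rI (Num 0) ;; Asg rN (Num 0) ;; Asg rPtr (Num 0) ;; Asg rV (Num 0) ;;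
    Asg rTau (Num 0) ;; Asg rPw (Num 0) ;; Asg rPQ (Num 0) ;; Asg rX (Num 0) ;; Asg rY (Num 0) ;;
    Asg rS (Num 0) ;; Asg rP1 (Num 0) ;; Asg rP2 (Num 0)"

definition count_tuple :: "nat \<Rightarrow> prog" where
  "count_tuple s = tuple_code s ;;
    Sto (Cell 2 (Reg rTau)) (Mem (Cell 2 (Reg rTau)) \<oplus> Num 1) ;; clear"

text \<open>The exponent \<open>s\<close> belongs to the program text, as every \<open>s\<close> has
  a program of its own, so the power is a plain expression.\<close>

primrec power_exp :: "exp \<Rightarrow> nat \<Rightarrow> exp" where
  "power_exp e 0 = Num 1"
| "power_exp e (Suc n) = e \<otimes> power_exp e n"

definition count_tuples :: "nat \<Rightarrow> prog" where
  "count_tuples s = For rT (Reg rUS) (count_tuple s)"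

definition phase1 :: "nat \<Rightarrow> prog" where
  "phase1 s =
    Asg rM (Mem (Num 0)) ;; walk ;; fill ;; Asg rUS (power_exp (Reg rU) s) ;; count_tuples s"

subsection \<open>Partial correctness\<close>

text \<open>The functional part of \<open>For_invariant\<close>, for program parts of short running
  time, whose safety follows from the tower bound.\<close>

lemma run_For:
  assumes "eval \<sigma> e = n" "I 0 (set_reg r 0 \<sigma>)"
    and "\<And>j \<sigma>'. j < n \<Longrightarrow> I j \<sigma>' \<Longrightarrow> reg \<sigma>' r = j \<Longrightarrow> I (Suc j) (set_reg r (Suc j) (run p \<sigma>'))"
  shows "I n (run (For r e p) \<sigma>)"
proof -
  have "I j (iterate (run p) r j \<sigma>)" if "j \<le> n" for j
    using that by (induction j) (use assms in auto)
  then show ?thesis using assms(1) by simp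
qed

lemma writes_shift [simp]: "writes (shift r l b k n) = {r, l}"
  and storeless_shift [simp]: "storeless (shift r l b k n)"
  and bound_regs_shift [simp]: "bound_regs (shift r l b k n) = (case n of Reg q \<Rightarrow> {q} | _ \<Rightarrow> {})"
  by (auto simp: shift_def)

lemma run_shift:
  assumes "l \<noteq> r" "eval \<sigma> n = c"
    and e: "\<And>\<tau> :: state. (\<And>q. q \<noteq> r \<Longrightarrow> q \<noteq> l \<Longrightarrow> reg \<tau> q = reg \<sigma> q) \<Longrightarrow> mem \<tau> = mem \<sigma> \<Longrightarrow>
      eval \<tau> e1 = b \<and> eval \<tau> e2 = k"
  shows "reg (run (shift r l e1 e2 n) \<sigma>) r = reg \<sigma> r div b ^ min c k"
proof -
  let ?I = "\<lambda>j (\<tau> :: state). reg \<tau> r = reg \<sigma> r div b ^ min j k \<and> mem \<tau> = mem \<sigma> \<and>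
    (\<forall>q. q \<noteq> r \<longrightarrow> q \<noteq> l \<longrightarrow> reg \<tau> q = reg \<sigma> q)"
  have "?I c (run (shift r l e1 e2 n) \<sigma>)"
    unfolding shift_def
  proof (rule run_For[where I = ?I])
    fix j \<tau> assume j: "j < c" "?I j \<tau>" "reg \<tau> l = j"
    then have "eval \<tau> e1 = b" "eval \<tau> e2 = k" using e[of \<tau>] by auto
    then show "?I (Suc j) (set_reg l (Suc j) (run (Ite (Reg l \<lessdot> e2) (Asg r (Reg r quot e1)) (Asg r (Reg r))) \<tau>))"
      using j assms(1) by (auto simp: min_def not_less_eq_eq Suc_le_eq div_mult2_eq[symmetric] mult.commute)
  qed (use assms in auto)
  then show ?thesis by simp
qed

section \<open>Layout of the input in memory and the invariant of the vertex tables\<close>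

definition is_pos :: "'a list \<Rightarrow> 'a \<Rightarrow> nat \<Rightarrow> bool" where
  "is_pos xs v t \<longleftrightarrow> (if v \<in> set xs then 0 < t \<and> t \<le> length xs \<and> xs ! (t - 1) = v else t = 0)"

lemma is_pos_snoc: "is_pos xs w t \<Longrightarrow> w \<noteq> v \<Longrightarrow> is_pos (xs @ [v]) w t"
  by (auto simp: is_pos_def nth_append)

lemma is_pos_last: "is_pos (xs @ [v]) v (Suc (length xs))"
  by (simp add: is_pos_def)

locale encoded_input =
  fixes f :: formula and Gs :: "nat pair_pre_digraph list" and vss :: "nat list list"
    and s :: nat
  assumes length_vss: "length vss = length Gs"
    and distinct_vss: "i < length Gs \<Longrightarrow> distinct (vss ! i)"
    and set_vss: "i < length Gs \<Longrightarrow> set (vss ! i) = pverts (Gs ! i)"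
    and wf_Gs: "i < length Gs \<Longrightarrow> parcs (Gs ! i) \<subseteq> pverts (Gs ! i) \<times> pverts (Gs ! i)"
    and inputs: "inputs f = {..<length Gs}"
    and s: "1 \<le> s"
begin

abbreviation m :: nat where "m \<equiv> length Gs"

abbreviation E :: nat where "E \<equiv> 1 + length (encode_formula f)"

definition n :: "nat \<Rightarrow> nat" where "n i = length (vss ! i)"

definition off :: "nat \<Rightarrow> nat" where "off i = E + (\<Sum>j<i. 1 + n j + n j * n j)"

abbreviation A :: nat where "A \<equiv> off m"

lemma off_0: "off 0 = E"
  and off_Suc: "off (Suc i) = off i + 1 + n i + n i * n i"
  by (simp_all add: off_def)

lemma off_mono: "i \<le> j \<Longrightarrow> off i \<le> off j"
  by (auto simp: off_def intro!: sum_mono2)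

lemma off_Suc_le: "i < m \<Longrightarrow> off i + 1 + n i + n i * n i \<le> A"
  using off_mono[of "Suc i" m] by (simp add: off_Suc)

definition input_mem :: "(nat \<Rightarrow> nat) \<Rightarrow> bool" where
  "input_mem \<mu>' \<longleftrightarrow> \<mu>' 0 = m \<and> (\<forall>x<length (encode_formula f). \<mu>' (Suc x) = encode_formula f ! x) \<and>
    (\<forall>i<m. \<mu>' (off i) = n i \<and> (\<forall>j<n i. \<mu>' (Suc (off i + j)) = vss ! i ! j) \<and>
      (\<forall>j<n i. \<forall>k<n i. \<mu>' (Suc (off i + n i + j * n i + k)) =
        of_bool ((vss ! i ! j, vss ! i ! k) \<in> parcs (Gs ! i))))"

text \<open>All stores go to addresses from \<open>A\<close> on, so this is why the input stays
  intact throughout.\<close>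

lemma input_mem_cong:
  assumes "\<And>x. x < A \<Longrightarrow> \<mu>2 x = \<mu>1 x" "input_mem \<mu>1"
  shows "input_mem \<mu>2"
proof -
  have "E \<le> A" using off_mono[of 0 m] by (simp add: off_0)
  then have 1: "\<mu>2 0 = \<mu>1 0" "\<And>x. x < length (encode_formula f) \<Longrightarrow> \<mu>2 (Suc x) = \<mu>1 (Suc x)"
    using assms(1) by simp_all
  have 2: "\<mu>2 (off i) = \<mu>1 (off i)" "j < n i \<Longrightarrow> \<mu>2 (Suc (off i + j)) = \<mu>1 (Suc (off i + j))"
    "j < n i \<Longrightarrow> k < n i \<Longrightarrow> \<mu>2 (Suc (off i + n i + j * n i + k)) = \<mu>1 (Suc (off i + n i + j * n i + k))"
    if "i < m" for i j k
  proof -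
    note le = off_Suc_le[OF that]
    show "\<mu>2 (off i) = \<mu>1 (off i)" using le by (intro assms) simp
    show "\<mu>2 (Suc (off i + j)) = \<mu>1 (Suc (off i + j))" if "j < n i" using le that by (intro assms) simp
    assume "j < n i" "k < n i"
    then have "j * n i + k < Suc j * n i" "Suc j * n i \<le> n i * n i"
      by (simp, intro mult_le_mono1, simp)
    then have "j * n i + k < n i * n i" by linarith
    then show "\<mu>2 (Suc (off i + n i + j * n i + k)) = \<mu>1 (Suc (off i + n i + j * n i + k))"
      using le by (intro assms) simp
  qed
  show ?thesis using assms(2) unfolding input_mem_def by (simp add: 1 2)
qed

text \<open>The list \<open>vs i\<close> is the part of the vertex list of graph \<open>i\<close>
  that has been read so far; thus the same predicate describes the empty, the partial and the
  complete tables.\<close>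

definition filled :: "(nat \<Rightarrow> nat list) \<Rightarrow> nat list \<Rightarrow> (nat \<Rightarrow> nat) \<Rightarrow> bool" where
  "filled vs U \<mu>' \<longleftrightarrow> input_mem \<mu>' \<and> distinct U \<and> set U = (\<Union>i<m. set (vs i)) \<and>
    (\<forall>a<length U. \<mu>' (cell A 1 a) = U ! a) \<and>
    (\<forall>v. \<forall>i<m. is_pos (vs i) v (\<mu>' (cell A 0 (v * m + i)))) \<and>
    (\<forall>v. \<mu>' (cell A 3 v) = of_bool (v \<in> set U))"

lemma input_mem_cell: "input_mem \<mu>' \<Longrightarrow> input_mem (\<mu>'(cell A r x := y))"
  by (rule input_mem_cong[of _ \<mu>']) (use cell_ge[of A r x] in auto)

lemma filled_seen:
  assumes "filled vs U \<mu>'" "i < m" "v \<in> set U"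
  shows "filled (vs(i := vs i @ [v])) U (\<mu>'(cell A 0 (v * m + i) := Suc (length (vs i))))"
proof -
  have "set U = (\<Union>i'<m. set ((vs(i := vs i @ [v])) i'))"
    using assms unfolding filled_def by (auto split: if_splits)
  then show ?thesis
    using assms unfolding filled_def
    by (auto simp: input_mem_cell cell_eq_iff mult_add_eq_iff intro: is_pos_last is_pos_snoc)
qed

lemma filled_new:
  assumes "filled vs U \<mu>'" "i < m" "v \<notin> set U"
  shows "filled (vs(i := vs i @ [v])) (U @ [v])
    (\<mu>'(cell A 3 v := 1, cell A 1 (length U) := v, cell A 0 (v * m + i) := Suc (length (vs i))))"
proof -
  have "set (U @ [v]) = (\<Union>i'<m. set ((vs(i := vs i @ [v])) i'))"
    using assms unfolding filled_def by (auto split: if_splits)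
  then show ?thesis
    using assms unfolding filled_def
    by (auto simp: input_mem_cell cell_eq_iff mult_add_eq_iff nth_append less_Suc_eq
        intro: is_pos_last is_pos_snoc)
qed

definition processed :: "nat \<Rightarrow> nat \<Rightarrow> nat \<Rightarrow> nat list" where
  "processed i j i' = (if i' < i then vss ! i' else if i' = i then take j (vss ! i) else [])"

lemma processed_Suc: "j < n i \<Longrightarrow>
    processed i (Suc j) = (processed i j)(i := processed i j i @ [vss ! i ! j])"
  by (auto simp: processed_def n_def take_Suc_conv_app_nth)

lemma length_processed: "j \<le> n i \<Longrightarrow> length (processed i j i) = j"
  by (simp add: processed_def n_def)

lemma processed_n: "processed i (n i) = processed (Suc i) 0"
  by (rule ext) (auto simp: processed_def n_def less_Suc_eq)

end

section \<open>Safety, running time and result combined in one judgement\<close>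

definition ok :: "nat \<Rightarrow> nat \<Rightarrow> prog \<Rightarrow> state \<Rightarrow> (state \<Rightarrow> bool) \<Rightarrow> bool" where
  "ok w T p \<sigma> Q \<longleftrightarrow> safe w p \<sigma> \<and> time p \<sigma> \<le> T \<and> Q (run p \<sigma>)"

lemma ok_Sq:
  assumes "ok w T1 p \<sigma> R" "\<And>\<tau>. R \<tau> \<Longrightarrow> ok w T2 q \<tau> Q"
  shows "ok w (T1 + T2) (p ;; q) \<sigma> Q"
  using assms unfolding ok_def by (fastforce intro: add_mono)

lemma ok_For:
  assumes "well_formed (For r e p)" "eval \<sigma> e = n" "n < 2 ^ w" "1 < (2::nat) ^ w"
    and "I 0 (set_reg r 0 \<sigma>)"
    and "\<And>j \<tau>. j < n \<Longrightarrow> I j \<tau> \<Longrightarrow> reg \<tau> r = j \<Longrightarrow> ok w T p \<tau> (\<lambda>\<tau>'. I (Suc j) (set_reg r (Suc j) \<tau>'))"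
  shows "ok w (6 + n * (8 + T)) (For r e p) \<sigma> (I n)"
  using For_invariant[where I = I and T = T, OF assms(1-5)] assms(6) unfolding ok_def by blast

lemma ok_weaken: "ok w T p \<sigma> Q \<Longrightarrow> T \<le> T' \<Longrightarrow> (\<And>\<tau>. Q \<tau> \<Longrightarrow> Q' \<tau>) \<Longrightarrow> ok w T' p \<sigma> Q'"
  unfolding ok_def by auto

lemma ok_if_bounded:
  assumes "well_formed p" "bound_regs p \<inter> writes p = {}" "bounded_by M \<sigma>" "consts_of p \<subseteq> {..M}" "2 \<le> M"
    and "\<And>q. q \<in> bound_regs p \<Longrightarrow> reg \<sigma> q \<le> \<rho> q" "static_time \<rho> p \<le> T" "tower M T < 2 ^ w"
  shows "ok w T p \<sigma> (\<lambda>\<tau>. \<tau> = run p \<sigma> \<and> bounded_by (tower M T) \<tau>)"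
proof -
  have "time p \<sigma> \<le> T"
    using time_le_static_time[OF assms(1,2,6)] assms(7) by simp
  then show ?thesis using safe_if_bounded[OF assms(1,3-5) _ assms(8)] by (simp add: ok_def)
qed

context encoded_input begin

abbreviation full :: "nat \<Rightarrow> nat list" where "full \<equiv> processed m 0"

lemma full: "i < m \<Longrightarrow> full i = vss ! i"
  by (simp add: processed_def)

lemma length_le_if_filled:
  assumes "filled vs U \<mu>'" "\<And>i. i < m \<Longrightarrow> length (vs i) \<le> n i"
  shows "length U \<le> (\<Sum>i<m. n i)"
proof -
  have "length U = card (\<Union>i<m. set (vs i))"
    using assms(1) by (simp add: filled_def distinct_card[symmetric])
  also have "\<dots> \<le> (\<Sum>i<m. card (set (vs i)))" by (rule card_UN_le) simp
  also have "\<dots> \<le> (\<Sum>i<m. n i)"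
    using assms(2) card_length order_trans by (intro sum_mono) blast
  finally show ?thesis .
qed

lemma length_processed_le: "length (processed i j i') \<le> n i'"
  by (simp add: processed_def n_def)

lemma sum_n_le: "(\<Sum>i<m. n i) \<le> A"
  unfolding off_def by (rule trans_le_add2, rule sum_mono) simp

lemma n_less: "i < m \<Longrightarrow> n i < A"
  using off_Suc_le[of i] by linarith

end

text \<open>\<open>M\<close> bounds everything that survives a round: addresses, vertex names, the
  number of tuples and thereby every count, and \<open>s * s + 4\<close> for the constants in the
  programs. \<open>T0\<close> bounds the time of one round.\<close>

locale bounded_input = encoded_input +
  fixes M w T0 :: nat
  assumes M_ge: "2 \<le> M" "s * s + 4 \<le> M" "A \<le> M" "(\<Sum>i<m. n i) ^ s \<le> M"
    and vss_le: "i < m \<Longrightarrow> v \<in> set (vss ! i) \<Longrightarrow> v \<le> M"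
    and tower_less: "tower M T0 < 2 ^ w"
    and T0_ge: "static_time (\<lambda>_. m) fill_step \<le> T0" "static_time (\<lambda>_. m) walk \<le> T0"
      "static_time (\<lambda>_. m) (count_tuple s) \<le> T0" "10 \<le> T0" "cost (power_exp (Reg rU) s) < T0"
begin

lemma M_less: "M < 2 ^ w" "1 < (2::nat) ^ w"
  using tower_ge[OF M_ge(1), of T0] tower_less M_ge(1) by linarith+

text \<open>Inside a short part numbers may grow up to \<open>tower M T0\<close>. This intermediate
  bound is forgotten; \<open>Q\<close> speaks of the final state only, and invariants re-establish
  \<open>bounded_by M\<close> from the known result.\<close>

lemma ok_short:
  assumes "well_formed p" "bound_regs p \<inter> writes p = {}" "bounded_by M \<sigma>"
    "consts_of p \<subseteq> {..s * s + 4}"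
    "\<And>q. q \<in> bound_regs p \<Longrightarrow> reg \<sigma> q \<le> m" "static_time (\<lambda>_. m) p \<le> T0" "Q (run p \<sigma>)"
  shows "ok w T0 p \<sigma> Q"
  by (rule ok_weaken[OF ok_if_bounded[of p M \<sigma> "\<lambda>_. m" T0]])
    (use assms M_ge tower_less in \<open>auto simp: subset_iff intro: order_trans\<close>)

lemma m_le: "m \<le> A"
proof -
  have "(\<Sum>j<m. 1) \<le> (\<Sum>j<m. 1 + n j + n j * n j)" by (rule sum_mono) simp
  then show ?thesis by (simp add: off_def)
qed

definition fill_inv :: "nat \<Rightarrow> nat \<Rightarrow> state \<Rightarrow> bool" where
  "fill_inv i j \<sigma> \<longleftrightarrow> reg \<sigma> rE = E \<and> reg \<sigma> rM = m \<and> reg \<sigma> rA = A \<and> reg \<sigma> rPtr = off i \<and>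
    reg \<sigma> rRes = 0 \<and>
    bounded_by M \<sigma> \<and> (\<forall>t. mem \<sigma> (cell A 2 t) = 0) \<and>
    (\<exists>U. reg \<sigma> rU = length U \<and> filled (processed i j) U (mem \<sigma>))"

lemma ok_fill_step:
  assumes "i < m" "j < n i" and inv: "fill_inv i j \<sigma>"
    and regs: "reg \<sigma> rN = n i" "reg \<sigma> rI = i" "reg \<sigma> rJ = j"
  shows "ok w T0 fill_step \<sigma> (\<lambda>\<tau>. fill_inv i (Suc j) (set_reg rJ (Suc j) \<tau>) \<and>
    reg \<tau> rN = n i \<and> reg \<tau> rI = i)"
proof (rule ok_short)
  obtain U where U: "reg \<sigma> rU = length U" "filled (processed i j) U (mem \<sigma>)"
    and r: "reg \<sigma> rE = E" "reg \<sigma> rM = m" "reg \<sigma> rA = A" "reg \<sigma> rPtr = off i" "bounded_by M \<sigma>"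
    "reg \<sigma> rRes = 0" "\<And>t. mem \<sigma> (cell A 2 t) = 0"
    using inv unfolding fill_inv_def by auto
  let ?v = "vss ! i ! j"
  have v: "mem \<sigma> (Suc (off i + j)) = ?v" and seen: "mem \<sigma> (cell A 3 ?v) = of_bool (?v \<in> set U)"
    using U(2) assms by (auto simp: filled_def input_mem_def)
  have vM: "?v \<le> M" using assms vss_le[of i ?v] by (simp add: n_def)
  have j: "Suc j \<le> M" using assms n_less[of i] M_ge by linarith
  have len: "length (processed i j i) = j" using assms length_processed by simp
  show "fill_inv i (Suc j) (set_reg rJ (Suc j) (run fill_step \<sigma>)) \<and>
    reg (run fill_step \<sigma>) rN = n i \<and> reg (run fill_step \<sigma>) rI = i"
  proof (cases "?v \<in> set U")
    case True
    have run: "run fill_step \<sigma> =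
        set_mem (cell A 0 (?v * m + i)) (Suc j) (set_reg rV ?v (set_reg rV ?v \<sigma>))"
      using True by (simp add: fill_step_def r regs v seen)
    have "filled (processed i (Suc j)) U ((mem \<sigma>)(cell A 0 (?v * m + i) := Suc j))"
      unfolding processed_Suc[OF assms(2)] using filled_seen[OF U(2) assms(1) True] len by simp
    moreover have "bounded_by M (set_reg rJ (Suc j) (run fill_step \<sigma>))"
      unfolding run using r vM j by (intro bounded_by_set_reg bounded_by_set_mem)
    ultimately show ?thesis using U(1) r regs
      unfolding fill_inv_def by (auto simp: run cell_eq_iff intro!: exI[of _ U])
  next
    case False
    have run: "run fill_step \<sigma> =
        set_mem (cell A 0 (?v * m + i)) (Suc j) (set_reg rU (Suc (length U))
          (set_mem (cell A 1 (length U)) ?v (set_mem (cell A 3 ?v) 1 (set_reg rV ?v \<sigma>))))"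
      using False by (simp add: fill_step_def r regs v seen U)
    have new: "filled (processed i (Suc j)) (U @ [?v]) ((mem \<sigma>)
        (cell A 3 ?v := 1, cell A 1 (length U) := ?v, cell A 0 (?v * m + i) := Suc j))"
      unfolding processed_Suc[OF assms(2)] using filled_new[OF U(2) assms(1) False] len by simp
    \<comment> \<open>The listed vertices are distinct, so even with the new one they are at most as
      many as the entries of all vertex lists.\<close>
    have "Suc (length U) \<le> M"
      using length_le_if_filled[OF new length_processed_le] sum_n_le M_ge(3) by simp
    then have "bounded_by M (set_reg rJ (Suc j) (run fill_step \<sigma>))"
      unfolding run using r vM j M_ge(1) by (intro bounded_by_set_reg bounded_by_set_mem) auto
    then show ?thesis using U(1) r regs new
      unfolding fill_inv_def by (auto simp: run cell_eq_iff intro!: exI[of _ "U @ [?v]"])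
  qed
qed (use T0_ge inv in \<open>auto simp: fill_step_def fill_inv_def\<close>)

lemma ok_fill_graph:
  assumes i: "i < m" and inv: "fill_inv i 0 \<sigma>" and regs: "reg \<sigma> rI = i"
  shows "ok w (T0 + (6 + n i * (8 + T0) + T0)) fill_graph \<sigma>
    (\<lambda>\<tau>. fill_inv (Suc i) 0 (set_reg rI (Suc i) \<tau>))"
  unfolding fill_graph_def
proof (rule ok_Sq, rule_tac [2] ok_Sq)
  have le: "off i \<le> M" "n i \<le> M" "off (Suc i) \<le> M" "Suc i \<le> M"
    using i off_mono[of i m] off_mono[of "Suc i" m] n_less[of i] m_le M_ge by linarith+
  let ?J = "\<lambda>j \<tau>. fill_inv i j \<tau> \<and> reg \<tau> rN = n i \<and> reg \<tau> rI = i"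
  show "ok w T0 (Asg rN (Mem (Reg rPtr))) \<sigma> (?J 0)"
  proof (rule ok_short)
    have "mem \<sigma> (off i) = n i" using inv i by (auto simp: fill_inv_def filled_def input_mem_def)
    then show "?J 0 (run (Asg rN (Mem (Reg rPtr))) \<sigma>)"
      using inv regs le by (simp add: fill_inv_def bounded_by_set_reg)
  qed (use T0_ge inv in \<open>auto simp: fill_inv_def\<close>)
  fix \<tau> assume \<tau>: "?J 0 \<tau>"
  show "ok w (6 + n i * (8 + T0)) (For rJ (Reg rN) fill_step) \<tau> (?J (n i))"
  proof (rule ok_For[where I = ?J])
    fix j \<tau> assume "j < n i" "?J j \<tau>" "reg \<tau> rJ = j"
    then show "ok w T0 fill_step \<tau> (\<lambda>\<tau>'. ?J (Suc j) (set_reg rJ (Suc j) \<tau>'))"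
      using ok_fill_step[OF i, of j \<tau>] by (auto elim: ok_weaken)
  qed (use \<tau> le M_less in \<open>auto simp: fill_step_def fill_inv_def intro: bounded_by_set_reg\<close>)
next
  fix \<tau> assume \<tau>: "fill_inv i (n i) \<tau> \<and> reg \<tau> rN = n i \<and> reg \<tau> rI = i"
  have le: "off i \<le> M" "n i \<le> M" "off (Suc i) \<le> M" "Suc i \<le> M"
    using i off_mono[of i m] off_mono[of "Suc i" m] n_less[of i] m_le M_ge by linarith+
  show "ok w T0 (Asg rPtr (Reg rPtr \<oplus> Num 1 \<oplus> Reg rN \<oplus> Reg rN \<otimes> Reg rN)) \<tau>
     (\<lambda>\<tau>. fill_inv (Suc i) 0 (set_reg rI (Suc i) \<tau>))"
    by (rule ok_short) (use \<tau> le T0_ge in \<open>auto simp: fill_inv_def off_Suc processed_n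
        intro!: bounded_by_set_reg\<close>)
qed

lemma ok_fill:
  assumes \<sigma>: "reg \<sigma> rE = E" "reg \<sigma> rM = m" "reg \<sigma> rA = A" "reg \<sigma> rU = 0" "reg \<sigma> rRes = 0"
    "bounded_by M \<sigma>" "input_mem (mem \<sigma>)" "\<And>x. A \<le> x \<Longrightarrow> mem \<sigma> x = 0"
    and n: "\<And>i. i < m \<Longrightarrow> n i \<le> n_max"
  shows "ok w (T0 + (6 + m * (8 + (T0 + (6 + n_max * (8 + T0) + T0))))) fill \<sigma> (fill_inv m 0)"
  unfolding fill_def
proof (rule ok_Sq)
  have E: "E \<le> M" using off_mono[of 0 m] M_ge by (simp add: off_0)
  show "ok w T0 (Asg rPtr (Reg rE)) \<sigma> (fill_inv 0 0)"
  proof (rule ok_short)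
    have "filled (processed 0 0) [] (mem \<sigma>)"
      using \<sigma> by (simp add: filled_def processed_def is_pos_def cell_ge)
    then show "fill_inv 0 0 (run (Asg rPtr (Reg rE)) \<sigma>)"
      using \<sigma> E cell_ge by (auto simp: fill_inv_def off_0 intro!: bounded_by_set_reg)
  qed (use \<sigma> T0_ge in auto)
  fix \<tau> assume \<tau>: "fill_inv 0 0 \<tau>"
  show "ok w (6 + m * (8 + (T0 + (6 + n_max * (8 + T0) + T0)))) (For rI (Reg rM) fill_graph) \<tau>
     (fill_inv m 0)"
  proof (rule ok_For[where I = "\<lambda>i. fill_inv i 0"])
    fix i \<tau> assume i: "i < m" "fill_inv i 0 \<tau>" "reg \<tau> rI = i"
    show "ok w (T0 + (6 + n_max * (8 + T0) + T0)) fill_graph \<tau>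
        (\<lambda>\<tau>'. fill_inv (Suc i) 0 (set_reg rI (Suc i) \<tau>'))"
      by (rule ok_weaken[OF ok_fill_graph[OF i]]) (simp_all add: n[OF i(1)])
  qed (use \<tau> M_less m_le M_ge in \<open>auto simp: fill_graph_def fill_step_def fill_inv_def
      intro: bounded_by_set_reg\<close>)
qed

lemma ok_walk:
  assumes \<sigma>: "reg \<sigma> rE = E" "reg \<sigma> rM = m" "bounded_by M \<sigma>" "input_mem (mem \<sigma>)"
  shows "ok w T0 walk \<sigma> (\<lambda>\<tau>. reg \<tau> rE = E \<and> reg \<tau> rM = m \<and> reg \<tau> rA = A \<and>
    reg \<tau> rU = reg \<sigma> rU \<and> reg \<tau> rRes = reg \<sigma> rRes \<and> bounded_by M \<tau> \<and> mem \<tau> = mem \<sigma>)"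
proof (rule ok_short)
  have E: "E \<le> M" using off_mono[of 0 m] M_ge by (simp add: off_0)
  let ?I = "\<lambda>i \<tau>. reg \<tau> rE = E \<and> reg \<tau> rM = m \<and> reg \<tau> rA = off i \<and>
    reg \<tau> rU = reg \<sigma> rU \<and> reg \<tau> rRes = reg \<sigma> rRes \<and> bounded_by M \<tau> \<and> mem \<tau> = mem \<sigma>"
  let ?p = "Asg rN (Mem (Reg rA)) ;; Asg rA (Reg rA \<oplus> Num 1 \<oplus> Reg rN \<oplus> Reg rN \<otimes> Reg rN)"
  have "?I m (run (For rI (Reg rM) ?p) (set_reg rA E \<sigma>))"
  proof (rule run_For[where I = ?I])
    fix i \<tau> assume i: "i < m" "?I i \<tau>" "reg \<tau> rI = i"
    have le: "n i \<le> M" "off (Suc i) \<le> M" "Suc i \<le> M"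
      using i(1) off_mono[of "Suc i" m] n_less[of i] m_le M_ge by linarith+
    have "mem \<sigma> (off i) = n i" using \<sigma> i(1) by (simp add: input_mem_def)
    then show "?I (Suc i) (set_reg rI (Suc i) (run ?p \<tau>))"
      using i le by (auto simp: off_Suc intro!: bounded_by_set_reg)
  qed (use \<sigma> E in \<open>auto simp: off_0 intro!: bounded_by_set_reg\<close>)
  then show "reg (run walk \<sigma>) rE = E \<and> reg (run walk \<sigma>) rM = m \<and> reg (run walk \<sigma>) rA = A \<and>
    reg (run walk \<sigma>) rU = reg \<sigma> rU \<and> reg (run walk \<sigma>) rRes = reg \<sigma> rRes \<and>
    bounded_by M (run walk \<sigma>) \<and> mem (run walk \<sigma>) = mem \<sigma>"
    using \<sigma> by (simp add: walk_def bounded_by_set_reg del: run.simps(5))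
qed (use assms T0_ge in \<open>auto simp: walk_def\<close>)

end

section \<open>Computing and counting the codes of the tuples\<close>

context encoded_input begin

definition pair_digit :: "nat \<Rightarrow> nat \<Rightarrow> nat \<Rightarrow> nat" where
  "pair_digit i v u = of_bool ((v, u) \<in> parcs (Gs ! i)) + 2 * of_bool (v = u \<and> v \<in> pverts (Gs ! i))"

lemma storeless_digit_step [simp]: "storeless digit_step"
  and writes_digit_step [simp]: "writes digit_step = {rN, rP1, rP2, rTau, rV, rPw, rPtr}"
  by (auto simp: digit_step_def)

lemma run_digit_step:
  assumes i: "i < m" and filled: "filled full U (mem \<sigma>)"
    and r: "reg \<sigma> rI = i" "reg \<sigma> rM = m" "reg \<sigma> rA = A" "reg \<sigma> rPtr = off i"
    "reg \<sigma> rX = v" "reg \<sigma> rY = u"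
  shows "reg (run digit_step \<sigma>) rTau = reg \<sigma> rTau + reg \<sigma> rPw * pair_digit i v u"
    and "reg (run digit_step \<sigma>) rPw = reg \<sigma> rPw * 4"
    and "reg (run digit_step \<sigma>) rPtr = off (Suc i)"
proof -
  define p1 p2 where "p1 = mem \<sigma> (cell A 0 (v * m + i))" and "p2 = mem \<sigma> (cell A 0 (u * m + i))"
  have pos: "is_pos (vss ! i) v p1" "is_pos (vss ! i) u p2"
    using filled i by (auto simp: filled_def p1_def p2_def full)
  have n: "mem \<sigma> (off i) = n i" using filled i by (simp add: filled_def input_mem_def)
  let ?d = "if p1 * p2 \<noteq> 0 then mem \<sigma> (Suc (off i + n i + (p1 - 1) * n i + (p2 - 1))) + 2 * of_bool (p1 = p2) else 0"
  have "?d = pair_digit i v u"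
  proof (cases "p1 = 0 \<or> p2 = 0")
    case True
    then have "v \<notin> pverts (Gs ! i) \<or> u \<notin> pverts (Gs ! i)"
      using pos set_vss[OF i] by (auto simp: is_pos_def split: if_splits)
    \<comment> \<open>Arcs join vertices of the same graph, so a missing position forces both bits
      of the digit to be 0.\<close>
    then show ?thesis using True wf_Gs[OF i] by (auto simp: pair_digit_def)
  next
    case False
    then have p: "p1 - 1 < n i" "p2 - 1 < n i" "vss ! i ! (p1 - 1) = v" "vss ! i ! (p2 - 1) = u"
      "v \<in> pverts (Gs ! i)"
      using pos set_vss[OF i] by (auto simp: is_pos_def n_def split: if_splits)
    have "p1 = p2 \<longleftrightarrow> v = u"
      using p distinct_vss[OF i] False nth_eq_iff_index_eq[of "vss ! i" "p1 - 1" "p2 - 1"]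
      by (auto simp: n_def)
    moreover have "mem \<sigma> (Suc (off i + n i + (p1 - 1) * n i + (p2 - 1))) = of_bool ((v, u) \<in> parcs (Gs ! i))"
      using filled i p by (auto simp: filled_def input_mem_def)
    ultimately show ?thesis using False p by (simp add: pair_digit_def)
  qed
  then show "reg (run digit_step \<sigma>) rTau = reg \<sigma> rTau + reg \<sigma> rPw * pair_digit i v u"
    by (auto simp: digit_step_def r n p1_def[symmetric] p2_def[symmetric] add.assoc split: if_splits)
  show "reg (run digit_step \<sigma>) rPw = reg \<sigma> rPw * 4"
    and "reg (run digit_step \<sigma>) rPtr = off (Suc i)"
    by (auto simp: digit_step_def r n off_Suc)
qed

lemma storeless_load_entry [simp]: "storeless (load_entry s' r k)"
  and writes_load_entry [simp]: "writes (load_entry s' r k) = {r, rS}"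
  by (auto simp: load_entry_def)

lemma run_load_entry:
  assumes filled: "filled full U (mem \<sigma>)" and t: "t < length U ^ s"
    and r: "reg \<sigma> rT = t" "reg \<sigma> rU = length U" "reg \<sigma> rA = A" "r \<notin> {rT, rU, rA, rS}"
    and k: "p < s" "\<And>\<tau>. reg \<tau> rPQ = reg \<sigma> rPQ \<Longrightarrow> eval \<tau> k = p" and "r \<noteq> rPQ"
  shows "reg (run (load_entry s r k) \<sigma>) r = entry U t p"
proof -
  let ?\<sigma> = "set_reg r t \<sigma>"
  have "reg (run (shift r rS (Reg rU) k (Num s)) ?\<sigma>) r = reg ?\<sigma> r div length U ^ min s p"
    using r k \<open>r \<noteq> rPQ\<close> by (intro run_shift) auto
  moreover have "0 < length U" using t s by (cases "length U = 0"; cases s) auto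
  then have "mem \<sigma> (cell A 1 (t div length U ^ p mod length U)) = entry U t p"
    using filled by (simp add: filled_def entry_def)
  ultimately show ?thesis using r k(1) by (simp add: load_entry_def run_frame mem_run min_def)
qed

lemma storeless_tuple_code [simp]: "storeless (tuple_code s')"
  and writes_tuple_code [simp]: "writes (tuple_code s') =
    {rTau, rPw, rPQ, rX, rY, rS, rPtr, rI, rN, rP1, rP2, rV}"
  by (auto simp: tuple_code_def)

lemma col_digit_eq: "pq < s * s \<Longrightarrow> i < m \<Longrightarrow>
    col_digit Gs s U t (pq * m + i) = pair_digit i (entry U t (pq div s)) (entry U t (pq mod s))"
proof -
  assume "i < m"
  then have "(pq * m + i) div m = pq" by (intro div_nat_eqI) (auto simp: algebra_simps)
  then show ?thesis using \<open>i < m\<close> by (simp add: col_digit_def pair_digit_def Let_def)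
qed

text \<open>The digit index \<open>pq * m + i\<close> runs through consecutive numbers across the
  two nested loops. Hence one formula, the value of the first \<open>e\<close> digits together with
  the place value \<open>4 ^ e\<close>, is an invariant of both.\<close>

lemma run_tuple_code:
  assumes filled: "filled full U (mem \<sigma>)" and t: "t < length U ^ s"
    and r: "reg \<sigma> rT = t" "reg \<sigma> rU = length U" "reg \<sigma> rA = A" "reg \<sigma> rM = m" "reg \<sigma> rE = E"
  shows "reg (run (tuple_code s) \<sigma>) rTau = col_code Gs s U t"
proof -
  let ?C = "\<lambda>\<tau> :: state. mem \<tau> = mem \<sigma> \<and> reg \<tau> rT = t \<and> reg \<tau> rU = length U \<and> reg \<tau> rA = A \<and>
    reg \<tau> rM = m \<and> reg \<tau> rE = E"
  let ?D = "\<lambda>e (\<tau> :: state). reg \<tau> rTau = dvalue 4 (map (col_digit Gs s U t) [0..<e]) \<and> reg \<tau> rPw = 4 ^ e"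
  let ?p = "load_entry s rX (Reg rPQ quot Num s) ;; load_entry s rY (Reg rPQ rem Num s) ;;
      Asg rPtr (Reg rE) ;; For rI (Reg rM) digit_step"
  let ?I = "\<lambda>pq \<tau>. ?C \<tau> \<and> ?D (pq * m) \<tau>"
  have "?I (s * s) (run (For rPQ (Num (s * s)) ?p) (set_reg rPw 1 (set_reg rTau 0 \<sigma>)))"
  proof (rule run_For[where I = ?I])
    fix pq \<tau> assume pq: "pq < s * s" and I: "?I pq \<tau>" and rpq: "reg \<tau> rPQ = pq"
    have ps: "pq div s < s" "pq mod s < s"
      using pq s by (simp_all add: less_mult_imp_div_less)
    let ?v = "entry U t (pq div s)" and ?u = "entry U t (pq mod s)"
    let ?\<tau>1 = "run (load_entry s rX (Reg rPQ quot Num s)) \<tau>"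
    let ?\<tau>2 = "run (load_entry s rY (Reg rPQ rem Num s)) ?\<tau>1"
    have 1: "reg ?\<tau>1 rX = ?v"
      by (rule run_load_entry) (use filled t I ps rpq in auto)
    have 2: "reg ?\<tau>2 rY = ?u"
      by (rule run_load_entry) (use filled t I ps rpq in \<open>auto simp: mem_run run_frame\<close>)
    let ?J = "\<lambda>i \<tau>. ?C \<tau> \<and> ?D (pq * m + i) \<tau> \<and> reg \<tau> rPtr = off i \<and> reg \<tau> rX = ?v \<and> reg \<tau> rY = ?u"
    have "?J m (run (For rI (Reg rM) digit_step) (set_reg rPtr E ?\<tau>2))"
    proof (rule run_For[where I = ?J])
      show "?J 0 (set_reg rI 0 (set_reg rPtr E ?\<tau>2))"
        using I 1 2 by (simp add: mem_run run_frame off_0)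
      fix i \<tau>' assume i: "i < m" "?J i \<tau>'" "reg \<tau>' rI = i"
      note step = run_digit_step[OF i(1), of U \<tau>' ?v ?u]
      have e: "map (col_digit Gs s U t) [0..<pq * m + Suc i] =
          map (col_digit Gs s U t) [0..<pq * m + i] @ [pair_digit i ?v ?u]"
        using col_digit_eq[OF pq i(1)] by simp
      show "?J (Suc i) (set_reg rI (Suc i) (run digit_step \<tau>'))"
        using i filled step unfolding e dvalue_snoc by (simp add: mem_run run_frame)
    qed (use I in \<open>simp add: run_frame\<close>)
    then show "?I (Suc pq) (set_reg rPQ (Suc pq) (run ?p \<tau>))"
      using I by (simp add: run_frame add.commute del: run.simps(5))
  qed (use r in auto)
  then show ?thesis by (simp add: tuple_code_def col_code_def del: run.simps(5))
qed

lemma filled_cell_2: "filled vs U \<mu>' \<Longrightarrow> filled vs U (\<mu>'(cell A 2 t := y))"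
  unfolding filled_def by (auto simp: input_mem_cell cell_eq_iff)

end

context bounded_input begin

definition count_inv :: "nat list \<Rightarrow> nat \<Rightarrow> state \<Rightarrow> bool" where
  "count_inv U t \<sigma> \<longleftrightarrow> reg \<sigma> rE = E \<and> reg \<sigma> rM = m \<and> reg \<sigma> rA = A \<and> reg \<sigma> rU = length U \<and>
    reg \<sigma> rRes = 0 \<and> bounded_by M \<sigma> \<and> filled full U (mem \<sigma>) \<and>
    (\<forall>\<tau>. mem \<sigma> (cell A 2 \<tau>) = card {t' \<in> {..<t}. col_code Gs s U t' = \<tau>})"

lemma ok_count_tuple:
  assumes inv: "count_inv U t \<sigma>" and t: "t < length U ^ s" "reg \<sigma> rT = t" and U: "length U ^ s \<le> M"
  shows "ok w T0 (count_tuple s) \<sigma> (\<lambda>\<tau>. count_inv U (Suc t) (set_reg rT (Suc t) \<tau>))"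
proof (rule ok_short)
  let ?c = "col_code Gs s U t"
  let ?\<tau> = "set_mem (cell A 2 ?c) (Suc (mem \<sigma> (cell A 2 ?c))) (run (tuple_code s) \<sigma>)"
  have code: "reg (run (tuple_code s) \<sigma>) rTau = ?c"
    using inv t by (intro run_tuple_code) (auto simp: count_inv_def)
  have run: "run (count_tuple s) \<sigma> = run clear ?\<tau>"
    using inv by (simp add: count_tuple_def code run_frame mem_run count_inv_def)
  have card: "card {t' \<in> {..<Suc t}. col_code Gs s U t' = c} =
      card {t' \<in> {..<t}. col_code Gs s U t' = c} + of_bool (c = ?c)" for c
  proof -
    have "{t' \<in> {..<Suc t}. col_code Gs s U t' = c} =
        (if c = ?c then insert t else id) {t' \<in> {..<t}. col_code Gs s U t' = c}"
      by (auto simp: less_Suc_eq)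
    then show ?thesis by simp
  qed
  \<comment> \<open>A count never exceeds the number of tuples, so increments do not wear out the
    bound \<open>M\<close>.\<close>
  have le: "card {t' \<in> {..<Suc t}. col_code Gs s U t' = ?c} \<le> M"
  proof -
    have "card {t' \<in> {..<Suc t}. col_code Gs s U t' = ?c} \<le> card {..<Suc t}"
      by (intro card_mono) auto
    then show ?thesis using t U by simp
  qed
  have mem: "mem ?\<tau> = (mem \<sigma>)(cell A 2 ?c := card {t' \<in> {..<Suc t}. col_code Gs s U t' = ?c})"
    using inv unfolding card by (simp add: mem_run count_inv_def)
  \<comment> \<open>Every register written while coding the tuple is 0 again; only the new count and
    the loop counter have to be compared with \<open>M\<close>.\<close>
  have "bounded_by M (set_reg rT (Suc t) (run clear ?\<tau>))"
  proof -
    have "reg (run clear ?\<tau>) r \<le> M" for r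
      using inv by (auto simp: clear_def run_frame count_inv_def bounded_by_def)
    moreover have "mem ?\<tau> a \<le> M" for a
      using inv le unfolding mem by (auto simp: count_inv_def bounded_by_def)
    ultimately show ?thesis using t U by (auto simp: bounded_by_def mem_run[of clear] clear_def)
  qed
  moreover have "filled full U (mem ?\<tau>)"
    using inv unfolding mem by (intro filled_cell_2) (simp add: count_inv_def)
  moreover have "mem ?\<tau> (cell A 2 c) = card {t' \<in> {..<Suc t}. col_code Gs s U t' = c}" for c
    using inv card[of c, simplified] unfolding mem by (auto simp: cell_eq_iff count_inv_def)
  moreover have "mem (run clear ?\<tau>) = mem ?\<tau>" by (simp add: clear_def)
  ultimately show "count_inv U (Suc t) (set_reg rT (Suc t) (run (count_tuple s) \<sigma>))"
    using inv unfolding run count_inv_def by (simp add: run_frame clear_def)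
qed (use inv T0_ge in \<open>auto simp: count_tuple_def tuple_code_def load_entry_def digit_step_def
    clear_def shift_def count_inv_def intro: trans_le_add1\<close>)

lemma ok_count_tuples:
  assumes inv: "count_inv U 0 \<sigma>" and US: "reg \<sigma> rUS = length U ^ s" and U: "length U ^ s \<le> M"
  shows "ok w (6 + length U ^ s * (8 + T0)) (count_tuples s) \<sigma> (count_inv U (length U ^ s))"
  unfolding count_tuples_def
proof (rule ok_For[where I = "count_inv U"])
  fix t \<tau> assume "t < length U ^ s" "count_inv U t \<tau>" "reg \<tau> rT = t"
  then show "ok w T0 (count_tuple s) \<tau> (\<lambda>\<tau>'. count_inv U (Suc t) (set_reg rT (Suc t) \<tau>'))"
    using U by (intro ok_count_tuple)
qed (use assms M_less in \<open>auto simp: count_tuple_def tuple_code_def load_entry_def digit_step_def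
    clear_def shift_def count_inv_def bounded_by_set_reg\<close>)

lemma eval_power_exp [simp]: "eval \<sigma> (power_exp e k) = eval \<sigma> e ^ k"
  by (induction k) auto

lemma exp_consts_power_exp: "exp_consts (power_exp e k) \<subseteq> insert 1 (exp_consts e)"
  by (induction k) auto

lemma ok_phase1:
  assumes \<sigma>: "reg \<sigma> rE = E" "reg \<sigma> rU = 0" "reg \<sigma> rRes = 0"
    "bounded_by M \<sigma>" "input_mem (mem \<sigma>)" "\<And>x. A \<le> x \<Longrightarrow> mem \<sigma> x = 0"
    and n: "\<And>i. i < m \<Longrightarrow> n i \<le> n_max"
  shows "ok w (T0 + (T0 + ((T0 + (6 + m * (8 + (T0 + (6 + n_max * (8 + T0) + T0))))) +
      (T0 + (6 + (m * n_max) ^ s * (8 + T0)))))) (phase1 s) \<sigma>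
    (\<lambda>\<tau>. \<exists>U. distinct U \<and> set U = (\<Union>G\<in>set Gs. pverts G) \<and> count_inv U (length U ^ s) \<tau>)"
  unfolding phase1_def
proof (rule ok_Sq)
  let ?R = "\<lambda>\<tau>. reg \<tau> rE = E \<and> reg \<tau> rM = m \<and> reg \<tau> rU = 0 \<and> reg \<tau> rRes = 0 \<and> bounded_by M \<tau> \<and>
    mem \<tau> = mem \<sigma>"
  show "ok w T0 (Asg rM (Mem (Num 0))) \<sigma> ?R"
  proof (rule ok_short)
    show "?R (run (Asg rM (Mem (Num 0))) \<sigma>)"
      using assms m_le M_ge by (auto simp: input_mem_def intro!: bounded_by_set_reg)
  qed (use \<sigma> T0_ge in auto)
  fix \<tau>1 assume 2: "?R \<tau>1"
  show "ok w (T0 + ((T0 + (6 + m * (8 + (T0 + (6 + n_max * (8 + T0) + T0))))) +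
      (T0 + (6 + (m * n_max) ^ s * (8 + T0))))) (walk ;; fill ;; Asg rUS (power_exp (Reg rU) s) ;; count_tuples s) \<tau>1
    (\<lambda>\<tau>. \<exists>U. distinct U \<and> set U = (\<Union>G\<in>set Gs. pverts G) \<and> count_inv U (length U ^ s) \<tau>)"
  proof (rule ok_Sq[OF ok_walk], goal_cases)
    case (5 \<tau>2)
    show ?case
    proof (rule ok_Sq[OF ok_fill[OF _ _ _ _ _ _ _ _ n]], goal_cases)
      case (10 \<tau>3)
      then obtain U where U: "reg \<tau>3 rU = length U" "filled full U (mem \<tau>3)"
        by (auto simp: fill_inv_def)
      have "length U \<le> (\<Sum>i<m. n i)"
        using U(2) length_processed_le by (rule length_le_if_filled)
      then have Us: "length U ^ s \<le> M"
        using M_ge(4) power_mono[of "length U" "\<Sum>i<m. n i" s] by linarith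
      have "(\<Sum>i<m. n i) \<le> m * n_max" using sum_bounded_above[of "{..<m}" n n_max] n by simp
      then have "length U \<le> m * n_max" using \<open>length U \<le> (\<Sum>i<m. n i)\<close> by linarith
      then have Un: "length U ^ s \<le> (m * n_max) ^ s" by (intro power_mono) auto
      have set: "set U = (\<Union>G\<in>set Gs. pverts G)"
        using U(2) set_vss by (fastforce simp: filled_def full in_set_conv_nth)
      let ?R = "\<lambda>\<tau>. count_inv U 0 \<tau> \<and> reg \<tau> rUS = length U ^ s"
      show ?case
      proof (rule ok_Sq[where R = ?R], goal_cases)
        case 1
        show ?case
        proof (rule ok_short)
          show "?R (run (Asg rUS (power_exp (Reg rU) s)) \<tau>3)"
            using 10 U Us by (auto simp: fill_inv_def count_inv_def intro!: bounded_by_set_reg)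
        qed (use 10 T0_ge exp_consts_power_exp[of "Reg rU" s] s in \<open>auto simp: fill_inv_def\<close>)
      next
        case (2 \<tau>4)
        show ?case
          by (rule ok_weaken[OF ok_count_tuples[of U]])
            (use 2 Us Un U set in \<open>auto simp: filled_def intro!: add_mono mult_le_mono1\<close>)
      qed
    qed (use 5 2 \<sigma> in auto)
  qed (use 2 \<sigma> in auto)
qed

end

section \<open>The second phase: running through the type sequences and testing for cliques\<close>

abbreviation (input) "rL \<equiv> 26 :: nat"
abbreviation (input) "rTT \<equiv> 27 :: nat"
abbreviation (input) "rProd \<equiv> 28 :: nat"
abbreviation (input) "rXX \<equiv> 29 :: nat"
abbreviation (input) "rOk \<equiv> 30 :: nat"
abbreviation (input) "rC \<equiv> 31 :: nat"
abbreviation (input) "rQ \<equiv> 32 :: nat"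
abbreviation (input) "rD \<equiv> 33 :: nat"
abbreviation (input) "rMode \<equiv> 34 :: nat"
abbreviation (input) "rAcc \<equiv> 35 :: nat"
abbreviation (input) "rCh \<equiv> 36 :: nat"
abbreviation (input) "rSt \<equiv> 37 :: nat"
abbreviation (input) "rPos \<equiv> 38 :: nat"
abbreviation (input) "rBits \<equiv> 39 :: nat"
abbreviation (input) "rX2 \<equiv> 40 :: nat"
abbreviation (input) "rCol \<equiv> 41 :: nat"
abbreviation (input) "rGood \<equiv> 42 :: nat"
abbreviation (input) "rIt \<equiv> 43 :: nat"
abbreviation (input) "rMd \<equiv> 44 :: nat"
abbreviation (input) "rTok \<equiv> 45 :: nat"
abbreviation (input) "rBit \<equiv> 46 :: nat"
abbreviation (input) "rLM \<equiv> 47 :: nat"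
abbreviation (input) "rRM \<equiv> 48 :: nat"
abbreviation (input) "rDig \<equiv> 49 :: nat"
abbreviation (input) "rSh \<equiv> 50 :: nat"
abbreviation (input) "rZ \<equiv> 51 :: nat"

definition pow :: "nat \<Rightarrow> exp \<Rightarrow> exp \<Rightarrow> prog" where
  "pow r b n = Asg r (Num 1) ;; For rZ n (Asg r (Reg r \<otimes> b))"

text \<open>\<open>b ^ E\<close> and \<open>2 ^ E\<close> are loop bounds in \<open>sum_up\<close>,
  so they have to sit in registers that are not written any more.\<close>

definition init2 :: "nat \<Rightarrow> prog" where
  "init2 s = pow rFM (Num 4) (Reg rM) ;; pow rB (Reg rFM) (Num (s * s)) ;;
    pow rBE (Reg rB) (Reg rE) ;; pow rTE (Num 2) (Reg rE)"

text \<open>The pending modes are kept on a stack, which is a number in base 4.\<close>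

definition pass_step :: prog where
  "pass_step = Ite (Reg rSt) (
    Asg rMd (Reg rSt rem Num 4) ;; Asg rSt (Reg rSt quot Num 4) ;; Asg rTok (Mem (Reg rPos)) ;;
    Asg rBit (Reg rBits rem Num 2) ;; Asg rBits (Reg rBits quot Num 2) ;;
    Ite (Reg rTok) (
      Asg rLM (Reg rMd) ;; Asg rRM (Reg rMd) ;;
      Ite (Reg rTok \<doteq> Num 3)
        (Ite (Reg rBit) (Asg rRM (Num 3)) (Asg rLM (Num 3)))
        (Ite ((Reg rTok \<doteq> Num 1) \<otimes> (Reg rMd \<doteq> Num 1))
          (Ite (Reg rBit) (Asg rLM (Num 2)) (Asg rRM (Num 2))) skip) ;;
      Asg rSt ((Reg rSt \<otimes> Num 4 \<oplus> Reg rRM) \<otimes> Num 4 \<oplus> Reg rLM) ;;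
      Asg rPos (Reg rPos \<oplus> Num 1)) (
      Ite (Reg rMd \<doteq> Num 3) skip (
        Asg rDig (Reg rX2 rem Reg rB quot Reg rD) ;;
        shift rDig rSh (Num 4) (Mem (Reg rPos \<oplus> Num 1)) (Reg rM) ;;
        Asg rDig (Reg rDig rem Num 4) ;;
        Ite (Reg rMd \<doteq> Num 1) (Asg rDig (Reg rDig rem Num 2)) (Asg rDig (Reg rDig quot Num 2)) ;;
        Asg rGood (Reg rGood \<otimes> Reg rDig) ;; Asg rX2 (Reg rX2 quot Reg rB) ;;
        Asg rCol (Reg rCol \<oplus> Num 1)) ;;
      Asg rPos (Reg rPos \<oplus> Num 2))) skip"

text \<open>\<open>rMode\<close> is a loop counter with values 0 and 1. Adding 1 yields mode 1 or 2,
  which as a number is a stack with a single entry.\<close>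

definition try_choices :: prog where
  "try_choices = Asg rSt (Reg rMode \<oplus> Num 1) ;; Asg rPos (Num 1) ;; Asg rBits (Reg rCh) ;;
    Asg rX2 (Reg rTT) ;; Asg rCol (Num 0) ;; Asg rGood (Num 1) ;; For rIt (Reg rE) pass_step ;;
    Ite (Reg rGood \<otimes> (Reg rCol \<doteq> Reg rL)) (Asg rAcc (Num 1)) skip"

definition accept :: prog where
  "accept = Asg rAcc (Num 0) ;; For rCh (Reg rTE) try_choices"

text \<open>For adjacency both sides of the comparison are bits, and the pair is bad if acceptance
  coincides with the equality of its two rows.\<close>

definition check :: "nat \<Rightarrow> prog" where
  "check s = accept ;;
    Ite (Reg rMode)
      (Ite ((Reg rQ quot Num s \<doteq> Reg rQ rem Num s) \<otimes> (Reg rAcc \<doteq> Num 0)) (Asg rOk (Num 0)) skip)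
      (Ite (Reg rAcc \<doteq> (Reg rQ quot Num s \<doteq> Reg rQ rem Num s)) (Asg rOk (Num 0)) skip)"

definition validate :: "nat \<Rightarrow> prog" where
  "validate s = Asg rD (Num 1) ;;
    For rQ (Num (s * s)) (For rMode (Num 2) (check s) ;; Asg rD (Reg rD \<otimes> Reg rFM))"

text \<open>The loop is bounded by \<open>rE\<close> with a guard, because \<open>rL\<close> is
  itself a counter of \<open>sum_up\<close> and the static time bound admits only bound registers
  that are never written. It leaves \<open>T div b ^ L\<close> in \<open>rXX\<close>, from which
  \<open>summand\<close> reads off whether \<open>T < b ^ L\<close>.\<close>

definition product :: prog where
  "product = Asg rXX (Reg rTT) ;; Asg rProd (Num 1) ;;
    For rC (Reg rE) (Ite (Reg rC \<lessdot> Reg rL) (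
      Asg rProd (Reg rProd \<otimes> Mem (Cell 2 (Reg rXX rem Reg rB))) ;; Asg rXX (Reg rXX quot Reg rB)) skip)"

definition summand :: "nat \<Rightarrow> prog" where
  "summand s = product ;; Asg rOk (Reg rXX \<doteq> Num 0) ;; validate s ;;
    Asg rRes (Reg rRes \<oplus> Reg rOk \<otimes> Reg rProd)"

definition sum_up :: "nat \<Rightarrow> prog" where
  "sum_up s = For rL (Reg rE) (For rTT (Reg rBE) (summand s))"

lemma run_pow:
  assumes "eval \<sigma> n = k" "r \<noteq> rZ" "constant_outside {r, rZ} b" "constant_outside {r} n"
  shows "reg (run (pow r b n) \<sigma>) r = eval \<sigma> b ^ k"
proof -
  let ?I = "\<lambda>j (\<tau> :: state). reg \<tau> r = eval \<sigma> b ^ j \<and> (\<forall>q. q \<notin> {r, rZ} \<longrightarrow> reg \<tau> q = reg \<sigma> q)"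
  have "?I k (run (For rZ n (Asg r (Reg r \<otimes> b))) (set_reg r 1 \<sigma>))"
  proof (rule run_For[where I = ?I])
    show "eval (set_reg r 1 \<sigma>) n = k"
      unfolding assms(1)[symmetric] by (rule eval_constant_outside[OF assms(4)]) simp
    fix j \<tau> assume j: "?I j \<tau>"
    then have "eval \<tau> b = eval \<sigma> b" by (intro eval_constant_outside[OF assms(3)]) simp
    then show "?I (Suc j) (set_reg rZ (Suc j) (run (Asg r (Reg r \<otimes> b)) \<tau>))"
      using j assms(2) by (simp add: mult.commute)
  qed (use assms in auto)
  then show ?thesis by (simp add: pow_def del: run.simps(5))
qed

lemma writes_pow [simp]: "writes (pow r b n) = {r, rZ}"
  and storeless_pow [simp]: "storeless (pow r b n)"
  by (auto simp: pow_def)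

lemma run_init2:
  assumes "reg \<sigma> rM = m" "reg \<sigma> rE = E"
  shows "reg (run (init2 s) \<sigma>) rFM = 4 ^ m" "reg (run (init2 s) \<sigma>) rB = 4 ^ (s * s * m)"
    "reg (run (init2 s) \<sigma>) rBE = (4 ^ (s * s * m)) ^ E" "reg (run (init2 s) \<sigma>) rTE = 2 ^ E"
  by (simp_all add: init2_def run_pow run_frame assms power_mult[symmetric] mult.commute)

definition pass_regs :: "state \<Rightarrow> nat \<times> nat \<times> nat \<times> nat \<times> nat \<times> nat" where
  "pass_regs \<sigma> = (reg \<sigma> rSt, reg \<sigma> rPos, reg \<sigma> rBits, reg \<sigma> rX2, reg \<sigma> rCol, reg \<sigma> rGood)"

text \<open>The effect of \<open>pass_step\<close> on the registers that matter. Modes are nonzero,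
  so the stack is empty iff its number is 0; the left mode is pushed last and popped first. The
  \<open>min m\<close> stems from the \<open>m\<close> rounds of \<open>shift\<close> and leaves
  input indices below \<open>m\<close> unchanged.\<close>

fun astep :: "(nat \<Rightarrow> nat) \<Rightarrow> nat \<Rightarrow> nat \<Rightarrow> nat \<Rightarrow>
    nat \<times> nat \<times> nat \<times> nat \<times> nat \<times> nat \<Rightarrow> nat \<times> nat \<times> nat \<times> nat \<times> nat \<times> nat" where
  "astep \<mu> m D b (st, p, bits, X, c, g) = (if st = 0 then (st, p, bits, X, c, g)
    else if \<mu> p \<noteq> 0 then
      ((st div 4 * 4 + right_mode (\<mu> p) (st mod 4) (bits mod 2)) * 4 +
        left_mode (\<mu> p) (st mod 4) (bits mod 2), p + 1, bits div 2, X, c, g)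
    else if st mod 4 = 3 then (st div 4, p + 2, bits div 2, X, c, g)
    else (st div 4, p + 2, bits div 2, X div b, c + 1,
      g * leaf D b (min m (\<mu> (p + 1))) (st mod 4) X))"

lemma storeless_pass_step [simp]: "storeless pass_step"
  and writes_pass_step [simp]: "writes pass_step =
    {rV, rSt, rPos, rBits, rX2, rCol, rGood, rMd, rTok, rBit, rLM, rRM, rDig, rSh}"
  by (auto simp: pass_step_def)

lemma run_pass_step:
  assumes "reg \<sigma> rB = b" "reg \<sigma> rD = D" "reg \<sigma> rM = m"
  shows "pass_regs (run pass_step \<sigma>) = astep (mem \<sigma>) m D b (pass_regs \<sigma>)"
proof -
  let ?p = "shift rDig rSh (Num 4) (Mem (Reg rPos \<oplus> Num 1)) (Reg rM)"
  have "reg (run ?p \<tau>) rDig = reg \<tau> rDig div 4 ^ min (reg \<tau> rM) (mem \<tau> (reg \<tau> rPos + 1))" for \<tau>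
    by (rule run_shift) auto
  note shift = this[simplified]
  let ?M = "reg \<sigma> rSt mod 4" and ?tok = "mem \<sigma> (reg \<sigma> rPos)"
  consider "reg \<sigma> rSt = 0" | "reg \<sigma> rSt \<noteq> 0" "?tok = 0" "?M = 3" | "reg \<sigma> rSt \<noteq> 0" "?tok = 0" "?M = 1"
    | "reg \<sigma> rSt \<noteq> 0" "?tok = 0" "?M \<noteq> 3" "?M \<noteq> 1" | "reg \<sigma> rSt \<noteq> 0" "?tok = 3"
    | "reg \<sigma> rSt \<noteq> 0" "?tok = 1" "?M = 1"
    | "reg \<sigma> rSt \<noteq> 0" "?tok \<noteq> 0" "?tok \<noteq> 3" "\<not> (?tok = 1 \<and> ?M = 1)" by blast
  then show ?thesis
  proof cases
    case 7
    then have "of_bool (?tok = 1) * of_bool (?M = 1) = (0::nat)" by auto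
    then show ?thesis using assms 7
      by (auto simp: pass_regs_def pass_step_def left_mode_def right_mode_def)
  qed (use assms in \<open>simp_all add: pass_regs_def pass_step_def run_frame mem_run shift
    left_mode_def right_mode_def leaf_def Let_def\<close>)
qed

text \<open>One step per node: reading a subformula pops its mode and leaves the rest
  \<open>st\<close> of the stack as it was. With \<open>st\<close> arbitrary, the mode of the second
  operand can wait on the stack while the first is read.\<close>

lemma astep_encode_formula:
  assumes "\<And>x. x < length (encode_formula f) \<Longrightarrow> \<mu> (p + x) = encode_formula f ! x"
    and "inputs f \<subseteq> {..m}" "M \<in> {1, 2, 3}"
  shows "(astep \<mu> m D b ^^ nodes f) (st * 4 + M, p, s4) =
    (st, p + length (encode_formula f), pass D b f M s4)"
  using assms
proof (induction f arbitrary: M p st s4 rule: node_induct)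
  case (Input i)
  obtain bits X c g where s4: "s4 = (bits, X, c, g)" by (rule prod_cases4)
  have "\<mu> p = 0" "\<mu> (Suc p) = i" using Input(1)[of 0] Input(1)[of 1] by auto
  then show ?case using Input by (auto simp: nodes_def s4)
next
  case (node tok f1 f2)
  obtain bits s3 where s4: "s4 = (bits, s3)" by (cases s4)
  obtain X c g where s3: "s3 = (X, c, g)" by (rule prod_cases3)
  let ?L = "left_mode tok M (bits mod 2)" and ?R = "right_mode tok M (bits mod 2)"
  let ?l1 = "length (encode_formula f1)"
  note enc = encode_node[OF node.hyps, of f1 f2]
  have LR: "?L \<in> {1, 2, 3}" "?R \<in> {1, 2, 3}"
    using node.prems(3) by (auto simp: left_mode_def right_mode_def)
  have tok: "\<mu> p = tok" using node.prems(1)[of 0] by (simp add: enc)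
  have e1: "\<mu> (Suc p + x) = encode_formula f1 ! x" if "x < ?l1" for x
    using node.prems(1)[of "Suc x"] that by (simp add: enc nth_append)
  have e2: "\<mu> (Suc p + ?l1 + x) = encode_formula f2 ! x" if "x < length (encode_formula f2)" for x
    using node.prems(1)[of "Suc (?l1 + x)"] that by (simp add: enc nth_append add.assoc)
  have "(astep \<mu> m D b ^^ nodes (node tok f1 f2)) (st * 4 + M, p, s4) =
      (astep \<mu> m D b ^^ nodes f2) ((astep \<mu> m D b ^^ nodes f1) (astep \<mu> m D b (st * 4 + M, p, s4)))"
  proof -
    have "nodes (node tok f1 f2) = Suc (nodes f2 + nodes f1)" by (simp add: nodes_def)
    then show ?thesis by (simp only: funpow_Suc_right funpow_add o_apply)
  qed
  also have "astep \<mu> m D b (st * 4 + M, p, s4) = ((st * 4 + ?R) * 4 + ?L, Suc p, bits div 2, s3)"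
    using node.prems(3) node.hyps by (auto simp: s4 s3 tok)
  also have "(astep \<mu> m D b ^^ nodes f1) \<dots> =
      (st * 4 + ?R, Suc p + ?l1, pass D b f1 ?L (bits div 2, s3))"
    by (rule node.IH(1)) (use e1 node.prems LR in auto)
  also have "(astep \<mu> m D b ^^ nodes f2) \<dots> =
      (st, Suc p + ?l1 + length (encode_formula f2), pass D b f2 ?R (pass D b f1 ?L (bits div 2, s3)))"
    by (rule node.IH(2)) (use e2 node.prems LR in auto)
  finally show ?case by (simp add: enc s4 pass_node[OF node.hyps])
qed

lemma astep_empty_stack: "(astep \<mu> m D b ^^ k) (0, p, s4) = (0, p, s4)"
  by (induction k) (cases s4; simp)+

lemma length_encode_formula: "length (encode_formula f) = 3 * operations f + 2"
  by (induction f) auto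

lemma nodes_le: "nodes f \<le> 1 + length (encode_formula f)"
  by (simp add: nodes_def length_encode_formula)

text \<open>Longer bit strings bring nothing new, since \<open>pass_sound\<close> holds for every
  string. So the range may be extended to \<open>2 ^ E\<close>, which does not require the program
  to know \<open>nodes f\<close>.\<close>

lemma ex_choices_iff_accepts:
  assumes "nodes f \<le> E"
  shows "(\<exists>bits<2 ^ E. case pass D b f M (bits, X, 0, 1) of (_, _, c, g) \<Rightarrow> c = l \<and> g \<noteq> 0) \<longleftrightarrow>
    accepts D b f M X l"
proof
  assume "accepts D b f M X l"
  then obtain bits where "bits < 2 ^ nodes f"
    "\<exists>bits' X' g. pass D b f M (bits, X, 0, 1) = (bits', X', l, g) \<and> g \<noteq> 0"
    unfolding ex_pass_iff_accepts[symmetric] by blast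
  moreover have "(2::nat) ^ nodes f \<le> 2 ^ E" using assms by (intro power_increasing) auto
  ultimately have "bits < 2 ^ E" "\<exists>bits' X' g. pass D b f M (bits, X, 0, 1) = (bits', X', l, g) \<and> g \<noteq> 0"
    by (linarith, blast)
  then show "\<exists>bits<2 ^ E. case pass D b f M (bits, X, 0, 1) of (_, _, c, g) \<Rightarrow> c = l \<and> g \<noteq> 0"
    by (intro exI[of _ bits]) auto
next
  assume "\<exists>bits<2 ^ E. case pass D b f M (bits, X, 0, 1) of (_, _, c, g) \<Rightarrow> c = l \<and> g \<noteq> 0"
  then obtain bits where *: "case pass D b f M (bits, X, 0, 1) of (_, _, c, g) \<Rightarrow> c = l \<and> g \<noteq> 0"
    by (elim exE conjE)
  obtain bits' X' c g where p: "pass D b f M (bits, X, 0, 1) = (bits', X', c, g)"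
    by (rule prod_cases4)
  show "accepts D b f M X l" using pass_sound[OF p] * unfolding p by auto
qed

lemma storeless_accept [simp]: "storeless accept"
  and writes_accept: "writes accept = {rAcc, rCh, rIt} \<union> writes pass_step"
  by (auto simp: accept_def try_choices_def)

lemma storeless_validate [simp]: "storeless (validate s')"
  and writes_validate: "writes (validate s') = {rD, rQ, rMode, rOk} \<union> writes accept"
  by (auto simp: validate_def check_def writes_accept)

lemma storeless_product [simp]: "storeless product"
  and writes_product: "writes product = {rV, rXX, rProd, rC}"
  by (auto simp: product_def)

lemma storeless_summand [simp]: "storeless (summand s')"
  and writes_summand: "writes (summand s') = {rRes} \<union> writes product \<union> writes (validate s')"
  by (auto simp: summand_def writes_validate)

context encoded_input begin

abbreviation b :: nat where "b \<equiv> 4 ^ (s * s * m)"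

definition env :: "(nat \<Rightarrow> nat) \<Rightarrow> state \<Rightarrow> bool" where
  "env cnt \<sigma> \<longleftrightarrow> input_mem (mem \<sigma>) \<and> (\<forall>\<tau>. mem \<sigma> (cell A 2 \<tau>) = cnt \<tau>) \<and>
    reg \<sigma> rE = E \<and> reg \<sigma> rM = m \<and> reg \<sigma> rA = A \<and> reg \<sigma> rFM = 4 ^ m \<and> reg \<sigma> rB = b \<and>
    reg \<sigma> rBE = b ^ E \<and> reg \<sigma> rTE = 2 ^ E"

lemma env_set_reg [simp]:
  "r \<notin> {rE, rM, rA, rFM, rB, rBE, rTE} \<Longrightarrow> env cnt (set_reg r v \<sigma>) \<longleftrightarrow> env cnt \<sigma>"
  by (auto simp: env_def)

lemma env_run:
  "storeless p \<Longrightarrow> writes p \<inter> {rE, rM, rA, rFM, rB, rBE, rTE} = {} \<Longrightarrow> env cnt (run p \<sigma>) \<longleftrightarrow> env cnt \<sigma>"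
  by (auto simp: env_def mem_run run_frame)

lemma run_pass:
  assumes "env cnt \<sigma>" "reg \<sigma> rD = D" "pass_regs \<sigma> = (M, 1, s4)" "M \<in> {1, 2, 3}"
  shows "pass_regs (run (For rIt (Reg rE) pass_step) \<sigma>) = (0, E, pass D b f M s4)"
proof -
  let ?s = "astep (mem \<sigma>) m D b"
  let ?I = "\<lambda>j \<tau>. pass_regs \<tau> = (?s ^^ j) (pass_regs \<sigma>) \<and> mem \<tau> = mem \<sigma> \<and>
    reg \<tau> rB = b \<and> reg \<tau> rD = D \<and> reg \<tau> rM = m"
  have "?I E (run (For rIt (Reg rE) pass_step) \<sigma>)"
  proof (rule run_For[where I = ?I])
    fix j \<tau> assume j: "?I j \<tau>"
    moreover have "pass_regs (set_reg rIt k \<tau>') = pass_regs \<tau>'" for k \<tau>' by (simp add: pass_regs_def)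
    ultimately show "?I (Suc j) (set_reg rIt (Suc j) (run pass_step \<tau>))"
      using run_pass_step[of \<tau> b D m] by (simp add: run_frame mem_run)
  qed (use assms in \<open>auto simp: env_def pass_regs_def\<close>)
  then have "pass_regs (run (For rIt (Reg rE) pass_step) \<sigma>) = (?s ^^ E) (0 * 4 + M, 1, s4)"
    using assms(3) by simp
  \<comment> \<open>After \<open>nodes f\<close> rounds the stack is empty, and the remaining rounds
    change nothing.\<close>
  also have "\<dots> = (?s ^^ (E - nodes f)) ((?s ^^ nodes f) (0 * 4 + M, 1, s4))"
    using funpow_add[of "E - nodes f" "nodes f" ?s] nodes_le[of f] by (simp del: astep.simps)
  also have "(?s ^^ nodes f) (0 * 4 + M, 1, s4) = (0, E, pass D b f M s4)"
    by (rule astep_encode_formula) (use assms inputs in \<open>auto simp: env_def input_mem_def\<close>)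
  finally show ?thesis by (simp only: astep_empty_stack)
qed

lemma run_accept:
  assumes env: "env cnt \<sigma>" and r: "reg \<sigma> rD = D" "reg \<sigma> rMode = k" "k < 2" "reg \<sigma> rTT = T" "reg \<sigma> rL = L"
  shows "reg (run accept \<sigma>) rAcc = of_bool (accepts D b f (k + 1) T L)"
proof -
  let ?P = "\<lambda>bits. case pass D b f (k + 1) (bits, T, 0, 1) of (_, _, c, g) \<Rightarrow> c = L \<and> g \<noteq> 0"
  let ?I = "\<lambda>j \<tau>. env cnt \<tau> \<and> reg \<tau> rD = D \<and> reg \<tau> rMode = k \<and> reg \<tau> rTT = T \<and> reg \<tau> rL = L \<and>
    reg \<tau> rAcc = of_bool (\<exists>bits<j. ?P bits)"
  have "?I (2 ^ E) (run (For rCh (Reg rTE) try_choices) (set_reg rAcc 0 \<sigma>))"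
  proof (rule run_For[where I = ?I])
    fix j \<tau> assume I: "?I j \<tau>" and j: "reg \<tau> rCh = j"
    define \<tau>1 where "\<tau>1 = set_reg rGood 1 (set_reg rCol 0 (set_reg rX2 T (set_reg rBits j
      (set_reg rPos 1 (set_reg rSt (k + 1) \<tau>)))))"
    define \<tau>2 where "\<tau>2 = run (For rIt (Reg rE) pass_step) \<tau>1"
    have fr: "reg \<tau>2 q = reg \<tau> q" if "q \<notin> insert rIt (writes pass_step)" for q
      using that by (auto simp: \<tau>2_def \<tau>1_def run_frame simp del: run.simps(5))
    have env2: "env cnt \<tau>2"
      using I unfolding \<tau>2_def by (subst env_run) (auto simp: \<tau>1_def)
    have "pass_regs \<tau>2 = (0, E, pass D b f (k + 1) (j, T, 0, 1))"
      unfolding \<tau>2_def by (rule run_pass[of cnt])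
        (use I r(3) in \<open>auto simp: \<tau>1_def pass_regs_def less_2_cases_iff\<close>)
    then have P: "reg \<tau>2 rCol = L \<and> reg \<tau>2 rGood \<noteq> 0 \<longleftrightarrow> ?P j"
      by (auto simp: pass_regs_def split: prod.splits)
    have "run try_choices \<tau> =
        run (Ite (Reg rGood \<otimes> (Reg rCol \<doteq> Reg rL)) (Asg rAcc (Num 1)) skip) \<tau>2"
      using I j by (simp add: try_choices_def \<tau>1_def \<tau>2_def del: run.simps(5))
    also have "\<dots> = (if reg \<tau>2 rCol = reg \<tau>2 rL \<and> reg \<tau>2 rGood \<noteq> 0 then set_reg rAcc 1 \<tau>2
        else set_reg rV (reg \<tau>2 rV) \<tau>2)"
      by auto
    also have "reg \<tau>2 rL = L" using I fr[of rL] by simp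
    finally have run: "run try_choices \<tau> = (if ?P j then set_reg rAcc 1 \<tau>2
        else set_reg rV (reg \<tau>2 rV) \<tau>2)"
      unfolding P .
    show "?I (Suc j) (set_reg rCh (Suc j) (run try_choices \<tau>))"
      using I env2 unfolding run by (auto simp: fr less_Suc_eq)
  qed (use assms in \<open>auto simp: env_def\<close>)
  then have "reg (run accept \<sigma>) rAcc = of_bool (\<exists>bits<2 ^ E. ?P bits)"
    by (simp add: accept_def del: run.simps(5))
  then show ?thesis using ex_choices_iff_accepts[OF nodes_le] by simp
qed

text \<open>\<open>rOk\<close> is only ever lowered to 0, so its initial value, set by
  \<open>summand\<close> from the test \<open>T < b ^ L\<close>, acts as a further conjunct.\<close>

lemma run_validate:
  assumes env: "env cnt \<sigma>" and r: "reg \<sigma> rTT = T" "reg \<sigma> rL = L"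
  shows "reg (run (validate s) \<sigma>) rOk = (if valid s m f L T then reg \<sigma> rOk else 0)"
proof -
  let ?V0 = "\<lambda>pq. accepts (4 ^ (pq * m)) b f 1 T L \<longleftrightarrow> pq div s \<noteq> pq mod s"
  let ?V1 = "\<lambda>pq. pq div s = pq mod s \<longrightarrow> accepts (4 ^ (pq * m)) b f 2 T L"
  let ?C = "\<lambda>pq \<tau>. env cnt \<tau> \<and> reg \<tau> rTT = T \<and> reg \<tau> rL = L \<and> reg \<tau> rD = 4 ^ (pq * m)"
  let ?I = "\<lambda>pq \<tau>. ?C pq \<tau> \<and> reg \<tau> rOk = (if \<forall>pq'<pq. ?V0 pq' \<and> ?V1 pq' then reg \<sigma> rOk else 0)"
  let ?p = "For rMode (Num 2) (check s) ;; Asg rD (Reg rD \<otimes> Reg rFM)"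
  have "?I (s * s) (run (For rQ (Num (s * s)) ?p) (set_reg rD 1 \<sigma>))"
  proof (rule run_For[where I = ?I])
    fix pq \<tau> assume I: "?I pq \<tau>" and pq: "reg \<tau> rQ = pq"
    let ?J = "\<lambda>(k :: nat) (\<tau>' :: state). ?C pq \<tau>' \<and> reg \<tau>' rQ = pq \<and>
      reg \<tau>' rOk = (if (0 < k \<longrightarrow> ?V0 pq) \<and> (1 < k \<longrightarrow> ?V1 pq) then reg \<tau> rOk else 0)"
    have "?J 2 (run (For rMode (Num 2) (check s)) \<tau>)"
    proof (rule run_For[where I = ?J])
      fix k \<tau>' assume k: "k < 2" "?J k \<tau>'" "reg \<tau>' rMode = k"
      have "reg (run accept \<tau>') rAcc = of_bool (accepts (4 ^ (pq * m)) b f (k + 1) T L)"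
        by (rule run_accept[of cnt]) (use k in auto)
      also have "k + 1 = (if k = 0 then 1 else 2)" using k(1) by auto
      finally have acc: "reg (run accept \<tau>') rAcc =
        of_bool (accepts (4 ^ (pq * m)) b f (if k = 0 then 1 else 2) T L)" .
      have "env cnt (run accept \<tau>')" using k by (subst env_run) (auto simp: writes_accept)
      then show "?J (Suc k) (set_reg rMode (Suc k) (run (check s) \<tau>'))"
        using k acc by (cases "k = 0") (simp_all add: check_def run_frame writes_accept)
    qed (use I pq in auto)
    then show "?I (Suc pq) (set_reg rQ (Suc pq) (run ?p \<tau>))"
      using I by (auto simp: less_Suc_eq env_def power_add mult.commute simp del: run.simps(5))
  qed (use assms in auto)
  then show ?thesis by (simp add: validate_def valid_def Let_def del: run.simps(5))
qed

lemma run_product: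
  assumes env: "env cnt \<sigma>" and r: "reg \<sigma> rTT = T" "reg \<sigma> rL = L" and L: "L \<le> E"
  shows "reg (run product \<sigma>) rProd = (\<Prod>c<L. cnt (T div b ^ c mod b))"
    and "reg (run product \<sigma>) rXX = T div b ^ L"
proof -
  let ?I = "\<lambda>j \<tau>. env cnt \<tau> \<and> reg \<tau> rL = L \<and> reg \<tau> rXX = T div b ^ min j L \<and>
    reg \<tau> rProd = (\<Prod>c<min j L. cnt (T div b ^ c mod b))"
  let ?p = "Ite (Reg rC \<lessdot> Reg rL) (
      Asg rProd (Reg rProd \<otimes> Mem (Cell 2 (Reg rXX rem Reg rB))) ;; Asg rXX (Reg rXX quot Reg rB)) skip"
  have "?I E (run (For rC (Reg rE) ?p) (set_reg rProd 1 (set_reg rXX T \<sigma>)))"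
  proof (rule run_For[where I = ?I])
    fix j \<tau> assume j: "?I j \<tau>" "reg \<tau> rC = j"
    show "?I (Suc j) (set_reg rC (Suc j) (run ?p \<tau>))"
    proof (cases "j < L")
      case True
      then have "min (Suc j) L = Suc j" "min j L = j" by auto
      then show ?thesis using j True
        by (simp add: env_def div_mult2_eq[symmetric] mult.commute)
    next
      case False
      then have "min (Suc j) L = L" "min j L = L" by auto
      then show ?thesis using j False by simp
    qed
  qed (use assms in \<open>auto simp: env_def\<close>)
  moreover have "min E L = L" using L by simp
  ultimately show "reg (run product \<sigma>) rProd = (\<Prod>c<L. cnt (T div b ^ c mod b))"
    and "reg (run product \<sigma>) rXX = T div b ^ L"
    using r by (simp_all add: product_def del: run.simps(5))
qed

lemma run_summand:
  assumes env: "env cnt \<sigma>" and r: "reg \<sigma> rTT = T" "reg \<sigma> rL = L" and L: "L \<le> E"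
  shows "reg (run (summand s) \<sigma>) rRes = reg \<sigma> rRes +
    (if T < b ^ L \<and> valid s m f L T then \<Prod>c<L. cnt (T div b ^ c mod b) else 0)"
proof -
  define \<tau> where "\<tau> = set_reg rOk (of_bool (reg (run product \<sigma>) rXX = 0)) (run product \<sigma>)"
  have "env cnt (run product \<sigma>)" using env by (subst env_run) (auto simp: writes_product)
  then have "reg (run (validate s) \<tau>) rOk = (if valid s m f L T then reg \<tau> rOk else 0)"
    by (intro run_validate[of cnt]) (auto simp: \<tau>_def run_frame writes_product r)
  moreover have "T div b ^ L = 0 \<longleftrightarrow> T < b ^ L" by (simp add: div_eq_0_iff)
  moreover have "run (summand s) \<sigma> = set_reg rRes (reg (run (validate s) \<tau>) rRes +
      reg (run (validate s) \<tau>) rOk * reg (run (validate s) \<tau>) rProd) (run (validate s) \<tau>)"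
    by (simp add: summand_def \<tau>_def)
  moreover have "reg (run (validate s) \<tau>) rRes = reg \<sigma> rRes"
    "reg (run (validate s) \<tau>) rProd = reg (run product \<sigma>) rProd"
    by (simp_all add: run_frame writes_validate writes_accept \<tau>_def writes_product)
  moreover have "reg \<tau> rOk = of_bool (T < b ^ L)"
    using run_product(2)[OF assms] \<open>T div b ^ L = 0 \<longleftrightarrow> T < b ^ L\<close> by (simp add: \<tau>_def)
  ultimately show ?thesis
    using run_product(1)[OF assms] by simp
qed

lemma run_sum_up:
  assumes env: "env cnt \<sigma>" and "reg \<sigma> rRes = 0"
  shows "reg (run (sum_up s) \<sigma>) rRes = (\<Sum>L<E. \<Sum>T<b ^ E.
    if T < b ^ L \<and> valid s m f L T then \<Prod>c<L. cnt (T div b ^ c mod b) else 0)"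
proof -
  let ?s = "\<lambda>L T. if T < b ^ L \<and> valid s m f L T then \<Prod>c<L. cnt (T div b ^ c mod b) else 0"
  let ?I = "\<lambda>l \<tau>. env cnt \<tau> \<and> reg \<tau> rRes = (\<Sum>L<l. \<Sum>T<b ^ E. ?s L T)"
  have "?I E (run (For rL (Reg rE) (For rTT (Reg rBE) (summand s))) \<sigma>)"
  proof (rule run_For[where I = ?I])
    fix l \<tau> assume l: "l < E" "?I l \<tau>" "reg \<tau> rL = l"
    let ?J = "\<lambda>t \<tau>'. env cnt \<tau>' \<and> reg \<tau>' rL = l \<and> reg \<tau>' rRes = reg \<tau> rRes + (\<Sum>T<t. ?s l T)"
    have "?J (b ^ E) (run (For rTT (Reg rBE) (summand s)) \<tau>)"
    proof (rule run_For[where I = ?J])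
      fix t \<tau>' assume t: "?J t \<tau>'" "reg \<tau>' rTT = t"
      have "env cnt (run (summand s) \<tau>')"
        using t by (subst env_run) (auto simp: writes_summand writes_validate writes_accept writes_product)
      then show "?J (Suc t) (set_reg rTT (Suc t) (run (summand s) \<tau>'))"
        using t run_summand[of cnt \<tau>' t l] l(1)
        by (simp add: run_frame writes_summand writes_validate writes_accept writes_product)
    qed (use l in \<open>auto simp: env_def\<close>)
    then show "?I (Suc l) (set_reg rL (Suc l) (run (For rTT (Reg rBE) (summand s)) \<tau>))"
      using l by (simp del: run.simps(5))
  qed (use assms in \<open>auto simp: env_def\<close>)
  then show ?thesis by (simp add: sum_up_def del: run.simps(5))
qed

end

section \<open>Reading the formula\<close>

text \<open>
  A formula is a prefix code: \<open>rNeed\<close> counts the subformulas that still have to be read.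
\<close>

definition parse_loop :: com where
  "parse_loop = While (Reg rNeed) (Cond (Mem (Reg rE))
    (com.Seq (Assign rE (Reg rE \<oplus> Num 1)) (Assign rNeed (Reg rNeed \<oplus> Num 1)))
    (com.Seq (Assign rE (Reg rE \<oplus> Num 2)) (Assign rNeed (Bin Minus (Reg rNeed) (Num 1)))))"

text \<open>The input does not state where the formula ends, so no loop bound is available and a
  genuine \<open>While\<close> is required. The end found here is the value \<open>E\<close> in
  \<open>rE\<close> that bounds later loops.\<close>

definition parse :: com where
  "parse = com.Seq (Assign rE (Num 1)) (com.Seq (Assign rNeed (Num 1)) parse_loop)"

abbreviation (input) parse_state :: "nat \<Rightarrow> nat \<Rightarrow> state \<Rightarrow> state" where
  "parse_state p q \<sigma> \<equiv> set_reg rNeed q (set_reg rE p \<sigma>)"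

lemma parse_state_overwrite: "set_reg rNeed q (set_reg rE p (parse_state p' q' \<sigma>)) = parse_state p q \<sigma>"
  by (auto simp: set_reg_def fun_upd_twist)

text \<open>One round costs 2 for the loop test, 3 for the branching and 8 for two
  assignments.\<close>

lemma parse_token:
  assumes "p + q + 4 < 2 ^ w" "mem \<sigma> p < 2 ^ w"
    and "exec w parse_loop (if mem \<sigma> p = 0 then parse_state (p + 2) q \<sigma>
      else parse_state (p + 1) (q + 2) \<sigma>) t \<tau>"
  shows "exec w parse_loop (parse_state p (q + 1) \<sigma>) (13 + t) \<tau>"
proof -
  let ?\<sigma> = "parse_state p (q + 1) \<sigma>"
  let ?\<sigma>' = "if mem \<sigma> p = 0 then parse_state (p + 2) q \<sigma> else parse_state (p + 1) (q + 2) \<sigma>"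
  let ?c1 = "com.Seq (Assign rE (Reg rE \<oplus> Num 1)) (Assign rNeed (Reg rNeed \<oplus> Num 1))"
  let ?c2 = "com.Seq (Assign rE (Reg rE \<oplus> Num 2)) (Assign rNeed (Bin Minus (Reg rNeed) (Num 1)))"
  let ?c = "Cond (Mem (Reg rE)) ?c1 ?c2"
  have p1: "well_formed (Asg rE (Reg rE \<oplus> Num 1) ;; Asg rNeed (Reg rNeed \<oplus> Num 1))"
    and p2: "well_formed (Asg rE (Reg rE \<oplus> Num 2) ;; Asg rNeed (Bin Minus (Reg rNeed) (Num 1)))"
    by simp_all
  have "exec w ?c1 ?\<sigma> 8 (parse_state (p + 1) (q + 2) \<sigma>)"
    using exec_com_of[OF p1, of w ?\<sigma>] assms(1) parse_state_overwrite[of "q + 2" "p + 1" "q + 1" p \<sigma>]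
    by (simp add: numeral_eq_Suc)
  moreover have "exec w ?c2 ?\<sigma> 8 (parse_state (p + 2) q \<sigma>)"
    using exec_com_of[OF p2, of w ?\<sigma>] assms(1) parse_state_overwrite[of q "p + 2" "q + 1" p \<sigma>]
    by (simp add: numeral_eq_Suc)
  ultimately have "exec w ?c ?\<sigma> (1 + 2 + 8) ?\<sigma>'"
    using exec.Cond_true[of w ?\<sigma> "Mem (Reg rE)" ?c1 8 _ ?c2]
      exec.Cond_false[of w ?\<sigma> "Mem (Reg rE)" ?c2 8 _ ?c1] assms(1,2)
    by (auto simp: numeral_eq_Suc)
  then have "exec w parse_loop ?\<sigma> (1 + 1 + (1 + 2 + 8) + t) \<tau>"
    using exec.While_true[of w ?\<sigma> "Reg rNeed" ?c "1 + 2 + 8" ?\<sigma>' t \<tau>] assms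
    by (simp add: parse_loop_def)
  then show ?thesis by (simp add: numeral_eq_Suc)
qed

text \<open>A big-step semantics cannot speak of a loop run halfway, so the lemma prepends the
  reading of one subformula to a given run of the loop. Accordingly the second operand is treated
  before the first.\<close>

lemma parse_formula:
  assumes "\<And>x. x < length (encode_formula f) \<Longrightarrow> mem \<sigma> (p + x) = encode_formula f ! x"
    and "\<And>a. mem \<sigma> a < 2 ^ w" "p + length (encode_formula f) + q + 4 < 2 ^ w"
    and "exec w parse_loop (parse_state (p + length (encode_formula f)) q \<sigma>) t \<tau>"
  shows "\<exists>t'\<le>t + 13 * length (encode_formula f). exec w parse_loop (parse_state p (q + 1) \<sigma>) t' \<tau>"
  using assms
proof (induction f arbitrary: p q t rule: node_induct)
  case (Input i)
  have "mem \<sigma> p = 0" using Input(1)[of 0] by simp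
  then have "exec w parse_loop (parse_state p (q + 1) \<sigma>) (13 + t) \<tau>"
    using Input by (intro parse_token) auto
  then show ?case by (intro exI[of _ "13 + t"]) simp
next
  case (node tok f1 f2)
  let ?l1 = "length (encode_formula f1)" and ?l2 = "length (encode_formula f2)"
  note enc = encode_node[OF node.hyps, of f1 f2]
  have tok: "mem \<sigma> p = tok" using node.prems(1)[of 0] by (simp add: enc)
  have e1: "mem \<sigma> (p + 1 + x) = encode_formula f1 ! x" if "x < ?l1" for x
    using node.prems(1)[of "Suc x"] that by (simp add: enc nth_append)
  have e2: "mem \<sigma> (p + 1 + ?l1 + x) = encode_formula f2 ! x" if "x < ?l2" for x
    using node.prems(1)[of "Suc (?l1 + x)"] that by (simp add: enc nth_append add.assoc)
  have l2: "2 \<le> ?l2" by (simp add: length_encode_formula)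
  obtain t2 where t2: "t2 \<le> t + 13 * ?l2"
    "exec w parse_loop (parse_state (p + 1 + ?l1) (q + 1) \<sigma>) t2 \<tau>"
    using node.IH(2)[of "p + 1 + ?l1" q t] e2 node.prems by (auto simp: enc add.assoc)
  obtain t1 where t1: "t1 \<le> t2 + 13 * ?l1"
    "exec w parse_loop (parse_state (p + 1) (q + 1 + 1) \<sigma>) t1 \<tau>"
    using node.IH(1)[of "p + 1" "q + 1" t2] e1 node.prems t2 l2 by (auto simp: enc)
  have "exec w parse_loop (parse_state p (q + 1) \<sigma>) (13 + t1) \<tau>"
    using node.prems t1 node.hyps by (intro parse_token) (auto simp: enc tok)
  then show ?case using t1 t2 by (intro exI[of _ "13 + t1"]) (simp add: enc)
qed

lemma exec_parse:
  assumes "\<And>x. x < length (encode_formula f) \<Longrightarrow> mem \<sigma> (1 + x) = encode_formula f ! x"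
    and "\<And>a. mem \<sigma> a < 2 ^ w" "length (encode_formula f) + 5 < 2 ^ w"
  shows "\<exists>t\<le>6 + 13 * length (encode_formula f).
    exec w parse \<sigma> t (parse_state (1 + length (encode_formula f)) 0 \<sigma>)"
proof -
  let ?\<tau> = "parse_state (1 + length (encode_formula f)) 0 \<sigma>"
  have "exec w parse_loop ?\<tau> (1 + 1) ?\<tau>"
    unfolding parse_loop_def using exec.While_false[of w ?\<tau> "Reg rNeed"] by simp
  then obtain t where t: "t \<le> 1 + 1 + 13 * length (encode_formula f)"
    "exec w parse_loop (parse_state 1 (0 + 1) \<sigma>) t ?\<tau>"
    using parse_formula[OF assms(1,2), of 0 "1 + 1" ?\<tau>] assms(3) by auto
  have 1: "exec w (Assign rE (Num 1)) \<sigma> 2 (set_reg rE 1 \<sigma>)"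
    using exec.Assign[of w \<sigma> "Num 1" rE] assms(3) by (simp add: set_reg_def numeral_eq_Suc)
  have 2: "exec w (Assign rNeed (Num 1)) (set_reg rE 1 \<sigma>) 2 (parse_state 1 1 \<sigma>)"
    using exec.Assign[of w "set_reg rE 1 \<sigma>" "Num 1" rNeed] assms(3)
    by (simp add: set_reg_def numeral_eq_Suc)
  have "exec w parse \<sigma> (2 + (2 + t)) ?\<tau>"
    unfolding parse_def using t(2) by (intro exec.Seq[OF 1 exec.Seq[OF 2]]) simp
  then show ?thesis using t(1) by (intro exI[of _ "2 + (2 + t)"]) simp
qed

section \<open>The encoding of the input\<close>

lemma nth_concat:
  assumes "i < length xss" "r < length (xss ! i)"
  shows "concat xss ! ((\<Sum>j<i. length (xss ! j)) + r) = xss ! i ! r"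
  using assms
proof (induction xss arbitrary: i)
  case (Cons xs xss)
  then show ?case
    by (cases i) (auto simp: nth_append sum.lessThan_Suc_shift add.assoc simp del: sum.lessThan_Suc)
qed simp

lemma length_concat_sum: "length (concat xss) = (\<Sum>j<length xss. length (xss ! j))"
  by (induction xss) (auto simp: sum.lessThan_Suc_shift simp del: sum.lessThan_Suc)

lemma nth_concat_map:
  assumes "\<And>x. length (F x) = n" "j < length xs" "k < n"
  shows "concat (map F xs) ! (j * n + k) = F (xs ! j) ! k"
  using nth_concat[of j "map F xs" k] assms by simp

lemma length_concat_map: "(\<And>x. length (F x) = n) \<Longrightarrow> length (concat (map F xs)) = length xs * n"
  by (induction xs) auto

lemma card_inputs_le: "card (inputs f) \<le> operations f + 1"
proof (induction f rule: node_induct)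
  case (node tok f1 f2)
  have "card (inputs (node tok f1 f2)) \<le> card (inputs f1) + card (inputs f2)"
    by (simp add: card_Un_le)
  then show ?case using node by simp
qed simp

lemma encode_formula_le: "inputs f \<subseteq> {..<k} \<Longrightarrow> x \<in> set (encode_formula f) \<Longrightarrow> x \<le> k + 3"
  by (induction f) auto

text \<open>The last property bounds all words of the input: tokens are at most 3, indices are below
  the number of graphs, and matrix entries are bits.\<close>

lemma encodings_obtain:
  assumes "factored_graph f Gs" "encodes_factored_graph ws f Gs" "1 \<le> s"
  obtains vss where "encoded_input f Gs vss s"
    "encoded_input.input_mem f Gs vss (mem (initial_state ws))"
    "length ws = encoded_input.off f vss (length Gs)"
    "\<And>x. x \<in> set ws \<Longrightarrow> x \<le> length Gs + 3 \<or> (\<exists>i<length Gs. x = length (vss ! i) \<or> x \<in> set (vss ! i))"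
proof -
  obtain wss where wss: "list_all2 encodes_graph wss Gs"
    and ws: "ws = length Gs # encode_formula f @ concat wss"
    using assms(2) unfolding encodes_factored_graph_def by blast
  have len: "length wss = length Gs" using wss by (rule list_all2_lengthD)
  let ?adj = "\<lambda>i vs v. map (\<lambda>u. of_bool ((v, u) \<in> parcs (Gs ! i))) vs :: nat list"
  have "\<exists>vs. distinct vs \<and> set vs = pverts (Gs ! i) \<and>
      wss ! i = length vs # vs @ concat (map (?adj i vs) vs)" if "i < length Gs" for i
    using list_all2_nthD2[OF wss that] unfolding encodes_graph_def by simp
  then obtain vs where vs: "\<And>i. i < length Gs \<Longrightarrow> distinct (vs i) \<and> set (vs i) = pverts (Gs ! i) \<and>
      wss ! i = length (vs i) # vs i @ concat (map (?adj i (vs i)) (vs i))" by metis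
  define vss where "vss = map vs [0..<length Gs]"
  have vss: "vss ! i = vs i" if "i < length Gs" for i using that by (simp add: vss_def)
  interpret encoded_input f Gs vss s
  proof
    show "parcs (Gs ! i) \<subseteq> pverts (Gs ! i) \<times> pverts (Gs ! i)" if "i < length Gs" for i
    proof -
      interpret pair_pseudo_graph "Gs ! i" using assms(1) that by (simp add: factored_graph_def)
      show ?thesis using arc_fst_in_verts arc_snd_in_verts by fastforce
    qed
  qed (use assms vs in \<open>auto simp: vss_def factored_graph_def\<close>)
  have wss_nth: "wss ! i = n i # vss ! i @ concat (map (?adj i (vss ! i)) (vss ! i))" if "i < m" for i
    using vs[OF that] vss[OF that] by (simp add: n_def)
  have len_wss: "length (wss ! i) = 1 + n i + n i * n i" if "i < m" for i
    using wss_nth[OF that] length_concat_map[of "?adj i (vss ! i)" "n i" "vss ! i"] by (simp add: n_def)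
  have off: "off i = E + (\<Sum>j<i. length (wss ! j))" if "i \<le> m" for i
    unfolding off_def using that len_wss by (intro arg_cong2[of _ _ _ _ "(+)"] sum.cong) auto
  have mem: "mem (initial_state ws) a = (if a < length ws then ws ! a else 0)" for a
    by (simp add: initial_state_def)
  have len_ws: "length ws = A"
    using off[of m] by (simp add: ws length_concat_sum len)
  have mem_off: "mem (initial_state ws) (off i + r) = wss ! i ! r" if "i < m" "r < length (wss ! i)" for i r
  proof -
    have "off i + r < A" using off_Suc_le[OF that(1)] that len_wss by simp
    moreover have "ws ! (off i + r) = concat wss ! ((\<Sum>j<i. length (wss ! j)) + r)"
      using that(1) off[of i] by (simp add: ws nth_append)
    ultimately show ?thesis using that len nth_concat[of i wss r] by (simp add: mem len_ws)
  qed
  have "input_mem (mem (initial_state ws))"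
    unfolding input_mem_def
  proof (intro conjI allI impI)
    show "mem (initial_state ws) 0 = m" unfolding mem by (simp add: ws)
    show "mem (initial_state ws) (Suc x) = encode_formula f ! x" if "x < length (encode_formula f)" for x
      using that unfolding mem by (simp add: ws nth_append)
    fix i assume i: "i < m"
    note w = wss_nth[OF i] and l = len_wss[OF i]
    show "mem (initial_state ws) (off i) = n i"
      using mem_off[OF i, of 0] l w by simp
    fix j assume j: "j < n i"
    then show "mem (initial_state ws) (Suc (off i + j)) = vss ! i ! j"
      using mem_off[OF i, of "Suc j"] l w by (simp add: nth_append n_def)
    fix k assume k: "k < n i"
    have "j * n i + k < Suc j * n i" "Suc j * n i \<le> n i * n i"
      using j k by (simp, intro mult_le_mono1, simp)
    then have jk: "j * n i + k < n i * n i" by linarith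
    have "concat (map (?adj i (vss ! i)) (vss ! i)) ! (j * n i + k) =
        ?adj i (vss ! i) (vss ! i ! j) ! k"
      using j k by (intro nth_concat_map) (simp_all add: n_def)
    then have "wss ! i ! Suc (n i + (j * n i + k)) = of_bool ((vss ! i ! j, vss ! i ! k) \<in> parcs (Gs ! i))"
      using k unfolding w by (simp add: nth_append n_def)
    then show "mem (initial_state ws) (Suc (off i + n i + j * n i + k)) =
        of_bool ((vss ! i ! j, vss ! i ! k) \<in> parcs (Gs ! i))"
      using mem_off[OF i, of "Suc (n i + (j * n i + k))"] l jk by (simp add: add.assoc)
  qed
  moreover have "x \<le> m + 3 \<or> (\<exists>i<m. x = length (vss ! i) \<or> x \<in> set (vss ! i))" if x: "x \<in> set ws" for x
  proof -
    consider "x = m" | "x \<in> set (encode_formula f)" | "x \<in> set (concat wss)"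
      using x by (auto simp: ws)
    then show ?thesis
    proof cases
      case 2
      then show ?thesis using encode_formula_le[of f m x] inputs by simp
    next
      case 3
      then obtain xs where "xs \<in> set wss" "x \<in> set xs" by auto
      then obtain i where i: "i < m" "x \<in> set (wss ! i)" using len by (auto simp: in_set_conv_nth[of xs])
      then show ?thesis unfolding wss_nth[OF i(1)] by (auto simp: n_def)
    qed simp
  qed
  ultimately show ?thesis using that[OF encoded_input_axioms] len_ws by blast
qed

section \<open>Running time and word length\<close>

lemma static_time_mono:
  "(\<And>q. q \<in> bound_regs p \<Longrightarrow> \<rho> q \<le> \<rho>' q) \<Longrightarrow> static_time \<rho> p \<le> static_time \<rho>' p"
proof (induction p)
  case (For r e p)
  then have "bound_value \<rho> e \<le> bound_value \<rho>' e" by (cases e) auto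
  moreover have "static_time \<rho> p \<le> static_time \<rho>' p" using For by auto
  ultimately show ?case by (auto intro!: mult_le_mono add_mono)
qed (auto intro: add_mono)

text \<open>The summand 10 is the time of the assignment that advances \<open>rPtr\<close> to the
  next graph; the cost of \<open>power_exp\<close> is for the assignment to
  \<open>rUS\<close>.\<close>

definition time0 :: "nat \<Rightarrow> nat \<Rightarrow> nat" where
  "time0 s k = static_time (\<lambda>_. k) fill_step + static_time (\<lambda>_. k) walk +
    static_time (\<lambda>_. k) (count_tuple s) + cost (power_exp (Reg rU) s) + 10"

definition time1 :: "nat \<Rightarrow> nat \<Rightarrow> nat" where
  "time1 s k = static_time (\<lambda>_. 3 * k) (init2 s)"

definition time2 :: "nat \<Rightarrow> nat \<Rightarrow> nat" where
  "time2 s k = static_time (\<lambda>q. if q = rBE then (4 ^ (s * s * k)) ^ (3 * k)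
     else if q = rTE then 2 ^ (3 * k) else 3 * k) (sum_up s)"

text \<open>Reading the formula accounts for \<open>6 + 39 * k\<close>. Four short parts and the
  entry of two loops give \<open>4 * time0 s k + 12\<close>; the factor of \<open>k\<close> comes
  from filling the tables, that of \<open>k ^ s\<close> from counting at most
  \<open>(k * n) ^ s\<close> tuples.\<close>

definition total_time :: "nat \<Rightarrow> nat \<Rightarrow> nat" where
  "total_time s k = 6 + 39 * k + 4 * time0 s k + 12 + k * (14 + (8 + time0 s k) + 2 * time0 s k) +
    k ^ s * (8 + time0 s k) + time1 s k + time2 s k"

text \<open>The input takes at most \<open>3 * k + 3 * k * N ^ 2\<close> cells, hence
  \<open>6 * k\<close>; \<open>s * s + 4\<close> covers the constants in the programs. The exponent
  is taken equal to the factor, as it only has to be at least 2 and at least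
  \<open>s\<close>.\<close>

definition value_bound :: "nat \<Rightarrow> nat \<Rightarrow> nat \<Rightarrow> nat" where
  "value_bound s k N = ((6 * k + s * s + 4) * N) ^ (6 * k + s * s + 4)"

text \<open>\<open>z ^ d * N ^ d\<close> is the tower over \<open>value_bound\<close> for all three
  times together. The summand \<open>d\<close> makes the exponent of \<open>N\<close> large enough,
  and \<open>10 * k + 10\<close> gives strictness and room for the numbers used while reading the
  formula.\<close>

definition word_bound :: "nat \<Rightarrow> nat \<Rightarrow> nat" where
  "word_bound s k = (let z = 6 * k + s * s + 4;
      d = z * 2 ^ (time0 s k + time1 s k + time2 s k) in z ^ d + d + 10 * k + 10)"

definition clique_program :: "nat \<Rightarrow> com" where
  "clique_program s = com.Seq parse (com_of (phase1 s ;; init2 s ;; sum_up s))"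

lemma tower_value_bound_less:
  assumes "1 \<le> N" "word_bound s k * N ^ word_bound s k \<le> 2 ^ w"
  shows "tower (value_bound s k N) (time0 s k + time1 s k + time2 s k) < 2 ^ w"
proof -
  let ?z = "6 * k + s * s + 4" and ?t = "time0 s k + time1 s k + time2 s k"
  let ?d = "?z * 2 ^ ?t"
  have "tower (value_bound s k N) ?t = ?z ^ ?d * N ^ ?d"
    by (simp add: tower_def value_bound_def power_mult_distrib power_mult[symmetric])
  also have "\<dots> < word_bound s k * N ^ ?d"
    using assms(1) by (intro mult_strict_right_mono) (auto simp: word_bound_def Let_def)
  also have "\<dots> \<le> word_bound s k * N ^ word_bound s k"
    using assms(1) by (intro mult_le_mono2 power_increasing) (auto simp: word_bound_def Let_def)
  finally show ?thesis using assms(2) by linarith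
qed

lemma value_bound_ge:
  assumes "1 \<le> N" "j \<le> 6 * k + s * s + 4" "x \<le> ((6 * k + s * s + 4) * N) ^ j"
  shows "x \<le> value_bound s k N"
  using assms(3) power_increasing[OF assms(2), of "(6 * k + s * s + 4) * N"] assms(1)
  unfolding value_bound_def by simp

lemma well_formed_clique_program: "well_formed (phase1 s ;; init2 s ;; sum_up s)"
  by (simp add: phase1_def walk_def fill_def fill_graph_def fill_step_def count_tuples_def
      count_tuple_def tuple_code_def load_entry_def digit_step_def clear_def shift_def init2_def
      pow_def sum_up_def summand_def product_def validate_def check_def accept_def
      try_choices_def pass_step_def)

lemma exec_com_of_ok:
  "well_formed p \<Longrightarrow> ok w T p \<sigma> Q \<Longrightarrow> \<exists>t\<le>T. \<exists>\<tau>. exec w (com_of p) \<sigma> t \<tau> \<and> Q \<tau>"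
  unfolding ok_def using exec_com_of by blast

lemma consts_of_sum_up: "c \<in> consts_of (sum_up s) \<Longrightarrow> c \<le> s * s + 4"
  by (auto simp: sum_up_def summand_def product_def validate_def check_def accept_def
      try_choices_def pass_step_def shift_def intro: trans_le_add1)

lemma consts_of_init2: "c \<in> consts_of (init2 s) \<Longrightarrow> c \<le> s * s + 4"
  by (auto simp: init2_def pow_def)

lemma well_formed_init2: "well_formed (init2 s)" and well_formed_sum_up: "well_formed (sum_up s)"
  using well_formed_clique_program[of s] by simp_all

lemma bound_regs_init2: "bound_regs (init2 s) = {rM, rE}"
  and writes_init2: "writes (init2 s) = {rFM, rB, rBE, rTE, rZ}"
  and storeless_init2: "storeless (init2 s)"
  by (auto simp: init2_def pow_def)

lemma bound_regs_sum_up: "bound_regs (sum_up s) \<subseteq> {rM, rE, rBE, rTE}"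
  by (auto simp: sum_up_def summand_def product_def validate_def check_def accept_def
      try_choices_def pass_step_def)

lemma writes_sum_up: "writes (sum_up s) \<inter> {rM, rE, rBE, rTE} = {}"
  by (auto simp: sum_up_def writes_summand writes_validate writes_accept writes_product)

context bounded_input begin

text \<open>The running time depends on \<open>s\<close> and \<open>k\<close> only, so unlike in the
  first phase no invariant has to bound numbers: the static time and the tower bound give safety,
  and partial correctness gives the result.\<close>

lemma ok_phase2:
  assumes inv: "count_inv U (length U ^ s) \<sigma>" and U: "distinct U" "set U = (\<Union>G\<in>set Gs. pverts G)"
    and k: "m \<le> k" "E \<le> 3 * k" and tower: "tower M (time1 s k + time2 s k) < 2 ^ w"
  shows "ok w (time1 s k + time2 s k) (init2 s ;; sum_up s) \<sigma>
    (\<lambda>\<tau>. reg \<tau> rRes = card (clique_tuples s (denoted_graph f Gs)))"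
proof (rule ok_Sq)
  let ?T1 = "time1 s k" and ?T2 = "time2 s k"
  let ?cnt = "\<lambda>\<tau>. card {t \<in> {..<length U ^ s}. col_code Gs s U t = \<tau>}"
  let ?R = "\<lambda>\<tau>. env ?cnt \<tau> \<and> reg \<tau> rRes = 0 \<and> bounded_by (tower M ?T1) \<tau>"
  have t1: "tower M ?T1 < 2 ^ w"
    using tower_mono[OF M_ge(1), of ?T1 "?T1 + ?T2"] tower by simp
  show "ok w ?T1 (init2 s) \<sigma> ?R"
  proof (rule ok_weaken[OF ok_if_bounded[of _ M _ "\<lambda>_. 3 * k"]])
    show "reg \<sigma> q \<le> 3 * k" if "q \<in> bound_regs (init2 s)" for q
      using that inv k by (auto simp: bound_regs_init2 count_inv_def)
    show "consts_of (init2 s) \<subseteq> {..M}"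
      using consts_of_init2[of _ s] M_ge(2) by (auto intro: order_trans)
    fix \<tau> assume "\<tau> = run (init2 s) \<sigma> \<and> bounded_by (tower M ?T1) \<tau>"
    then have \<tau>: "\<tau> = run (init2 s) \<sigma>" and "bounded_by (tower M ?T1) (run (init2 s) \<sigma>)" by auto
    then show "?R \<tau>"
      using inv run_init2[of \<sigma> m E s] unfolding \<tau>
      by (simp add: env_def count_inv_def run_frame writes_init2 mem_run storeless_init2 filled_def)
  qed (use inv t1 M_ge(1) in \<open>auto simp: well_formed_init2 time1_def bound_regs_init2 writes_init2
      count_inv_def\<close>)
  fix \<tau> assume \<tau>: "?R \<tau>"
  show "ok w ?T2 (sum_up s) \<tau> (\<lambda>\<tau>. reg \<tau> rRes = card (clique_tuples s (denoted_graph f Gs)))"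
  proof (rule ok_weaken[OF ok_if_bounded[of _ "tower M ?T1" _ "\<lambda>q. if q = rBE then (4 ^ (s * s * k)) ^ (3 * k)
     else if q = rTE then 2 ^ (3 * k) else 3 * k"]])
    show "consts_of (sum_up s) \<subseteq> {..tower M ?T1}"
      using consts_of_sum_up[of _ s] M_ge(2) tower_ge[OF M_ge(1), of ?T1]
      by (meson atMost_iff order_trans subsetI)
    show "2 \<le> tower M ?T1" using M_ge(1) tower_ge[OF M_ge(1), of ?T1] by linarith
    show "bound_regs (sum_up s) \<inter> writes (sum_up s) = {}"
      using bound_regs_sum_up writes_sum_up by blast
    have "(4::nat) ^ (s * s * m * E) \<le> 4 ^ (s * s * k * (3 * k))"
      using k by (intro power_increasing mult_le_mono) auto
    moreover have "(2::nat) ^ E \<le> 2 ^ (3 * k)" using k(2) by (intro power_increasing) auto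
    ultimately show "reg \<tau> q \<le> (if q = rBE then (4 ^ (s * s * k)) ^ (3 * k)
        else if q = rTE then 2 ^ (3 * k) else 3 * k)" if "q \<in> bound_regs (sum_up s)" for q
      using that bound_regs_sum_up[of s] \<tau> k
      by (auto simp: env_def power_mult[symmetric] simp del: power_Suc)
    fix \<tau>' assume "\<tau>' = run (sum_up s) \<tau> \<and> bounded_by (tower (tower M ?T1) ?T2) \<tau>'"
    moreover have "operations f + 1 < E" by (simp add: length_encode_formula)
    ultimately show "reg \<tau>' rRes = card (clique_tuples s (denoted_graph f Gs))"
      using run_sum_up[of ?cnt \<tau>] \<tau> card_clique_tuples[OF _ s U, of f E] inputs by simp
  qed (use \<tau> tower in \<open>auto simp: well_formed_sum_up time2_def tower_tower\<close>)
qed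

end

section \<open>Assembling the phases: time, word length and result of the whole program\<close>

lemma exec_clique_program:
  assumes s: "1 \<le> s" and n: "1 \<le> n" and fg: "factored_graph f Gs" "has_complexity f Gs n k"
    "encodes_factored_graph ws f Gs" and N: "n \<le> N" "\<forall>G\<in>set Gs. \<forall>v\<in>pverts G. v \<le> N"
    and w: "word_bound s k * N ^ word_bound s k \<le> 2 ^ w"
  shows "\<exists>t \<tau>. exec w (clique_program s) (initial_state ws) t \<tau> \<and> t \<le> total_time s k * n ^ s \<and>
    reg \<tau> 0 = card (clique_tuples s (denoted_graph f Gs))"
proof -
  obtain vss where enc: "encoded_input f Gs vss s"
    and mem: "encoded_input.input_mem f Gs vss (mem (initial_state ws))"
    and len: "length ws = encoded_input.off f vss (length Gs)"
    and ws: "\<And>x. x \<in> set ws \<Longrightarrow> x \<le> length Gs + 3 \<or>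
      (\<exists>i<length Gs. x = length (vss ! i) \<or> x \<in> set (vss ! i))"
    using encodings_obtain[OF fg(1,3) s] by blast
  interpret encoded_input f Gs vss s by (rule enc)
  let ?z = "6 * k + s * s + 4" and ?M = "value_bound s k N" and ?c = "time0 s k"
  let ?T = "?c + time1 s k + time2 s k"
  have N1: "1 \<le> N" using n N by simp
  have k: "operations f + 1 = k" using fg(2) by (simp add: has_complexity_def)
  have m: "m \<le> k" using card_inputs_le[of f] k by (simp add: inputs)
  have E: "E = 3 * k" using k by (auto simp: length_encode_formula)
  have n_le: "encoded_input.n vss i \<le> n" if "i < m" for i
  proof -
    have "card (pverts (Gs ! i)) \<le> n" using fg(2) that by (simp add: has_complexity_def)
    then show ?thesis using distinct_card[OF distinct_vss[OF that]] set_vss[OF that] by (simp add: n_def)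
  qed
  have vss_N: "v \<le> N" if "i < m" "v \<in> set (vss ! i)" for i v
    using N(2) that set_vss[OF that(1)] by auto
  have zN: "?z \<le> ?z * N" using N1 by simp
  have NzN: "N \<le> ?z * N" using mult_le_mono1[of 1 ?z N] by simp
  have M1: "x \<le> ?M" if "x \<le> ?z * N" for x
    using value_bound_ge[OF N1, of 1 k s x] that by simp
  have A: "A \<le> ?M"
  proof (rule value_bound_ge[OF N1])
    have "1 + encoded_input.n vss i + encoded_input.n vss i * encoded_input.n vss i \<le> 3 * (N * N)"
      if "i < m" for i
    proof -
      have "encoded_input.n vss i \<le> N" using n_le[OF that] N by simp
      then have "encoded_input.n vss i * encoded_input.n vss i \<le> N * N" "encoded_input.n vss i \<le> N * N" "1 \<le> N * N"
        using N1 by (auto intro: mult_le_mono order_trans[OF _ le_square])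
      then show ?thesis by linarith
    qed
    then have "A \<le> 3 * k + m * (3 * (N * N))"
      using sum_bounded_above[of "{..<m}" "\<lambda>i. 1 + encoded_input.n vss i + encoded_input.n vss i * encoded_input.n vss i" "3 * (N * N)"]
      unfolding off_def E by simp
    also have "\<dots> \<le> 3 * k * (N * N) + k * (3 * (N * N))"
    proof (rule add_mono)
      have "3 * k * 1 \<le> 3 * k * (N * N)" using N1 by (intro mult_le_mono2) simp
      then show "3 * k \<le> 3 * k * (N * N)" by simp
    qed (use m in simp)
    also have "\<dots> = 6 * k * (N * N)" by simp
    also have "\<dots> \<le> (?z * ?z) * (N * N)" by (intro mult_le_mono1) (simp add: algebra_simps)
    finally show "A \<le> (?z * N) ^ 2" by (simp add: power2_eq_square mult_ac)
  qed simp
  have us: "(\<Sum>i<m. encoded_input.n vss i) ^ s \<le> ?M"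
  proof (rule value_bound_ge[OF N1])
    have "(\<Sum>i<m. encoded_input.n vss i) \<le> m * n"
      using sum_bounded_above[of "{..<m}" "encoded_input.n vss" n] n_le by simp
    also have "\<dots> \<le> ?z * N" using m N by (intro mult_le_mono) auto
    finally show "(\<Sum>i<m. encoded_input.n vss i) ^ s \<le> (?z * N) ^ s" by (intro power_mono) auto
    show "s \<le> ?z" using le_square[of s] by linarith
  qed
  have tower: "tower ?M ?T < 2 ^ w" by (rule tower_value_bound_less[OF N1 w])
  have M2: "2 \<le> ?M" using zN by (intro M1) linarith
  have st: "static_time (\<lambda>_. m) p \<le> static_time (\<lambda>_. k) p" for p
    using m by (intro static_time_mono)
  interpret bounded_input f Gs vss s ?M w ?c
  proof
    show "tower ?M ?c < 2 ^ w" using tower_mono[OF M2, of ?c ?T] tower by simp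
    show "s * s + 4 \<le> ?M" using zN by (intro M1) linarith
    show "v \<le> ?M" if "i < m" "v \<in> set (vss ! i)" for i v
      using vss_N[OF that] NzN by (intro M1) linarith
    show "static_time (\<lambda>_. m) fill_step \<le> ?c" "static_time (\<lambda>_. m) walk \<le> ?c"
      "static_time (\<lambda>_. m) (count_tuple s) \<le> ?c"
      using st[of fill_step] st[of walk] st[of "count_tuple s"] unfolding time0_def by linarith+
  qed (use A us M2 in \<open>auto simp: time0_def\<close>)
  let ?\<sigma> = "initial_state ws" and ?\<sigma>1 = "parse_state E 0 (initial_state ws)"
  have mem_le: "mem ?\<sigma> a \<le> ?M" for a
  proof (cases "a < length ws")
    case True
    then have "ws ! a \<in> set ws" by simp
    from ws[OF this] have "ws ! a \<le> ?z * N"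
    proof
      assume "ws ! a \<le> m + 3"
      then show ?thesis using m zN by linarith
    next
      assume "\<exists>i<m. ws ! a = length (vss ! i) \<or> ws ! a \<in> set (vss ! i)"
      then have "ws ! a \<le> N" using vss_N n_le N(1) by (fastforce simp: n_def)
      then show ?thesis using NzN by linarith
    qed
    then show ?thesis using True by (simp add: initial_state_def M1)
  qed (simp add: initial_state_def)
  have "\<exists>t\<le>6 + 13 * length (encode_formula f). exec w parse ?\<sigma> t ?\<sigma>1"
  proof (rule exec_parse)
    show "mem ?\<sigma> (1 + x) = encode_formula f ! x" if "x < length (encode_formula f)" for x
      using mem that by (simp add: input_mem_def)
    show "mem ?\<sigma> a < 2 ^ w" for a using mem_le[of a] M_less by simp
    have "length (encode_formula f) + 5 < word_bound s k * 1"
      using E by (simp add: word_bound_def Let_def)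
    also have "\<dots> \<le> word_bound s k * N ^ word_bound s k"
      using N1 by (intro mult_le_mono2) simp
    finally show "length (encode_formula f) + 5 < 2 ^ w" using w by linarith
  qed
  then obtain t0 where "t0 \<le> 6 + 13 * length (encode_formula f)" "exec w parse ?\<sigma> t0 ?\<sigma>1"
    by (elim exE conjE)
  then have t0: "t0 \<le> 6 + 39 * k" "exec w parse ?\<sigma> t0 ?\<sigma>1" using E by simp_all
  let ?G = "denoted_graph f Gs"
  let ?T1 = "?c + (?c + ((?c + (6 + m * (8 + (?c + (6 + n * (8 + ?c) + ?c))))) +
      (?c + (6 + (m * n) ^ s * (8 + ?c)))))"
  have "ok w (?T1 + (time1 s k + time2 s k)) (phase1 s ;; init2 s ;; sum_up s) ?\<sigma>1
      (\<lambda>\<tau>. reg \<tau> rRes = card (clique_tuples s ?G))"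
  proof (rule ok_Sq[OF ok_phase1], goal_cases)
    case 4
    show ?case using mem_le A E
      by (auto simp: bounded_by_def initial_state_def off_def intro: order_trans)
  next
    case (8 \<tau>)
    then obtain U where "distinct U" "set U = (\<Union>G\<in>set Gs. pverts G)" "count_inv U (length U ^ s) \<tau>"
      by blast
    moreover have "tower ?M (time1 s k + time2 s k) < 2 ^ w"
      using tower_mono[OF M2, of "time1 s k + time2 s k" ?T] tower by simp
    ultimately show ?case using m E by (intro ok_phase2) auto
  qed (use mem n_le len in \<open>auto simp: initial_state_def\<close>)
  from exec_com_of_ok[OF well_formed_clique_program this] obtain t1 \<tau> where
    t1: "t1 \<le> ?T1 + (time1 s k + time2 s k)"
      "exec w (com_of (phase1 s ;; init2 s ;; sum_up s)) ?\<sigma>1 t1 \<tau>"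
      "reg \<tau> rRes = card (clique_tuples s ?G)" by blast
  have "exec w (clique_program s) ?\<sigma> (t0 + t1) \<tau>"
    unfolding clique_program_def by (rule exec.Seq[OF t0(2) t1(2)])
  moreover have "t0 + t1 \<le> total_time s k * n ^ s"
  proof -
    let ?x = "n ^ s"
    have x: "1 \<le> ?x" "n \<le> ?x" using n s power_increasing[of 1 s n] by auto
    define a where "a = m * (8 + (?c + (6 + n * (8 + ?c) + ?c)))"
    define b' where "b' = (m * n) ^ s * (8 + ?c)"
    have a: "a \<le> k * ((14 + (8 + ?c) + 2 * ?c) * ?x)"
      unfolding a_def
    proof (intro mult_le_mono m)
      have "n * (8 + ?c) \<le> ?x * (8 + ?c)" "(14 + 2 * ?c) * 1 \<le> (14 + 2 * ?c) * ?x"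
        using x by (intro mult_le_mono; simp)+
      then show "8 + (?c + (6 + n * (8 + ?c) + ?c)) \<le> (14 + (8 + ?c) + 2 * ?c) * ?x"
        by (simp add: algebra_simps)
    qed
    have b': "b' \<le> k ^ s * (8 + ?c) * ?x"
      unfolding b'_def using m by (simp add: power_mult_distrib power_mono)
    have "t0 + t1 \<le> a + b' + (6 + 39 * k + 4 * ?c + 12 + time1 s k + time2 s k) * 1"
      using add_mono[OF t0(1) t1(1)[folded a_def b'_def]] by (simp add: algebra_simps)
    also have "\<dots> \<le> k * ((14 + (8 + ?c) + 2 * ?c) * ?x) + k ^ s * (8 + ?c) * ?x +
        (6 + 39 * k + 4 * ?c + 12 + time1 s k + time2 s k) * ?x"
      using x by (intro add_mono a b' mult_le_mono2)
    finally have "t0 + t1 \<le> k * ((14 + (8 + ?c) + 2 * ?c) * ?x) + k ^ s * (8 + ?c) * ?x +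
        (6 + 39 * k + 4 * ?c + 12 + time1 s k + time2 s k) * ?x" .
    then show ?thesis by (simp add: total_time_def algebra_simps)
  qed
  ultimately show ?thesis using t1(3) by blast
qed

lemma solvable_num_exact_copies:
  assumes "complete_digraph s (with_proj H)" "distinct bs" "set bs = pverts H"
  shows "solvable_in_time (num_exact_copies H bs) (\<lambda>n k. total_time s k * n ^ s)"
proof -
  have copies: "num_exact_copies H bs G = card (clique_tuples s G)" for G :: "nat list pair_pre_digraph"
    by (simp add: num_exact_copies_def exact_copies_clique[OF assms])
  show ?thesis
  \<comment> \<open>For \<open>s = 0\<close> the empty tuple is the only clique, and there is no row
    whose length could serve for sorting. The program is the constant 1, which fits because
    \<open>2 * N ^ 2 \<le> 2 ^ w\<close> and \<open>1 \<le> N\<close>.\<close>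
  proof (cases "s = 0")
    case True
    have "\<exists>t \<tau>. exec w (Assign 0 (Num 1)) (initial_state ws) t \<tau> \<and> t \<le> total_time s k * n ^ s \<and>
        reg \<tau> 0 = card (clique_tuples s G)"
      if "2 * N ^ 2 \<le> 2 ^ w" "1 \<le> n" "n \<le> N"
      for w n N k :: nat and ws and G :: "nat list pair_pre_digraph"
    proof (intro exI conjI)
      have "2 * 1 \<le> 2 * N ^ 2" using that by (intro mult_le_mono2) simp
      then have "1 < (2::nat) ^ w" using that by linarith
      then show "exec w (Assign 0 (Num 1)) (initial_state ws) 2 (set_reg 0 1 (initial_state ws))"
        using exec.Assign[of w "initial_state ws" "Num 1" 0] by (simp add: set_reg_def numeral_eq_Suc)
      show "2 \<le> total_time s k * n ^ s" using True by (simp add: total_time_def)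
      have "clique_tuples s G = {[]}" using True by (auto simp: clique_tuples_def)
      then show "reg (set_reg 0 1 (initial_state ws)) 0 = card (clique_tuples s G)" by simp
    qed
    then show ?thesis
      unfolding solvable_in_time_def copies
      by (intro exI[of _ "Assign 0 (Num 1)"] exI[of _ 1] exI[of _ "\<lambda>_. 2"]) auto
  next
    case False
    then have "1 \<le> s" by simp
    then show ?thesis
      unfolding solvable_in_time_def copies
      by (intro exI[of _ "clique_program s"] exI[of _ 1] exI[of _ "word_bound s"])
        (use exec_clique_program in auto)
  qed
qed

theorem theorem1p2:
  shows "(\<forall>(s :: nat) (H :: 'b pair_pre_digraph) bs.
            complete_digraph s (with_proj H) \<and> distinct bs \<and> set bs = pverts H \<longrightarrow>
            fixed_parameter_tractable (num_exact_copies H bs)) \<and>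
         (\<exists>g :: nat \<Rightarrow> nat \<Rightarrow> nat.
            \<forall>(s :: nat) (H :: 'b pair_pre_digraph) bs.
              complete_digraph s (with_proj H) \<and> distinct bs \<and> set bs = pverts H \<longrightarrow>
              solvable_in_time (num_exact_copies H bs) (\<lambda>n k. g s k * n ^ s))"
  unfolding fixed_parameter_tractable_def using solvable_num_exact_copies by blast

end
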